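(* Let $\mathrm{char}\,\mathbf{F}_q=2$ and let $w \in V_5$. Then \[ \widehat{\Phi}(w) = \begin{cases} q^{-1} + q^{-2} - q^{-3} & \text{if } w=0, \\ q^{-2} - q^{-3} & \text{if } w \text{ has Waring type } \langle 1 \rangle \text{ or } \langle 1^2 \rangle, \\ C(w)\, q^{-4} & \text{in all other cases}, \end{cases} \] where, in the last case, \[ C(w) = -\sum_{\substack{[f_2] \in \mathbf{P}(V^*_2) \\ f_2^2 \in w^\bot}} \varepsilon([f_2]) \] and \[ C(w) \in \begin{cases} \{-1\} & \text{if the Waring type of } w \text{ is } \langle 1, 1 \rangle, \\ \{1\} & \text{if the Waring type of } w \text{ is } \langle 2 \rangle, \\ \{0\} & \text{if the Waring type of } w \text{ is } \langle 1^3 \rangle, \\ \{0, -1\} & \text{if the Waring type of } w \text{ is } \langle 1^2, 1 \rangle, \\ \{0, \pm 1\} & \text{for the other Waring types (namely } \langle 1,1,1\rangle, \langle 2,1\rangle, \langle 3\rangle). \end{cases} \]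
   Context: $\mathbf{F}_q$ is the field with $q$ elements, $q$ a power of the prime $p$ (here $p=2$). $V_n^*$ ($n\ge 0$) is the $\mathbf{F}_q$-vector space of binary forms of degree $n$ in $x,y$ (homogeneous polynomials of degree $n$ in $\mathbf{F}_q[x,y]$), $V_n=(V_n^* )^*$ is its dual space, and $(\cdot,\cdot)\colon V_n\times V_n^*\to\mathbf{F}_q$ is the natural perfect pairing. Fix a nontrivial additive character $\psi\colon\mathbf{F}_q\to\mathbf{C}^\times$. A binary form is singular if it has a repeated factor, equivalently if its discriminant $\mathrm{Disc}$ vanishes (the zero form is counted as singular). Define \[ \widehat{\Phi}(w) = \frac{1}{\# V^*_5} \sum_{\substack{f \in V_5^* \\ \mathrm{Disc}(f) = 0}} \psi((w, f)) \qquad (w \in V_5). \] Polar pairing and apolar ideal: for $0\le m\le n$, $w\in V_n$ and $f_1\in V_m^*$, the element $(w,f_1)\in V_{n-m}$ is defined by $(w,f_1)(f_2)=(w,f_1f_2)$ for $f_2\in V_{n-m}^*$; for $m>n$ one sets $(w,f_1)=0$. For $w\in V_n$, $w^\bot\subseteq\mathbf{F}_q[x,y]$ is the homogeneous ideal of all $f$ with $(w,f)=0$. Splitting type: if a nonzero binary form $f$ factors as $c f_1^{e_1}\cdots f_r^{e_r}$ with $c$ a nonzero constant and pairwise non-proportional irreducible forms $f_i$ over $\mathbf{F}_q$ of degree $d_i$, its splitting type is the symbol $\langle d_1^{e_1},\dots,d_r^{e_r}\rangle$ (exponents equal to $1$ are omitted). Waring type: for $0\ne w\in V_5$, written $w=\sum_{i=0}^5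 a_i (x^{5-i}y^i)^*$ in the basis dual to the monomials, let $s\in\{1,2,3\}$ be the rank of the $3\times 4$ matrix $(a_{i+j})_{0\le i\le 2,\,0\le j\le 3}$. The ideal $w^\bot$ is generated by two forms, of degrees $s$ and $7-s$; the generator $\varphi_s$ of degree $s$ is the nonzero form of smallest degree in $w^\bot$ and is unique up to scalar. The Waring type of $w$ is the splitting type of $\varphi_s$. (The Waring type of $w=0$ is $\emptyset$.) $\mathbf{P}(V_2^* )$ is the set of nonzero elements of $V_2^*$ modulo $\mathbf{F}_q^\times$. The function $\varepsilon\colon\mathbf{P}(V_2^* )\to\mathbf{C}$ is: $\varepsilon([f_2])=1$ if $f_2$ is split (a product of two non-proportional linear forms over $\mathbf{F}_q$), $0$ if $f_2$ is ramified (a nonzero constant times the square of a linear form over $\mathbf{F}_q$), and $-1$ if $f_2$ is inert (irreducible over $\mathbf{F}_q$). *)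

theory Defs
  imports
    "Jordan_Normal_Form.DL_Rank"
    "HOL-Computational_Algebra.Computational_Algebra"
begin

text \<open>
  The ring \<open>F\<^sub>q[x,y]\<close> is represented by \<open>'a poly poly\<close>, where the inner variable is \<open>x\<close>
  and the outer variable is \<open>y\<close>: the coefficient of \<open>x\<^sup>j y\<^sup>i\<close> in \<open>f\<close> is
  \<open>poly.coeff (poly.coeff f i) j\<close>, and \<open>[:c:]\<close>, acting by \<open>Polynomial.smult\<close>, is the scalar \<open>c\<close>.
\<close>

type_synonym 'a bipoly = "'a poly poly"

definition xy_monom :: "nat \<Rightarrow> nat \<Rightarrow> 'a::field bipoly" where
  "xy_monom j i = Polynomial.monom (Polynomial.monom 1 j) i"

definition scale :: "'a::field \<Rightarrow> 'a bipoly \<Rightarrow> 'a bipoly" where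
  "scale c f = Polynomial.smult [:c:] f"

definition forms :: "nat \<Rightarrow> 'a::field bipoly set" where
  "forms n = {f. \<forall>i j. poly.coeff (poly.coeff f i) j \<noteq> 0 \<longrightarrow> i + j = n}"

definition hom_part :: "nat \<Rightarrow> 'a::field bipoly \<Rightarrow> 'a bipoly" where
  "hom_part m f = (\<Sum>i\<le>m. scale (poly.coeff (poly.coeff f i) (m - i)) (xy_monom (m - i) i))"

text \<open>
  A functional on \<open>forms n\<close> is represented by the unique function extending it by \<open>0\<close>, so that
  the zero functional is \<open>\<lambda>_. 0\<close> and equality of functionals is equality of functions.
  The natural pairing of \<open>w\<close> and \<open>f\<close> is then \<open>w f\<close>.
\<close>

definition dual_forms :: "nat \<Rightarrow> ('a::field bipoly \<Rightarrow> 'a) set" where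
  "dual_forms n = {w.
     (\<forall>f\<in>forms n. \<forall>g\<in>forms n. w (f + g) = w f + w g) \<and>
     (\<forall>c. \<forall>f\<in>forms n. w (scale c f) = c * w f) \<and>
     (\<forall>f. f \<notin> forms n \<longrightarrow> w f = 0)}"

text \<open>\<open>polar n m w g\<close> is the functional \<open>(w, g)\<close> for \<open>w \<in> dual_forms n\<close> and \<open>g \<in> forms m\<close>.\<close>

definition polar :: "nat \<Rightarrow> nat \<Rightarrow> ('a::field bipoly \<Rightarrow> 'a) \<Rightarrow> 'a bipoly \<Rightarrow> ('a bipoly \<Rightarrow> 'a)" where
  "polar n m w g =
     (if m \<le> n then (\<lambda>h. if h \<in> forms (n - m) then w (g * h) else 0) else (\<lambda>_. 0))"

definition apolar_ideal :: "nat \<Rightarrow> ('a::field bipoly \<Rightarrow> 'a) \<Rightarrow> 'a bipoly set" where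
  "apolar_ideal n w = {f. \<forall>m. polar n m w (hom_part m f) = (\<lambda>_. 0)}"

definition nontrivial_additive_character :: "('a::field \<Rightarrow> complex) \<Rightarrow> bool" where
  "nontrivial_additive_character \<psi> \<longleftrightarrow>
     (\<forall>a. \<psi> a \<noteq> 0) \<and> (\<forall>a b. \<psi> (a + b) = \<psi> a * \<psi> b) \<and> (\<exists>a. \<psi> a \<noteq> 1)"

text \<open>
  A form is singular if it has a repeated factor. As every square, in particular that of the
  non-unit \<open>0\<close>, divides \<open>0\<close>, the zero form is not \<^const>\<open>squarefree\<close>, so it counts as singular.
\<close>

definition singular_forms :: "nat \<Rightarrow> 'a::field bipoly set" where
  "singular_forms n = {f \<in> forms n. \<not> squarefree f}"

definition Phi_hat :: "('a::finite_field \<Rightarrow> complex) \<Rightarrow> ('a bipoly \<Rightarrow> 'a) \<Rightarrow> complex" where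
  "Phi_hat \<psi> w =
     1 / of_nat (card (forms 5 :: 'a bipoly set)) * (\<Sum>f\<in>singular_forms 5. \<psi> (w f))"

definition proportional :: "'a::field bipoly \<Rightarrow> 'a bipoly \<Rightarrow> bool" where
  "proportional f g \<longleftrightarrow> (\<exists>c. c \<noteq> 0 \<and> g = scale c f)"

text \<open>
  The symbol \<open>\<langle>d\<^sub>1^e\<^sub>1, \<dots>, d\<^sub>r^e\<^sub>r\<rangle>\<close> is the multiset of the pairs \<open>(d\<^sub>i, e\<^sub>i)\<close>.
\<close>

type_synonym splitting_symbol = "(nat \<times> nat) multiset"

definition has_splitting_type :: "'a::field bipoly \<Rightarrow> splitting_symbol \<Rightarrow> bool" where
  "has_splitting_type f T \<longleftrightarrow>
     (\<exists>(c::'a) (r::nat) (g :: nat \<Rightarrow> 'a bipoly) (d :: nat \<Rightarrow> nat) (e :: nat \<Rightarrow> nat).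
        c \<noteq> 0 \<and>
        (\<forall>i<r. g i \<in> forms (d i) \<and> Factorial_Ring.irreducible (g i) \<and> e i \<ge> 1) \<and>
        (\<forall>i<r. \<forall>j<r. i \<noteq> j \<longrightarrow> \<not> proportional (g i) (g j)) \<and>
        f = scale c (\<Prod>i<r. g i ^ e i) \<and>
        T = {#(d i, e i). i \<in># mset_set {..<r}#})"

text \<open>
  The coordinate \<open>a\<^sub>i\<close> of \<open>w\<close> in the basis dual to the monomials is its value at \<open>x\<^sup>5\<^sup>-\<^sup>i y\<^sup>i\<close>.
\<close>

definition coord :: "('a::field bipoly \<Rightarrow> 'a) \<Rightarrow> nat \<Rightarrow> 'a" where
  "coord w i = w (xy_monom (5 - i) i)"

definition catalecticant :: "('a::field bipoly \<Rightarrow> 'a) \<Rightarrow> 'a mat" where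
  "catalecticant w = mat 3 4 (\<lambda>(i, j). coord w (i + j))"

definition waring_generator :: "('a::field bipoly \<Rightarrow> 'a) \<Rightarrow> 'a bipoly \<Rightarrow> bool" where
  "waring_generator w \<phi> \<longleftrightarrow>
     \<phi> \<in> forms (vec_space.rank 3 (catalecticant w)) \<and> \<phi> \<noteq> 0 \<and> \<phi> \<in> apolar_ideal 5 w \<and>
     (\<forall>m. \<forall>f\<in>forms m. f \<noteq> 0 \<and> f \<in> apolar_ideal 5 w \<longrightarrow> vec_space.rank 3 (catalecticant w) \<le> m)"

definition has_waring_type :: "('a::field bipoly \<Rightarrow> 'a) \<Rightarrow> splitting_symbol \<Rightarrow> bool" where
  "has_waring_type w T \<longleftrightarrow>
     (if w = (\<lambda>_. 0) then T = {#} else (\<exists>\<phi>. waring_generator w \<phi> \<and> has_splitting_type \<phi> T))"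

definition proj_forms :: "nat \<Rightarrow> 'a::field bipoly set set" where
  "proj_forms n = (forms n - {0}) // {(f, g). f \<in> forms n - {0} \<and> proportional f g}"

definition split_form :: "'a::field bipoly \<Rightarrow> bool" where
  "split_form f \<longleftrightarrow>
     (\<exists>l\<in>forms 1 - {0}. \<exists>l'\<in>forms 1 - {0}. \<not> proportional l l' \<and> f = l * l')"

definition ramified_form :: "'a::field bipoly \<Rightarrow> bool" where
  "ramified_form f \<longleftrightarrow> (\<exists>c. \<exists>l\<in>forms 1 - {0}. c \<noteq> 0 \<and> f = scale c (l ^ 2))"

definition inert_form :: "'a::field bipoly \<Rightarrow> bool" where
  "inert_form f \<longleftrightarrow> Factorial_Ring.irreducible f"

text \<open>
  The three properties are invariant under scaling and exactly one holds for each nonzero binary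
  quadratic form, so the choice of representatives and the last alternative are immaterial.
\<close>

definition epsilon :: "'a::field bipoly set \<Rightarrow> complex" where
  "epsilon P =
     (if \<exists>f\<in>P. split_form f then 1
      else if \<exists>f\<in>P. ramified_form f then 0
      else if \<exists>f\<in>P. inert_form f then - 1
      else undefined)"

definition C_const :: "('a::finite_field bipoly \<Rightarrow> 'a) \<Rightarrow> complex" where
  "C_const w = - (\<Sum>P | P \<in> proj_forms 2 \<and> (\<exists>f\<in>P. f ^ 2 \<in> apolar_ideal 5 w). epsilon P)"

end

theory Submission
  imports Defs
begin

text \<open>Write \<open>\<epsilon>(g)\<close> for the value of \<open>\<epsilon>\<close> at the class of a nonzero quadratic form \<open>g\<close>. The
  Moebius function takes the value \<open>-1\<close> on linear forms and \<open>\<epsilon>(g)\<close> on a quadratic form \<open>g\<close>, and forms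
  of higher degree have no square dividing a nonzero quintic form. Hence the indicator function of
  the singular quintic forms is
  \<open>[f singular] = #{[l] : l\<^sup>2 dvd f} - (\<Sum>[g] with g\<^sup>2 dvd f. \<epsilon>(g))\<close>,
  also for \<open>f = 0\<close> (\<open>moebius_identity\<close>). The forms divisible by a given \<open>h\<close> constitute a linear
  space, on which the sum of \<open>\<psi>(w f)\<close> vanishes unless \<open>h\<close> lies in the apolar ideal. This gives
  \<open>Phi_hat \<psi> w = #{[l] : l\<^sup>2 \<in> w\<^sup>\<bottom>} / q\<^sup>2 + C(w) / q\<^sup>4\<close> (\<open>Phi_hat_formula\<close>).

  In characteristic 2 squaring is additive and bijective on the field, so the quadratic forms \<open>g\<close>
  with \<open>g\<^sup>2 \<in> w\<^sup>\<bottom>\<close> form, together with 0, a linear space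
      \<open>S\<close>, cut out by two equations whose
  coefficients are the square roots of the even and of the odd coordinates of \<open>w\<close>. As
      \<open>\<epsilon>(g)\<close> is one
  less than the number of classes of linear forms dividing \<open>g\<close>, the sum of
      \<open>\<epsilon>\<close> over \<open>S\<close> can be
  computed by counting the elements of \<open>S\<close> divisible
      by each linear form. Let \<open>w \<noteq> 0\<close>.
  If the two equations are independent, \<open>S\<close> is a line and \<open>C(w)\<close> is
      \<open>-\<epsilon>\<close> of its generator.
  If they are dependent, \<open>C(w)\<close> is \<open>-q\<close> or \<open>0\<close>, according to
      whether or not \<open>w\<^sup>\<bottom>\<close> contains the
  square of a nonzero linear form; such a linear form is then unique up to scalars. If it exists,
  the equations are automatically dependent (\<open>apolar_dichotomy\<close>).

  It remains to relate this to Waring types. The rank of the catalecticant is the least degree of a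
  nonzero form in \<open>w\<^sup>\<bottom>\<close> (\<open>rank_catalecticant_form\<close>,
      \<open>rank_catalecticant_minimal\<close>), hence
  \<open>w\<^sup>\<bottom>\<close> contains the square of a nonzero linear form exactly for the types
      \<open>\<langle>1\<rangle>\<close> and \<open>\<langle>1\<^sup>2\<rangle>\<close>
  (\<open>waring_type_square\<close>). For the other types \<open>S\<close> contains a nonzero element
      that can be read off from
  the generator \<open>\<phi>\<close> of least degree in four cases: \<open>\<phi>\<close> itself if
      its degree is 2, \<open>l\<^sup>2\<close> if
  \<open>\<phi> = l\<^sup>3\<close>, and \<open>l l'\<close> if \<open>\<phi>
      = l\<^sup>2 l'\<close>. When \<open>\<phi>\<close> has degree 2 the two equations are independent,
  for otherwise the recurrence satisfied by the coordinates of \<open>w\<close> would put a linear form into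
  \<open>w\<^sup>\<bottom>\<close> (\<open>C_const_quad\<close>). In the remaining cases
      \<open>C(w)\<close> is \<open>0\<close> or \<open>-\<epsilon>(g)\<close> for every nonzero
      \<open>g\<close> in \<open>S\<close>.\<close>

section \<open>Binary forms and their coefficients\<close>

text \<open>The variables \<open>x\<close> and \<open>y\<close>, and the embedding of the scalars into the polynomial ring.\<close>

definition X :: "'a::field bipoly" where "X = [:[:0, 1:]:]"
definition Y :: "'a::field bipoly" where "Y = [:0, 1:]"
definition K :: "'a::field \<Rightarrow> 'a bipoly" where "K c = [:[:c:]:]"

lemma K_0 [simp]: "K 0 = 0" and K_1 [simp]: "K 1 = 1"
  and K_add: "K (a + b) = K a + K b" and K_mult: "K (a * b) = K a * K b"
  and K_minus: "K (- a) = - K a" and K_diff: "K (a - b) = K a - K b"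
  by (simp_all add: K_def one_pCons)

lemma K_sum: "K (sum h A) = (\<Sum>i\<in>A. K (h i))"
  by (induction A rule: infinite_finite_induct) (simp_all add: K_add)

lemma K_power: "K (a ^ n) = K a ^ n"
  by (induction n) (simp_all add: K_mult)

lemma K_eq_0_iff [simp]: "K c = 0 \<longleftrightarrow> c = 0"
  by (simp add: K_def)

lemma K_inj: "K a = K b \<longleftrightarrow> a = b"
  by (simp add: K_def)

lemma scale_eq_K: "scale c f = K c * f"
  by (simp add: scale_def K_def)

lemma X_power: "X ^ j = [:Polynomial.monom 1 j:]"
  by (induction j) (simp_all add: X_def Polynomial.monom_Suc one_pCons Polynomial.monom_0)

lemma Y_power: "Y ^ i = Polynomial.monom 1 i"
  by (induction i) (simp_all add: Y_def Polynomial.monom_Suc Polynomial.monom_0)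

lemma K_XY: "K c * X ^ j * Y ^ i = Polynomial.monom (Polynomial.monom c j) i"
  by (simp add: X_power Y_power K_def Polynomial.smult_monom)

lemma xy_monom_eq: "xy_monom j i = X ^ j * Y ^ i"
  unfolding xy_monom_def K_XY[symmetric] by simp

lemma coeff_XY: "poly.coeff (poly.coeff (K c * X ^ j * Y ^ i) i') j' = (if i' = i \<and> j'
    = j then c else 0)"
  unfolding K_XY by auto

lemma coeff_K_mult [simp]:
  "poly.coeff (poly.coeff (K c * f) i) j = c * poly.coeff (poly.coeff f i) j"
  by (simp add: K_def)

lemma bipoly_eq_iff:
  "f = g \<longleftrightarrow> (\<forall>i j. poly.coeff (poly.coeff f i) j
      = poly.coeff (poly.coeff g i) j)"
  by (auto simp: poly_eq_iff)

lemma coeff_hom_part: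
  "poly.coeff (poly.coeff (hom_part m f) i) j = (if i + j = m then poly.coeff (poly.coeff f i) j else 0)"
proof -
  have "poly.coeff (poly.coeff (hom_part m f) i) j =
     (\<Sum>k\<le>m. if i = k then (if j = m - i then poly.coeff (poly.coeff f i) (m - i) else 0) else 0)"
    unfolding hom_part_def scale_eq_K xy_monom_eq Polynomial.coeff_sum
    by (intro sum.cong refl) (auto simp: coeff_XY mult.assoc[symmetric])
  then show ?thesis by auto
qed

text \<open>Polynomials all of whose monomials have a total degree satisfying \<open>P\<close>. Besides the forms this
  covers the polynomials with only terms of degree less than, or greater than, a given bound.\<close>

definition graded :: "(nat \<Rightarrow> bool) \<Rightarrow> 'a::field bipoly set" where
  "graded P = {f. \<forall>i j. poly.coeff (poly.coeff f i) j \<noteq> 0 \<longrightarrow> P (i + j)}"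

lemma forms_eq_graded: "forms n = graded (\<lambda>m. m = n)"
  by (simp add: forms_def graded_def)

lemma graded_mult:
  assumes "f \<in> graded P" "g \<in> graded Q" "\<And>a b. P a \<Longrightarrow> Q b
      \<Longrightarrow> R (a + b)"
  shows "f * g \<in> graded R"
  unfolding graded_def
proof (intro CollectI allI impI)
  fix i j assume "poly.coeff (poly.coeff (f * g) i) j \<noteq> 0"
  then have "(\<Sum>k\<le>i. \<Sum>l\<le>j. poly.coeff (poly.coeff f k) l * poly.coeff (poly.coeff g (i
      - k)) (j - l)) \<noteq> 0"
    by (simp add: Polynomial.coeff_mult Polynomial.coeff_sum)
  then obtain k where k: "k \<le> i" "(\<Sum>l\<le>j. poly.coeff (poly.coeff f k) l * poly.coeff
      (poly.coeff g (i - k)) (j - l)) \<noteq> 0"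
    by (meson sum.not_neutral_contains_not_neutral atMost_iff)
  then obtain l where l: "l \<le> j" "poly.coeff (poly.coeff f k) l * poly.coeff (poly.coeff g (i - k))
      (j - l) \<noteq> 0"
    by (meson sum.not_neutral_contains_not_neutral atMost_iff)
  then have "poly.coeff (poly.coeff f k) l \<noteq> 0" "poly.coeff (poly.coeff g (i - k)) (j - l)
      \<noteq> 0" by auto
  then have "P (k + l)" "Q ((i - k) + (j - l))"
    using assms(1,2) unfolding graded_def by blast+
  then have "R (k + l + ((i - k) + (j - l)))" by (rule assms(3))
  then show "R (i + j)" using k(1) l(1) by simp
qed

lemma graded_add: "f \<in> graded P \<Longrightarrow> g \<in> graded P \<Longrightarrow> f
    + g \<in> graded P"
  unfolding graded_def by (auto, metis add.right_neutral add.left_neutral)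

lemma forms_mult: "f \<in> forms m \<Longrightarrow> g \<in> forms n
    \<Longrightarrow> f * g \<in> forms (m + n)"
  unfolding forms_eq_graded by (erule (1) graded_mult) simp

lemma forms_add: "f \<in> forms n \<Longrightarrow> g \<in> forms n \<Longrightarrow> f + g \<in> forms n"
  unfolding forms_eq_graded by (rule graded_add)

lemma forms_0 [simp]: "0 \<in> forms n" by (simp add: forms_def)

lemma K_in_forms [simp]: "K c \<in> forms 0" and X_in_forms [simp]: "X \<in> forms 1" and Y_in_forms
    [simp]: "Y \<in> forms 1"
  by (auto simp: forms_def K_def X_def Y_def coeff_pCons split: nat.splits)

lemma XY_in_forms_Suc [simp]: "X \<in> forms (Suc 0)" "Y \<in> forms (Suc 0)"
  using X_in_forms Y_in_forms by simp_all

lemma forms_K_mult: "f \<in> forms n \<Longrightarrow> K c * f \<in> forms n"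
  using forms_mult[OF K_in_forms] by force

lemma forms_power: "f \<in> forms m \<Longrightarrow> f ^ k \<in> forms (k * m)"
proof (induction k)
  case 0 then show ?case using K_in_forms[of 1] by simp
qed (auto intro!: forms_mult)

lemma forms_uminus: "f \<in> forms n \<Longrightarrow> - f \<in> forms n" by (simp add: forms_def)

lemma forms_diff: "f \<in> forms n \<Longrightarrow> g \<in> forms n \<Longrightarrow> f - g \<in> forms n"
  using forms_add[OF _ forms_uminus] by fastforce

lemma forms_sum: "(\<And>i. i \<in> A \<Longrightarrow> f i \<in> forms n)
    \<Longrightarrow> sum f A \<in> forms n"
  by (induction A rule: infinite_finite_induct) (auto intro: forms_add)

lemma forms_degree_unique: "f \<in> forms m \<Longrightarrow> f \<in> forms n
    \<Longrightarrow> f \<noteq> 0 \<Longrightarrow> m = n"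
  unfolding forms_def bipoly_eq_iff by auto

lemma forms_hom_part: "f \<in> forms n \<Longrightarrow> hom_part m f = (if m = n then f else 0)"
  unfolding bipoly_eq_iff coeff_hom_part by (auto simp: forms_def)

text \<open>The form of degree \<open>n\<close> in which \<open>x\<^sup>n\<^sup>-\<^sup>i y\<^sup>i\<close> has the coefficient \<open>c i\<close>; the values of \<open>c\<close> beyond \<open>n\<close> play no role.\<close>

definition bform :: "nat \<Rightarrow> (nat \<Rightarrow> 'a::field) \<Rightarrow> 'a bipoly" where
  "bform n c = (\<Sum>i\<le>n. K (c i) * X ^ (n - i) * Y ^ i)"

lemma coeff_bform:
  "poly.coeff (poly.coeff (bform n c) i) j = (if i + j = n then c i else 0)"
proof -
  have "poly.coeff (poly.coeff (bform n c) i) j =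
     (\<Sum>k\<le>n. if i = k then (if j = n - i then c i else 0) else 0)"
    unfolding bform_def Polynomial.coeff_sum
    by (intro sum.cong refl) (auto simp: coeff_XY)
  then show ?thesis by auto
qed

lemma bform_in_forms [simp]: "bform n c \<in> forms n"
  by (auto simp: forms_def coeff_bform split: if_splits)

lemma forms_eq_bform: "f \<in> forms n \<Longrightarrow> f
    = bform n (\<lambda>i. poly.coeff (poly.coeff f i) (n - i))"
  unfolding bipoly_eq_iff coeff_bform by (auto simp: forms_def)

lemma bform_eq_iff: "bform n c = bform n c' \<longleftrightarrow> (\<forall>i\<le>n. c i = c' i)"
  unfolding bipoly_eq_iff coeff_bform by (auto simp: le_iff_add)

lemma bform_cong: "n = n' \<Longrightarrow> (\<And>i. i \<le> n' \<Longrightarrow> c i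
    = c' i) \<Longrightarrow> bform n c = bform n' c'"
  by (simp add: bform_eq_iff)

lemma card_forms: "card (forms n :: 'a::finite_field bipoly set) = card (UNIV :: 'a set) ^ Suc n"
proof -
  have "bij_betw (bform n) ({..n} \<rightarrow>\<^sub>E (UNIV :: 'a set)) (forms n)"
  proof (rule bij_betwI')
    fix c c' :: "nat \<Rightarrow> 'a" assume c: "c \<in> {..n} \<rightarrow>\<^sub>E UNIV" "c' \<in>
        {..n} \<rightarrow>\<^sub>E UNIV"
    have "c = c'" if "\<forall>i\<le>n. c i = c' i"
      by (rule PiE_ext[OF c]) (use that in simp)
    then show "(bform n c = bform n c') = (c = c')"
      unfolding bform_eq_iff by blast
  next
    fix f :: "'a bipoly" assume "f \<in> forms n"
    then have "f = bform n (restrict (\<lambda>i. poly.coeff (poly.coeff f i) (n - i)) {..n})"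
      by (subst forms_eq_bform) (auto intro: bform_cong)
    then show "\<exists>c\<in>{..n} \<rightarrow>\<^sub>E UNIV. f = bform n c"
        by (intro bexI, assumption) (simp add: restrict_PiE_iff)
  qed (rule bform_in_forms)
  from bij_betw_same_card[OF this] show ?thesis
    by (simp only: card_PiE finite_atMost prod_constant card_atMost)
qed

lemma finite_forms [simp]: "finite (forms n :: 'a::finite_field bipoly set)"
  by (rule card_ge_0_finite) (simp only: card_forms zero_less_power finite_UNIV_card_ge_0
      finite_class.finite_UNIV)

text \<open>Linear and quadratic forms given by their coefficients.\<close>

definition lin :: "'a::field \<Rightarrow> 'a \<Rightarrow> 'a bipoly" where "lin u v = K u * X + K v * Y"
definition quad :: "'a::field \<Rightarrow> 'a \<Rightarrow> 'a \<Rightarrow> 'a bipoly" where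
  "quad a b c = K a * X ^ 2 + K b * X * Y + K c * Y ^ 2"

lemma lin_bform: "lin u v = bform 1 (\<lambda>i. if i = 0 then u else v)"
  by (simp add: lin_def bform_def)
lemma sum_atMost_2: "(\<Sum>i\<le>2. h i) = h 0 + h 1
    + h (2::nat)" for h :: "nat \<Rightarrow> 'b::comm_monoid_add"
  by (simp add: numeral_2_eq_2)

lemma quad_bform: "quad a b c = bform 2 (\<lambda>i. if i = 0 then a else if i = 1 then b else c)"
  by (simp add: quad_def bform_def sum_atMost_2)

lemma lin_in_forms [simp]: "lin u v \<in> forms 1" "lin u v \<in> forms (Suc 0)"
  and quad_in_forms [simp]: "quad a b c \<in> forms 2"
  unfolding lin_bform quad_bform One_nat_def[symmetric] by (rule bform_in_forms)+

lemma lin_eq_iff: "lin u v = lin u' v' \<longleftrightarrow> u = u' \<and> v = v'"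
proof -
  have "(\<forall>i\<le>1. P i) \<longleftrightarrow> P 0 \<and> P (1::nat)" for P by (auto simp: le_Suc_eq)
  then show ?thesis unfolding lin_bform bform_eq_iff by simp
qed
lemma quad_eq_iff: "quad a b c = quad a' b' c' \<longleftrightarrow> a = a' \<and> b = b' \<and> c = c'"
proof -
  have "(\<forall>i\<le>2. P i) \<longleftrightarrow> P 0 \<and> P (1::nat) \<and> P 2" for P
      by (auto simp: le_Suc_eq numeral_2_eq_2)
  then show ?thesis unfolding quad_bform bform_eq_iff by simp
qed
lemma lin_eq_0_iff: "lin u v = 0 \<longleftrightarrow> u = 0 \<and> v = 0"
  using lin_eq_iff[of u v 0 0] by (simp add: lin_def)
lemma quad_eq_0_iff: "quad a b c = 0 \<longleftrightarrow> a = 0 \<and> b = 0 \<and> c = 0"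
  using quad_eq_iff[of a b c 0 0 0] by (simp add: quad_def)

lemma forms_1E: assumes "f \<in> forms 1" obtains u v where "f = lin u v"
  using forms_eq_bform[OF assms] by (simp add: bform_def lin_def)
lemma forms_2E: assumes "f \<in> forms 2" obtains a b c where "f = quad a b c"
proof (rule that)
  show "f = quad (poly.coeff (poly.coeff f 0) 2) (poly.coeff (poly.coeff f 1) 1) (poly.coeff
      (poly.coeff f 2) 0)"
    by (subst forms_eq_bform[OF assms]) (simp add: bform_def sum_atMost_2 quad_def)
qed
lemma forms_0E: assumes "f \<in> forms 0" obtains c where "f = K c"
  using forms_eq_bform[OF assms] by (simp add: bform_def)

lemma K_mult_quad: "K t * quad a b c = quad (t * a) (t * b) (t * c)"
  and lin_mult: "lin u v * lin s t = quad (u * s) (u * t + v * s) (v * t)"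
  by (simp_all add: lin_def quad_def K_mult K_add algebra_simps power2_eq_square)

section \<open>Divisors of forms are forms\<close>

text \<open>If \<open>D\<close> and \<open>E\<close> are both the highest or both the lowest degrees of terms of \<open>h\<close> and \<open>k\<close>, the product of the
  homogeneous parts of degrees \<open>D\<close> and \<open>E\<close> is not cancelled in \<open>h * k\<close>. The predicates \<open>P\<close> and \<open>Q\<close>
  describe the degrees of the other terms and allow both cases to be treated at once.\<close>

lemma forms_cofactor_degree:
  assumes hk: "h * k \<in> forms n"
    and h: "hom_part D h \<noteq> 0" "\<And>i j. poly.coeff (poly.coeff h i) j \<noteq> 0
        \<Longrightarrow> i + j \<noteq> D \<Longrightarrow> P (i + j)"
    and k: "hom_part E k \<noteq> 0" "\<And>i j. poly.coeff (poly.coeff k i) j \<noteq> 0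
        \<Longrightarrow> i + j \<noteq> E \<Longrightarrow> Q (i + j)"
    and PQ: "\<And>a. P a \<Longrightarrow> a \<noteq> D" "\<And>b. Q b
        \<Longrightarrow> b \<noteq> E" "\<And>a b. P a \<Longrightarrow> Q b \<Longrightarrow> a
        + b \<noteq> D + E"
  shows "D + E = n"
proof (rule ccontr)
  assume ne: "D + E \<noteq> n"
  define h1 where "h1 = hom_part D h"
  define k1 where "k1 = hom_part E k"
  have 1: "h1 \<in> graded (\<lambda>m. m = D)" "k1 \<in> graded (\<lambda>m. m = E)" 
    "h - h1 \<in> graded P" "k - k1 \<in> graded Q"
    using h(2) k(2) by (auto simp: graded_def h1_def k1_def coeff_hom_part split: if_splits)
  let ?R = "\<lambda>m. m \<noteq> D + E"
  have "h1 * (k - k1) \<in> graded ?R" using 1(1,4) by (rule graded_mult) (use PQ(2) in auto)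
  moreover have "(h - h1) * k1 \<in> graded ?R" using 1(3,2) by (rule graded_mult) (use PQ(1) in auto)
  moreover have "(h - h1) * (k - k1) \<in> graded ?R" using 1(3,4) by (rule graded_mult) (use PQ(3) in auto)
  ultimately have 2: "h1 * (k - k1) + (h - h1) * k1 + (h - h1) * (k - k1) \<in> graded ?R"
    by (intro graded_add)
  have 3: "h * k = h1 * k1 + (h1 * (k - k1) + (h - h1) * k1 + (h - h1) * (k - k1))"
    by (simp add: algebra_simps)
  have "h1 * k1 \<noteq> 0" using h(1) k(1) by (simp add: h1_def k1_def)
  then obtain i j where ij: "poly.coeff (poly.coeff (h1 * k1) i) j \<noteq> 0"
    unfolding bipoly_eq_iff by auto
  moreover have "h1 * k1 \<in> graded (\<lambda>m. m = D + E)" using 1(1,2) by (rule graded_mult) auto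
  ultimately have "i + j = D + E" by (auto simp: graded_def)
  then have "poly.coeff (poly.coeff (h1 * (k - k1) + (h - h1) * k1 + (h - h1) * (k - k1)) i) j = 0"
    using 2 by (auto simp: graded_def)
  with ij have "poly.coeff (poly.coeff (h * k) i) j \<noteq> 0" unfolding 3 by simp
  with hk \<open>i + j = D + E\<close> ne show False by (auto simp: forms_def)
qed

lemma forms_divisors:
  assumes hk: "h * k \<in> forms n" and nz: "h * k \<noteq> 0"
  obtains d e where "h \<in> forms d" "k \<in> forms e" "d + e = n"
proof -
  define T where "T f = {i + j | i j. poly.coeff (poly.coeff f i) j \<noteq> 0}" for f :: "'a bipoly"
  have T: "i + j \<in> T f" if "poly.coeff (poly.coeff f i) j \<noteq> 0" for f i j
    using that by (auto simp: T_def)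
  have fin: "finite (T f)" for f
  proof (rule finite_subset)
    show "T f \<subseteq> (\<Union>i\<le>Polynomial.degree f. (\<lambda>j. i
        + j) ` {..Polynomial.degree (poly.coeff f i)})"
    proof
      fix m assume "m \<in> T f"
      then obtain i j where ij: "m = i + j" "poly.coeff (poly.coeff f i) j \<noteq> 0" by (auto simp: T_def)
      then have "poly.coeff f i \<noteq> 0" by auto
      with ij show "m \<in> (\<Union>i\<le>Polynomial.degree f. (\<lambda>j. i
          + j) ` {..Polynomial.degree (poly.coeff f i)})"
        by (auto intro!: Polynomial.le_degree)
    qed
  qed auto
  have ne: "T f \<noteq> {}" if "f \<noteq> 0" for f
    using that unfolding bipoly_eq_iff T_def by auto
  have hp: "hom_part m f \<noteq> 0" if "m \<in> T f" for m f
    using that unfolding bipoly_eq_iff coeff_hom_part T_def by auto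
  have le_Max: "m \<le> Max (T f)" and Min_le: "Min (T f) \<le> m" if "m \<in> T f" for m f
    using fin that by auto
  have Max_T: "Max (T f) \<in> T f" and Min_T: "Min (T f) \<in> T f" if "f \<noteq> 0" for f
    using fin ne[OF that] by auto
  have nz': "h \<noteq> 0" "k \<noteq> 0" using nz by auto
  have top: "Max (T h) + Max (T k) = n"
  proof (rule forms_cofactor_degree[OF hk, where P = "\<lambda>m. m < Max (T h)" and Q
      = "\<lambda>m. m < Max (T k)"])
    show "hom_part (Max (T h)) h \<noteq> 0" "hom_part (Max (T k)) k \<noteq> 0"
      using nz' by (auto intro!: hp Max_T)
    show "i + j < Max (T h)" if "poly.coeff (poly.coeff h i) j \<noteq> 0" "i
        + j \<noteq> Max (T h)" for i j
      using le_Max[OF T[OF that(1)]] that(2) by simp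
    show "i + j < Max (T k)" if "poly.coeff (poly.coeff k i) j \<noteq> 0" "i
        + j \<noteq> Max (T k)" for i j
      using le_Max[OF T[OF that(1)]] that(2) by simp
  qed auto
  have bot: "Min (T h) + Min (T k) = n"
  proof (rule forms_cofactor_degree[OF hk, where P = "\<lambda>m. m > Min (T h)" and Q
      = "\<lambda>m. m > Min (T k)"])
    show "hom_part (Min (T h)) h \<noteq> 0" "hom_part (Min (T k)) k \<noteq> 0"
      using nz' by (auto intro!: hp Min_T)
    show "i + j > Min (T h)" if "poly.coeff (poly.coeff h i) j \<noteq> 0" "i
        + j \<noteq> Min (T h)" for i j
      using Min_le[OF T[OF that(1)]] that(2) by simp
    show "i + j > Min (T k)" if "poly.coeff (poly.coeff k i) j \<noteq> 0" "i
        + j \<noteq> Min (T k)" for i j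
      using Min_le[OF T[OF that(1)]] that(2) by simp
  qed auto
  have "Min (T h) \<le> Max (T h)" "Min (T k) \<le> Max (T k)"
    using le_Max[OF Min_T] nz' by auto
  then have *: "Min (T h) = Max (T h)" "Min (T k) = Max (T k)"
    using top bot by linarith+
  have "f \<in> forms (Max (T f))" if "Min (T f) = Max (T f)" for f
    unfolding forms_def
  proof (intro CollectI allI impI)
    fix i j assume nz: "poly.coeff (poly.coeff f i) j \<noteq> 0"
    show "i + j = Max (T f)"
      using le_Max[OF T[OF nz]] Min_le[OF T[OF nz]] that by linarith
  qed
  with * top that show ?thesis by blast
qed

lemma forms_cofactor:
  assumes "h \<in> forms d" "h \<noteq> 0" "h * k \<in> forms n" "d \<le> n"
  shows "k \<in> forms (n - d)"
proof (cases "k = 0")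
  case False
  then have "h * k \<noteq> 0" using assms by auto
  from forms_divisors[OF assms(3) this] obtain d' e where "h \<in> forms d'" "k \<in> forms e" "d' + e = n"
    by blast
  with forms_degree_unique[OF assms(1), of d'] assms(2) show ?thesis by auto
qed auto

lemma K_is_unit: "c \<noteq> 0 \<Longrightarrow> is_unit (K c :: 'a::field bipoly)"
  by (rule dvdI[of _ _ "K (1 / c)"]) (simp flip: K_mult)

lemma form_unit_iff:
  assumes "f \<in> forms d" "f \<noteq> 0" shows "is_unit f \<longleftrightarrow> d = 0"
proof
  assume "is_unit f"
  then obtain g where g: "1 = f * g" by (auto elim: dvdE)
  have "f * g \<in> forms 0" using K_in_forms[of 1] g by simp
  moreover have "f * g \<noteq> 0" by (simp flip: g)
  ultimately obtain d' e where "f \<in> forms d'" "g \<in> forms e" "d' + e = 0" by (rule forms_divisors)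
  with forms_degree_unique[OF assms(1), of d'] assms(2) show "d = 0" by auto
next
  assume "d = 0"
  then show "is_unit f" using assms by (auto elim!: forms_0E intro: K_is_unit)
qed

section \<open>Linear factors of forms\<close>

text \<open>The value of a polynomial at \<open>x = a\<close>, \<open>y = b\<close>.\<close>

definition ev :: "'a::field bipoly \<Rightarrow> 'a \<Rightarrow> 'a \<Rightarrow> 'a" where
  "ev f a b = poly (poly f [:b:]) a"

lemma ev_simps [simp]: "ev X a b = a" "ev Y a b = b" "ev (K c) a b = c" "ev 0 a b = 0"
  "ev (f + g) a b = ev f a b + ev g a b" "ev (f * g) a b = ev f a b * ev g a b"
  "ev (f ^ n) a b = ev f a b ^ n"
  by (simp_all add: ev_def X_def Y_def K_def)

lemma ev_lin [simp]: "ev (lin u v) a b = u * a + v * b"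
  by (simp add: lin_def)

lemma ev_sum: "ev (sum h A) a b = (\<Sum>i\<in>A. ev (h i) a b)"
  by (induction A rule: infinite_finite_induct) auto

text \<open>The nonzero linear and the nonzero quadratic forms.\<close>

abbreviation lins :: "'a::field bipoly set" where "lins \<equiv> forms 1 - {0}"
abbreviation quads :: "'a::field bipoly set" where "quads \<equiv> forms 2 - {0}"

lemma linsE:
  assumes "l \<in> lins" obtains u v where "l = lin u v" "u \<noteq> 0 \<or> v \<noteq> 0"
proof -
  have "l \<in> forms 1" using assms by blast
  then obtain u v where "l = lin u v" by (rule forms_1E)
  with assms show ?thesis by (intro that[of u v]) (auto simp: lin_eq_0_iff)
qed

lemma diff_dvd_power_diff: "x - y dvd x ^ n - y ^ n" for x y :: "'b::comm_ring_1"
  by (cases n) (simp_all only: diff_power_eq_sum power_0 diff_self dvd_0_right dvd_triv_left)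

text \<open>Modulo \<open>u x + v y\<close>, the form \<open>u\<^sup>n f(x, y) = f(u x, u y)\<close> is congruent to \<open>f(- v y, u y) = f(- v, u) y\<^sup>n\<close>. This
  settles the case \<open>u \<noteq> 0\<close>; for \<open>u = 0\<close> the hypothesis says that \<open>f\<close> has no term \<open>x\<^sup>n\<close>.\<close>

lemma lin_dvd_bform:
  assumes "u \<noteq> 0 \<or> v \<noteq> 0" and root: "ev (bform n c) v (- u) = 0"
  shows "lin u v dvd bform n c"
proof -
  have root': "(\<Sum>i\<le>n. c i * v ^ (n - i) * (- u) ^ i) = 0"
    using root by (simp add: bform_def ev_sum)
  show ?thesis
  proof (cases "u = 0")
    case False
    let ?D = "\<lambda>i. K (c i) * (K u * X) ^ (n - i) * (K u * Y) ^ i - K (c i) * (- (K v * Y)) ^ (n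
        - i) * (K u * Y) ^ i"
    have "lin u v dvd ?D i" for i
    proof -
      have "lin u v = K u * X - (- (K v * Y))" by (simp add: lin_def)
      then have "lin u v dvd (K u * X) ^ (n - i) - (- (K v * Y)) ^ (n - i)"
        using diff_dvd_power_diff by metis
      then have "lin u v dvd K (c i) * ((K u * X) ^ (n - i) - (- (K v * Y)) ^ (n - i)) * (K u * Y) ^ i"
          by simp
      then show ?thesis by (simp add: algebra_simps)
    qed
    then have "lin u v dvd (\<Sum>i\<le>n. ?D i)" by (rule dvd_sum)
    also have "(\<Sum>i\<le>n. ?D i)
        = K (u ^ n) * bform n c - K ((- 1) ^ n * (\<Sum>i\<le>n. c i * v ^ (n - i) * (- u) ^ i)) * Y ^ n"
    proof -
      have 1: "K (c i) * (K u * X) ^ (n - i) * (K u * Y) ^ i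
          = K (u ^ n) * (K (c i) * X ^ (n - i) * Y ^ i)" if "i \<le> n" for i
      proof -
        have "u ^ n = u ^ (n - i) * u ^ i" using that by (simp flip: power_add)
        then show ?thesis by (simp add: power_mult_distrib K_mult K_power)
      qed
      have 2: "K (c i) * (- (K v * Y)) ^ (n - i) * (K u * Y) ^ i
          = K ((- 1) ^ n * (c i * v ^ (n - i) * (- u) ^ i)) * Y ^ n" if "i \<le> n" for i
      proof -
        have y: "Y ^ n = Y ^ (n - i) * Y ^ i" using that by (simp flip: power_add)
        have "(- 1) ^ n * (- u) ^ i = (- 1) ^ (n - i) * u ^ i" 
        proof -
          have "(- 1 :: 'a) ^ n = (- 1) ^ (n - i) * (- 1) ^ i" using that by (simp flip: power_add)
          moreover have "(- u) ^ i = (- 1) ^ i * u ^ i" by (rule power_minus)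
          moreover have "(- 1 :: 'a) ^ i * (- 1) ^ i = 1" by (simp flip: power_mult_distrib)
          ultimately show ?thesis by (simp add: algebra_simps)
        qed
        then have s: "(- 1) ^ n * (c i * v ^ (n - i) * (- u) ^ i)
            = c i * (- 1) ^ (n - i) * v ^ (n - i) * u ^ i"
          by (simp add: algebra_simps)
        have "(- (K v * Y)) ^ (n - i) = K ((- 1) ^ (n - i) * v ^ (n - i)) * Y ^ (n - i)"
          by (subst power_minus) (simp add: K_mult K_power K_minus power_mult_distrib)
        then show ?thesis unfolding y s by (simp add: K_mult K_power power_mult_distrib)
      qed
      show ?thesis unfolding sum_subtractf bform_def sum_distrib_left sum_distrib_right K_sum
        by (intro arg_cong2[of _ _ _ _ minus] sum.cong refl 1 2) simp_all
    qed
    finally have "lin u v dvd K (u ^ n) * bform n c" by (simp add: root')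
    moreover have "is_unit (K (u ^ n))" using False by (intro K_is_unit) simp
    ultimately show ?thesis by (simp add: dvd_mult_unit_iff')
  next
    case True
    with assms(1) have v: "v \<noteq> 0" by simp
    have "(\<Sum>i\<le>n. c i * v ^ (n - i) * (- u) ^ i) = (\<Sum>i\<le>n. if i
        = 0 then c 0 * v ^ n else 0)"
      using True by (intro sum.cong) (auto simp: power_0_left)
    also have "\<dots> = c 0 * v ^ n" by simp
    finally have c0: "c 0 = 0" using root' v by simp
    have "Y dvd K (c i) * X ^ (n - i) * Y ^ i" for i
      using c0 by (cases i) auto
    then have "Y dvd bform n c" unfolding bform_def by (intro dvd_sum) auto
    then show ?thesis using True v by (simp add: lin_def K_is_unit mult_unit_dvd_iff)
  qed
qed

lemma lin_dvd_iff:
  assumes "f \<in> forms n" "u \<noteq> 0 \<or> v \<noteq> 0"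
  shows "lin u v dvd f \<longleftrightarrow> ev f v (- u) = 0"
proof
  assume "lin u v dvd f"
  then show "ev f v (- u) = 0" by (auto elim!: dvdE)
next
  assume "ev f v (- u) = 0"
  then show "lin u v dvd f"
    using lin_dvd_bform[OF assms(2)] forms_eq_bform[OF assms(1)] by metis
qed

lemma lins_dvd_mult_iff:
  assumes "l \<in> lins" "f \<in> forms m" "g \<in> forms n"
  shows "l dvd f * g \<longleftrightarrow> l dvd f \<or> l dvd g"
proof -
  obtain u v where l: "l = lin u v" and uv: "u \<noteq> 0 \<or> v \<noteq> 0" using assms(1) by (rule linsE)
  show ?thesis
    unfolding l lin_dvd_iff[OF forms_mult[OF assms(2,3)] uv] lin_dvd_iff[OF assms(2) uv] lin_dvd_iff[OF
        assms(3) uv] by simp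
qed

lemma proportional_K: "proportional f g \<longleftrightarrow> (\<exists>c. c \<noteq> 0 \<and> g = K c * f)"
  by (simp add: proportional_def scale_eq_K)

lemma proportional_refl [simp]: "proportional f f"
  unfolding proportional_K by (rule exI[of _ 1]) simp

lemma proportional_sym: "proportional f g \<Longrightarrow> proportional g f"
  unfolding proportional_K
  by (elim exE conjE, rule_tac x = "inverse c" in exI) (simp flip: mult.assoc K_mult)

lemma proportional_trans: "proportional f g \<Longrightarrow> proportional g h
    \<Longrightarrow> proportional f h"
  unfolding proportional_K
  by (elim exE conjE, rule_tac x = "ca * c" in exI) (simp add: K_mult mult.assoc)

lemma proportional_cong:
  "proportional f g \<Longrightarrow> proportional f h \<longleftrightarrow> proportional g h"
  by (meson proportional_sym proportional_trans)

lemma proportional_dvd_iff: "proportional f g \<Longrightarrow> h dvd g \<longleftrightarrow> h dvd f"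
  unfolding proportional_K by (auto simp: dvd_mult_unit_iff' K_is_unit)

lemma proportional_dvd_iff': "proportional f g \<Longrightarrow> g dvd h \<longleftrightarrow> f dvd h"
  unfolding proportional_K by (auto simp: mult_unit_dvd_iff' K_is_unit)

lemma proportional_mult: "proportional f g \<Longrightarrow> proportional h k
    \<Longrightarrow> proportional (f * h) (g * k)"
  unfolding proportional_K
  by (elim exE conjE, rule_tac x = "c * ca" in exI) (simp add: K_mult algebra_simps)

lemma proportional_power2: "proportional f g \<Longrightarrow> proportional (f ^ 2) (g ^ 2)"
  unfolding power2_eq_square by (intro proportional_mult)

lemma proportional_forms: "proportional f g \<Longrightarrow> f \<in> forms n - {0}
    \<Longrightarrow> g \<in> forms n - {0}"
  unfolding proportional_K by (auto intro: forms_K_mult)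

lemma card_proportional:
  assumes "f \<noteq> 0"
  shows "card {g :: 'a::finite_field bipoly. proportional f g} = card (UNIV :: 'a set) - 1"
proof -
  have "{g. proportional f g} = (\<lambda>c. K c * f) ` (UNIV - {0})"
    by (auto simp: proportional_K)
  moreover have "inj_on (\<lambda>c. K c * f) (UNIV - {0})"
    by (rule inj_onI) (use assms K_inj in \<open>metis mult_right_cancel\<close>)
  ultimately show ?thesis by (simp add: card_image card_Diff_singleton)
qed

lemma lins_dvd_lins: "l \<in> lins \<Longrightarrow> m \<in> lins
    \<Longrightarrow> l dvd m \<longleftrightarrow> proportional l m"
proof
  assume lm: "l \<in> lins" "m \<in> lins" "l dvd m"
  then obtain k where k: "m = l * k" by auto
  then have "k \<in> forms (1 - 1)" using lm by (intro forms_cofactor[of l 1]) auto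
  then obtain c where "k = K c" by (auto elim: forms_0E)
  with k lm show "proportional l m" by (auto simp: proportional_K mult.commute)
qed (auto simp: proportional_K)

lemma form_irreducible_iff:
  assumes "f \<in> forms n" "f \<noteq> 0"
  shows "Factorial_Ring.irreducible f \<longleftrightarrow> n \<noteq> 0 \<and>
    (\<forall>g h d e. f = g * h \<longrightarrow> g \<in> forms d \<longrightarrow> h \<in> forms e
        \<longrightarrow> d + e = n \<longrightarrow> d = 0 \<or> e = 0)" (is "?L \<longleftrightarrow> ?R")
proof
  assume irr: ?L
  have "n \<noteq> 0" using irr form_unit_iff[OF assms] by (auto simp: irreducible_def)
  moreover have "d = 0 \<or> e = 0" if "f = g * h" "g \<in> forms d" "h \<in> forms e" for g h d e
  proof -
    have nz: "g \<noteq> 0" "h \<noteq> 0" using that(1) assms(2) by auto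
    have "is_unit g \<or> is_unit h" using irr that(1) by (rule irreducibleD)
    then show ?thesis using form_unit_iff[OF that(2) nz(1)] form_unit_iff[OF that(3) nz(2)] by simp
  qed
  ultimately show ?R by blast
next
  assume R: ?R
  show ?L
  proof (rule irreducibleI)
    show "f \<noteq> 0" by fact
    show "\<not> is_unit f" using R form_unit_iff[OF assms] by blast
    fix g h assume gh: "f = g * h"
    then obtain d e where de: "g \<in> forms d" "h \<in> forms e" "d + e = n"
      using forms_divisors[of g h n] assms by auto
    have nz: "g \<noteq> 0" "h \<noteq> 0" using gh assms(2) by auto
    have "d = 0 \<or> e = 0" using R gh de by blast
    then show "is_unit g \<or> is_unit h"
      using form_unit_iff[OF de(1) nz(1)] form_unit_iff[OF de(2) nz(2)] by simp
  qed
qed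

lemma lins_irreducible: "l \<in> lins \<Longrightarrow> Factorial_Ring.irreducible l"
  using form_irreducible_iff[of l 1] by auto

lemma quads_irreducible_iff:
  assumes "g \<in> quads"
  shows "Factorial_Ring.irreducible g \<longleftrightarrow> \<not> (\<exists>l\<in>lins. l dvd g)"
proof
  assume irr: "Factorial_Ring.irreducible g"
  show "\<not> (\<exists>l\<in>lins. l dvd g)"
  proof
    assume "\<exists>l\<in>lins. l dvd g"
    then obtain l k where lk: "l \<in> lins" "g = l * k" by (meson dvdE)
    then have "k \<in> forms (2 - 1)" using assms by (intro forms_cofactor[of l 1]) auto
    moreover have "g = l * k \<longrightarrow> l \<in> forms 1 \<longrightarrow> k \<in> forms 1
        \<longrightarrow> 1 + 1 = (2::nat) \<longrightarrow> (1::nat) = 0 \<or> (1::nat) = 0"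
      using form_irreducible_iff[of g 2] irr assms by blast
    ultimately show False using lk by simp
  qed
next
  assume no: "\<not> (\<exists>l\<in>lins. l dvd g)"
  show "Factorial_Ring.irreducible g"
  proof -
    have "d = 0 \<or> e = 0" if "g = h * k" "h \<in> forms d" "k \<in> forms e" "d + e = 2" for h k d e
    proof (rule ccontr)
      assume "\<not> (d = 0 \<or> e = 0)"
      then have "d = 1" using that(4) by linarith
      then have "h \<in> lins" using that assms by auto
      moreover have "h dvd g" using that(1) by simp
      ultimately show False using no by blast
    qed
    then show ?thesis using form_irreducible_iff[of g 2] assms by auto
  qed
qed

lemma quads_cases:
  assumes "g \<in> quads"
  obtains (irr) "Factorial_Ring.irreducible g"
  | (prod) l l' where "l \<in> lins" "l' \<in> lins" "g = l * l'"
proof (cases "Factorial_Ring.irreducible g")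
  case False
  then obtain l k where lk: "l \<in> lins" "g = l * k" using quads_irreducible_iff[OF assms] by (meson dvdE)
  then have "k \<in> forms (2 - 1)" using assms by (intro forms_cofactor[of l 1]) auto
  then have "k \<in> lins" using lk assms by auto
  with lk prod show ?thesis by blast
qed (rule irr)

section \<open>The function epsilon on quadratic forms\<close>

text \<open>The value of \<open>\<epsilon>\<close> at the class of \<open>g\<close>.\<close>

definition eps :: "'a::field bipoly \<Rightarrow> complex" where
  "eps g = epsilon {h. proportional g h}"

lemma lins_mult_dvd_lins:
  assumes "l \<in> lins" "l' \<in> lins" "m \<in> lins"
  shows "m dvd l * l' \<longleftrightarrow> proportional l m \<or> proportional l' m"
proof -
  have "m dvd l * l' \<longleftrightarrow> m dvd l \<or> m dvd l'"
      using assms lins_dvd_mult_iff[of m l 1 l' 1] by auto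
  then show ?thesis using assms lins_dvd_lins proportional_sym by metis
qed

lemma eps_split:
  assumes "l \<in> lins" "l' \<in> lins" "\<not> proportional l l'"
  shows "eps (l * l') = 1"
proof -
  have "split_form (l * l')" using assms by (auto simp: split_form_def)
  then have "\<exists>f\<in>{h. proportional (l * l') h}. split_form f"
    by (intro bexI[of _ "l * l'"]) simp_all
  then show ?thesis unfolding eps_def epsilon_def by (simp only: if_True)
qed

lemma proportional_split_iff:
  assumes "l \<in> lins" "l' \<in> lins" "m \<in> lins" "m' \<in> lins" "proportional (l * l') (m * m')"
  shows "proportional l l' \<longleftrightarrow> proportional m m'"
proof -
  have 1: "k dvd l * l' \<longleftrightarrow> k dvd m * m'" for k
      using assms(5) proportional_dvd_iff by blast
  have 2: "proportional l k \<or> proportional l' k \<longleftrightarrow> proportional m k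
      \<or> proportional m' k" if "k \<in> lins" for k
    using 1[of k] lins_mult_dvd_lins[OF assms(1,2) that] lins_mult_dvd_lins[OF assms(3,4) that] by simp
  have "proportional m m'" if "proportional l l'"
  proof -
    have "proportional l m" "proportional l m'"
      using 2[OF assms(3)] 2[OF assms(4)] proportional_cong[OF that] by simp_all
    then show ?thesis using proportional_sym proportional_trans by blast
  qed
  moreover have "proportional l l'" if "proportional m m'"
  proof -
    have "proportional m l" "proportional m l'"
      using 2[OF assms(1)] 2[OF assms(2)] proportional_cong[OF that] by simp_all
    then show ?thesis using proportional_sym proportional_trans by blast
  qed
  ultimately show ?thesis by blast
qed

lemma eps_ramified:
  assumes "l \<in> lins" "l' \<in> lins" "proportional l l'"
  shows "eps (l * l') = 0"
proof -
  obtain c where c: "c \<noteq> 0" "l' = K c * l" using assms(3) by (auto simp: proportional_K)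
  then have "l * l' = scale c (l ^ 2)" by (simp add: scale_eq_K power2_eq_square algebra_simps)
  with c assms have ram: "ramified_form (l * l')" by (auto simp: ramified_form_def)
  have "\<not> split_form f" if "proportional (l * l') f" for f
  proof (rule notI)
    assume "split_form f"
    then obtain m m' where m: "m \<in> lins" "m' \<in> lins" "\<not> proportional m m'" "f = m * m'"
      by (auto simp: split_form_def)
    with proportional_split_iff[OF assms(1,2) m(1,2)] that assms(3) show False by simp
  qed
  then have "\<not> (\<exists>f\<in>{h. proportional (l * l') h}. split_form f)" by blast
  moreover have "\<exists>f\<in>{h. proportional (l * l') h}. ramified_form f"
    using ram by (intro bexI[of _ "l * l'"]) simp_all
  ultimately show ?thesis unfolding eps_def epsilon_def by (simp only: if_False if_True)
qed

lemma eps_inert: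
  assumes "g \<in> quads" "Factorial_Ring.irreducible g"
  shows "eps g = - 1"
proof -
  have *: "\<not> (\<exists>l\<in>lins. l dvd f)" if "proportional g f" for f
    using quads_irreducible_iff[OF assms(1)] assms(2) proportional_dvd_iff[OF that] by blast
  have "\<not> split_form f" "\<not> ramified_form f" if "proportional g f" for f
    using *[OF that] unfolding split_form_def ramified_form_def scale_eq_K power2_eq_square
    by (metis dvd_triv_left, metis dvd_triv_left dvd_mult)
  then have "\<not> (\<exists>f\<in>{h. proportional g h}. split_form f)" "\<not> (\<exists>f\<in>{h.
      proportional g h}. ramified_form f)"
    by blast+
  moreover have "\<exists>f\<in>{h. proportional g h}. inert_form f"
    using assms by (intro bexI[of _ g]) (simp_all add: inert_form_def)
  ultimately show ?thesis unfolding eps_def epsilon_def by (simp only: if_False if_True)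
qed

lemma eps_proportional: "proportional f g \<Longrightarrow> eps f = eps g"
  unfolding eps_def using proportional_cong by (metis (no_types, lifting) Collect_cong)

text \<open>The value \<open>\<epsilon>(g)\<close> is the number of classes of linear forms dividing \<open>g\<close>, minus one. Here and below
  each class is counted with its \<open>q - 1\<close> elements.\<close>

lemma eps_count:
  fixes g :: "'a::finite_field bipoly"
  assumes "g \<in> quads"
  shows "of_nat (card (UNIV :: 'a set) - 1) * eps g
      = of_nat (card {l \<in> lins. l dvd g}) - of_nat (card (UNIV :: 'a set) - 1)"
  using assms
proof (cases g rule: quads_cases)
  case irr
  then have "{l \<in> lins. l dvd g} = {}" using quads_irreducible_iff[OF assms] by blast
  then show ?thesis by (simp only: eps_inert[OF assms irr]) simp
next
  case (prod l l')
  have eq: "{m \<in> lins. m dvd g} = {m. proportional l m} \<union> {m. proportional l' m}"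
    using prod lins_mult_dvd_lins proportional_forms by blast
  have nz: "l \<noteq> 0" "l' \<noteq> 0" using prod by auto
  note c = card_proportional[OF nz(1)] card_proportional[OF nz(2)]
  have fin: "finite {m. proportional k m}" if "k \<in> lins" for k :: "'a bipoly"
    by (rule finite_subset[of _ "forms 1"]) (use that proportional_forms in blast, simp)
  show ?thesis
  proof (cases "proportional l l'")
    case True
    then have "{m. proportional l' m} = {m. proportional l m}" using proportional_cong by blast
    then show ?thesis using eq c eps_ramified[OF prod(1,2) True] prod(3) by simp
  next
    case False
    then have "{m. proportional l m} \<inter> {m. proportional l' m} = {}"
      using proportional_sym proportional_trans by blast
    then have "card {m \<in> lins. m dvd g} = 2 * (card (UNIV :: 'a set) - 1)"
      unfolding eq using fin prod c by (simp add: card_Un_disjoint)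
    then show ?thesis using eps_split[OF prod(1,2) False] prod(3) by simp
  qed
qed

section \<open>The indicator function of the singular quintic forms\<close>

lemma char2_uminus:
  fixes x :: "'a::field" assumes "CHAR('a) = 2" shows "- x = x"
proof -
  have "of_nat CHAR('a) = (0::'a)" by (rule of_nat_CHAR)
  then have "(2::'a) = 0" using assms by simp
  then have "x + x = 0" by (metis mult_2 mult_zero_left)
  then show ?thesis by (simp add: eq_neg_iff_add_eq_0 minus_equation_iff)
qed

lemma char2_sqrt:
  fixes c :: "'a::finite_field" assumes "CHAR('a) = 2" obtains d where "c = d ^ 2"
proof -
  have "inj (\<lambda>x::'a. x ^ 2)"
    by (rule injI) (metis power2_eq_iff char2_uminus[OF assms])
  then have "surj (\<lambda>x::'a. x ^ 2)" by (rule finite_UNIV_inj_surj[OF finite_class.finite_UNIV])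
  then obtain d where "c = d ^ 2" by (rule surjE)
  then show ?thesis by (rule that)
qed

lemma card_field_ge_2: "card (UNIV :: 'a::finite_field set) \<ge> 2"
proof -
  have "card {0, 1 :: 'a} \<le> card (UNIV :: 'a set)" by (intro card_mono) auto
  then show ?thesis by simp
qed

lemma forms_multiples:
  assumes "h \<in> forms d" "h \<noteq> 0"
  shows "{f \<in> forms (d + n). h dvd f} = (\<lambda>k. h * k) ` forms n"
proof
  show "{f \<in> forms (d + n). h dvd f} \<subseteq> (\<lambda>k. h * k) ` forms n"
  proof
    fix f assume "f \<in> {f \<in> forms (d + n). h dvd f}"
    then obtain k where k: "f = h * k" "h * k \<in> forms (d + n)" by auto
    with forms_cofactor[OF assms k(2)] show "f \<in> (\<lambda>k. h * k) ` forms n" by auto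
  qed
qed (use assms in \<open>auto intro: forms_mult\<close>)

lemma card_forms_multiples:
  fixes h :: "'a::finite_field bipoly"
  assumes "h \<in> forms d" "h \<noteq> 0"
  shows "card {f \<in> forms (d + n). h dvd f} = card (UNIV :: 'a set) ^ Suc n"
  unfolding forms_multiples[OF assms] using assms(2)
  by (subst card_image) (auto intro!: inj_onI simp: card_forms)

lemma lins_mult: "l \<in> lins \<Longrightarrow> l' \<in> lins \<Longrightarrow> l * l' \<in> quads"
  using forms_mult[of l 1 l' 1] unfolding one_add_one by simp

lemma form_dvd_degree:
  assumes "h \<in> forms d" "f \<in> forms n" "f \<noteq> 0" "h dvd f"
  shows "d \<le> n"
proof -
  obtain k where k: "f = h * k" using assms(4) by auto
  then obtain d' e where "h \<in> forms d'" "d' + e = n"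
    using forms_divisors[of h k n] assms by metis
  moreover have "h \<noteq> 0" using k assms(3) by auto
  ultimately show ?thesis using forms_degree_unique[OF assms(1)] by fastforce
qed

lemma lins_power2_dvd_cancel:
  assumes "l \<in> lins" "h \<in> forms a" "\<not> l dvd h" "k \<in> forms b" "l ^ 2 dvd h * k"
  shows "l ^ 2 dvd k"
proof (cases "k = 0")
  case False
  have "l dvd l ^ 2" by (simp add: power2_eq_square)
  then have "l dvd h * k" using assms(5) by (rule dvd_trans)
  then have "l dvd k" using lins_dvd_mult_iff[OF assms(1,2,4)] assms(3) by blast
  then obtain k1 where k1: "k = l * k1" by auto
  have "l * k1 \<in> forms b" "l * k1 \<noteq> 0" using assms(4) False k1 by simp_all
  then obtain d e where "l \<in> forms d" and e: "k1 \<in> forms e" by (rule forms_divisors)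
  have "l * l dvd l * (h * k1)" using assms(5) unfolding k1 power2_eq_square mult.left_commute[of h l] .
  then have "l dvd h * k1" using assms(1) by (subst (asm) dvd_mult_cancel_left) auto
  then have "l dvd k1" using lins_dvd_mult_iff[OF assms(1,2) e] assms(3) by blast
  then show ?thesis unfolding k1 power2_eq_square by simp
qed simp

lemma not_squarefree_formE:
  assumes f: "f \<in> forms 5" "f \<noteq> 0" and "\<not> squarefree f"
  obtains (lin) l where "l \<in> lins" "l ^ 2 dvd f"
  | (irr) g where "g \<in> quads" "Factorial_Ring.irreducible g" "g ^ 2 dvd f"
proof -
  obtain h where h: "h ^ 2 dvd f" "\<not> is_unit h" using assms(3) by (auto simp: squarefree_def)
  then obtain k where "f = h ^ 2 * k" by blast
  then have k: "f = h * (h * k)" by (simp add: power2_eq_square mult.assoc)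
  have "h * (h * k) \<in> forms 5" "h * (h * k) \<noteq> 0" using f k by simp_all
  then obtain d e where d: "h \<in> forms d" and "h * k \<in> forms e" by (rule forms_divisors)
  have hz: "h \<noteq> 0" using k f(2) by auto
  have "h ^ 2 \<in> forms (2 * d)" using d by (rule forms_power)
  then have "2 * d \<le> 5" using f h(1) by (rule form_dvd_degree)
  moreover have "d \<noteq> 0" using form_unit_iff[OF d hz] h(2) by blast
  ultimately consider "d = 1" | "d = 2" by linarith
  then show ?thesis
  proof cases
    case 1
    with d hz h(1) lin show ?thesis by blast
  next
    case 2
    then have hq: "h \<in> quads" using d hz by blast
    then show ?thesis
    proof (cases h rule: quads_cases)
      case irr
      with hq h(1) that(2) show ?thesis by blast
    next
      case (prod l l')
      have "l ^ 2 dvd h ^ 2" unfolding prod(3) by (simp add: power_mult_distrib)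
      with prod(1) h(1) lin show ?thesis using dvd_trans by blast
    qed
  qed
qed

lemma finite_proportional [simp]: "finite {g :: 'a::finite_field bipoly. proportional f g}"
proof -
  have "{g. proportional f g} \<subseteq> range (\<lambda>c. K c * f)" by (auto simp: proportional_K)
  then show ?thesis by (rule finite_subset) simp
qed

lemma sum_eps_proportional:
  fixes g :: "'a::finite_field bipoly"
  assumes "g \<noteq> 0"
  shows "(\<Sum>h | proportional g h. eps h) = of_nat (card (UNIV :: 'a set) - 1) * eps g"
proof -
  have "(\<Sum>h | proportional g h. eps h) = (\<Sum>h | proportional g h. eps g)"
    by (intro sum.cong refl) (simp add: eps_proportional)
  then show ?thesis by (simp only: sum_constant card_proportional[OF assms])
qed

text \<open>Double counting of the pairs of a form in \<open>S\<close> and a linear form dividing it.\<close>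

lemma sum_eps_eq:
  fixes S :: "'a::finite_field bipoly set"
  assumes "S \<subseteq> quads"
  shows "of_nat (card (UNIV :: 'a set) - 1) * (\<Sum>g\<in>S. eps g) =
     (\<Sum>l\<in>lins. of_nat (card {g \<in> S. l dvd g})) - of_nat (card (UNIV :: 'a set) - 1) *
         of_nat (card S)"
proof -
  have fin: "finite S" by (rule finite_subset[OF assms]) simp
  have "of_nat (card (UNIV :: 'a set) - 1) * (\<Sum>g\<in>S. eps g) =
     (\<Sum>g\<in>S. of_nat (card {l \<in> lins. l dvd g}) - of_nat (card (UNIV :: 'a set) - 1))"
    unfolding sum_distrib_left by (intro sum.cong refl eps_count) (use assms in blast)
  also have "\<dots> = (\<Sum>g\<in>S. of_nat (card {l \<in> lins. l dvd g})) - of_nat (card (UNIV ::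
      'a set) - 1) * of_nat (card S)"
    by (simp only: sum_subtractf sum_constant mult.commute)
  also have "(\<Sum>g\<in>S. of_nat (card {l \<in> lins. l dvd g}) :: complex)
      = (\<Sum>g\<in>S. \<Sum>l | l \<in> lins \<and> l dvd g. 1)"
    by simp
  also have "\<dots> = (\<Sum>l\<in>lins. \<Sum>g | g \<in> S \<and> l dvd g. 1)"
    using fin by (intro sum.swap_restrict) simp_all
  also have "\<dots> = (\<Sum>l\<in>lins. of_nat (card {g \<in> S. l dvd g}))" by simp
  finally show ?thesis .
qed

lemma card_lins: "card (lins :: 'a::finite_field bipoly set) = card (UNIV :: 'a set) ^ 2 - 1"
  and card_quads: "card (quads :: 'a::finite_field bipoly set) = card (UNIV :: 'a set) ^ 3 - 1"
  by (simp_all add: card_Diff_singleton card_forms numeral_2_eq_2 numeral_3_eq_3)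

lemma sum_eps_quads:
  "(\<Sum>g\<in>(quads :: 'a::finite_field bipoly set). eps g) =
     of_nat (card (UNIV :: 'a set)) * of_nat (card (UNIV :: 'a set) - 1)"
proof -
  define q where "q = card (UNIV :: 'a set)"
  have q: "q \<ge> 2" unfolding q_def by (rule card_field_ge_2)
  then have q1: "of_nat (q - 1) = (of_nat q - 1 :: complex)" by (simp add: of_nat_diff)
  have c: "card {g \<in> quads. l dvd g} = q ^ 2 - 1" if "l \<in> lins" for l :: "'a bipoly"
  proof -
    have "{g \<in> quads. l dvd g} = {g \<in> forms (1 + 1). l dvd g} - {0}"
        by (auto simp only: one_add_one)
    moreover have "card {g \<in> forms (1 + 1). l dvd g} = q ^ Suc 1"
      unfolding q_def by (rule card_forms_multiples) (use that in auto)
    ultimately show ?thesis by (simp add: card_Diff_singleton power2_eq_square)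
  qed
  have "(\<Sum>l\<in>(lins :: 'a bipoly set). of_nat (card {g \<in> quads. l dvd g}))
      = (\<Sum>l\<in>(lins :: 'a bipoly set). of_nat (q ^ 2 - 1) :: complex)"
    by (intro sum.cong refl arg_cong[of _ _ of_nat] c)
  also have "\<dots> = of_nat (q ^ 2 - 1) * of_nat (q ^ 2 - 1)"
    by (simp only: sum_constant card_lins q_def)
  finally have "of_nat (q - 1) * (\<Sum>g\<in>(quads :: 'a bipoly set). eps g) =
      of_nat (q ^ 2 - 1) * of_nat (q ^ 2 - 1) - of_nat (q - 1) * of_nat (q ^ 3 - 1)"
    unfolding q_def by (subst sum_eps_eq) (simp_all only: card_quads)
  also have "\<dots> = of_nat (q - 1) * (of_nat q * of_nat (q - 1))"
  proof -
    have "of_nat (q ^ k - 1) = (of_nat q ^ k - 1 :: complex)" for k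
      using q by (subst of_nat_diff) auto
    moreover have "(Q ^ 2 - 1) * (Q ^ 2 - 1) - (Q - 1) * (Q ^ 3 - 1)
        = (Q - 1) * (Q * (Q - 1))" for Q :: complex
      by (simp add: power2_eq_square power3_eq_cube algebra_simps)
    ultimately show ?thesis unfolding q1 by simp
  qed
  finally show ?thesis using q unfolding q_def by (subst (asm) mult_left_cancel) auto
qed

lemma moebius_squarefree:
  fixes f :: "'a::finite_field bipoly"
  assumes "f \<in> forms n" "f \<noteq> 0" "squarefree f"
  shows "{l \<in> lins. l ^ 2 dvd f} = {}" "{g \<in> quads. g ^ 2 dvd f} = {}"
proof -
  have *: "d = 0" if "h \<in> forms d" "h \<noteq> 0" "h ^ 2 dvd f" for h d
    using that assms(3) form_unit_iff by (auto simp: squarefree_def)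
  have "\<not> l ^ 2 dvd f" if "l \<in> lins" for l
    using *[of l 1] that by auto
  then show "{l \<in> lins. l ^ 2 dvd f} = {}" by blast
  have "\<not> g ^ 2 dvd f" if "g \<in> quads" for g
    using *[of g 2] that by auto
  then show "{g \<in> quads. g ^ 2 dvd f} = {}" by blast
qed

text \<open>The next three lemmas determine the linear and quadratic forms whose square divides a nonzero
  singular quintic form \<open>f\<close>, as far as the values of \<open>\<epsilon>\<close> require. If the square of an
  irreducible quadratic form \<open>g\<close> divides \<open>f\<close>, then \<open>f = g\<^sup>2 m\<close> with \<open>m\<close> linear, and the linear factors of
  \<open>f\<close> are the multiples of \<open>m\<close>.\<close>

lemma moebius_irreducible:
  fixes f :: "'a::finite_field bipoly"
  assumes char: "CHAR('a) = 2" and f: "f \<in> forms 5" "f \<noteq> 0"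
    and g: "g \<in> quads" "Factorial_Ring.irreducible g" "g ^ 2 dvd f"
  shows "{l \<in> lins. l ^ 2 dvd f} = {}" "{h \<in> quads. h ^ 2 dvd f} = {h. proportional g h}"
proof -
  have cof: "\<exists>m\<in>lins. f = h ^ 2 * m" if h: "h \<in> quads" "h ^ 2 dvd f" for h
  proof -
    obtain m where m: "f = h ^ 2 * m" using h(2) by auto
    have "h ^ 2 \<in> forms (2 * 2)" using h(1) by (intro forms_power) auto
    then have "m \<in> forms (5 - 2 * 2)" by (rule forms_cofactor) (use m f h in auto)
    then have "m \<in> lins" using m f(2) by auto
    with m show ?thesis by blast
  qed
  obtain m where m: "m \<in> lins" "f = g ^ 2 * m" using cof[OF g(1,3)] by blast
  have g4: "h ^ 2 \<in> forms (2 * 2)" if "h \<in> quads" for h :: "'a bipoly" using that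
      by (intro forms_power) auto
  have ndvd: "\<not> l dvd g ^ 2" if "l \<in> lins" for l
    using lins_dvd_mult_iff[OF that, of g 2 g 2] g quads_irreducible_iff[OF g(1)] that
    by (auto simp: power2_eq_square)
  have no: "\<not> l ^ 2 dvd f" if l: "l \<in> lins" for l
  proof
    assume "l ^ 2 dvd f"
    then have "l ^ 2 dvd m" using lins_power2_dvd_cancel[OF l g4[OF g(1)] ndvd[OF l], of m 1] m by blast
    moreover have "l ^ 2 \<in> forms (2 * 1)" using l by (intro forms_power) auto
    ultimately have "2 * 1 \<le> (1::nat)" using form_dvd_degree[of "l ^ 2" "2 * 1" m 1] m by blast
    then show False by simp
  qed
  then show "{l \<in> lins. l ^ 2 dvd f} = {}" by blast
  have "proportional g h" if h: "h \<in> quads" "h ^ 2 dvd f" for h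
  proof -
    obtain m' where m': "m' \<in> lins" "f = h ^ 2 * m'" using cof[OF h] by blast
    have "\<not> m dvd h"
    proof
      assume "m dvd h"
      then have "m ^ 2 dvd h ^ 2" by (rule dvd_power_same)
      with h(2) no[OF m(1)] show False using dvd_trans by blast
    qed
    moreover have "m dvd h ^ 2 * m'" using m m' by (metis dvd_triv_right)
    ultimately have "m dvd m'"
      using lins_dvd_mult_iff[OF m(1) g4[OF h(1)], of m' 1] lins_dvd_mult_iff[OF m(1), of h 2 h 2]
          m'(1) h(1)
      by (simp add: power2_eq_square)
    then obtain c where c: "c \<noteq> 0" "m' = K c * m"
      using lins_dvd_lins[OF m(1) m'(1)] by (auto simp: proportional_K)
    obtain d where d: "c = d ^ 2" using char2_sqrt[OF char] .
    have "g ^ 2 * m = (K d * h) ^ 2 * m"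
      using m(2) m'(2) c(2) d by (simp only: K_power power_mult_distrib ac_simps)
    then have "g ^ 2 = (K d * h) ^ 2" using m(1) by simp
    then have "g = K d * h \<or> g = K (- d) * h" by (simp add: power2_eq_iff K_minus)
    moreover have "d \<noteq> 0" "- d \<noteq> 0" using c d by auto
    ultimately have "proportional h g" unfolding proportional_K by blast
    then show ?thesis by (rule proportional_sym)
  qed
  moreover have "h \<in> quads \<and> h ^ 2 dvd f" if "proportional g h" for h
    using proportional_forms[OF that g(1)] proportional_dvd_iff'[OF proportional_power2[OF that]] g(3)
        by blast
  ultimately show "{h \<in> quads. h ^ 2 dvd f} = {h. proportional g h}" by blast
qed

lemma moebius_two_lins:
  fixes f :: "'a::finite_field bipoly"
  assumes f: "f \<in> forms 5" "f \<noteq> 0"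
    and l: "l \<in> lins" "l ^ 2 dvd f" "l' \<in> lins" "l' ^ 2 dvd f" "\<not> proportional l l'"
    and irr: "\<And>g. g \<in> quads \<Longrightarrow> g ^ 2 dvd f
        \<Longrightarrow> \<not> Factorial_Ring.irreducible g"
  shows "{m \<in> lins. m ^ 2 dvd f} = {m. proportional l m} \<union> {m. proportional l' m}"
    "{h \<in> quads. h ^ 2 dvd f} = {h. proportional (l * l') h}"
proof -
  have sq: "m ^ 2 \<in> forms 2" if "m \<in> lins" for m :: "'a bipoly"
    using forms_power[of m 1 2] that by auto
  have nd: "\<not> m dvd k ^ 2" if "m \<in> lins" "k \<in> lins" "\<not> proportional k m" for m k ::
      "'a bipoly"
    using lins_mult_dvd_lins[OF that(2) that(2) that(1)] that(3) by (simp add: power2_eq_square)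
  obtain k where k: "f = l ^ 2 * k" using l(2) by auto
  have k3: "k \<in> forms (5 - 2)" by (rule forms_cofactor[OF sq[OF l(1)]]) (use k f l in auto)
  have "l' ^ 2 dvd k" using lins_power2_dvd_cancel[OF l(3) sq[OF l(1)] nd[OF l(3,1,5)] k3] l(4) k by simp
  then obtain n where n: "k = l' ^ 2 * n" by auto
  have n1: "n \<in> forms (5 - 2 - 2)" by (rule forms_cofactor[OF sq[OF l(3)]]) (use k3 n f l in auto)
  have n0: "n \<noteq> 0" using f(2) k n by auto
  have fe: "f = l ^ 2 * (l' ^ 2 * n)" using k n by simp
  have sq_n: "\<not> m ^ 2 dvd n" if "m \<in> lins" for m
    using form_dvd_degree[OF sq[OF that] n1 n0] by auto
  have L: "proportional l m \<or> proportional l' m" if m: "m \<in> lins" "m ^ 2 dvd f" for m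
  proof (rule ccontr)
    assume *: "\<not> (proportional l m \<or> proportional l' m)"
    have "m ^ 2 dvd k"
      by (rule lins_power2_dvd_cancel[OF m(1) sq[OF l(1)] nd[OF m(1) l(1)] k3]) (use * m k in auto)
    then have "m ^ 2 dvd n"
      unfolding n by (rule lins_power2_dvd_cancel[OF m(1) sq[OF l(3)] nd[OF m(1) l(3)] n1, rotated])
          (use * in auto)
    with sq_n[OF m(1)] show False by simp
  qed
  have L': "m \<in> lins \<and> m ^ 2 dvd f" if "proportional l m \<or> proportional l' m" for m
    using that proportional_forms l(1,3) proportional_dvd_iff'[OF proportional_power2] l(2,4) by metis
  from L L' show "{m \<in> lins. m ^ 2 dvd f}
      = {m. proportional l m} \<union> {m. proportional l' m}" by blast
  have "proportional (l * l') h" if h: "h \<in> quads" "h ^ 2 dvd f" for h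
    using h(1)
  proof (cases h rule: quads_cases)
    case irr
    with h assms(8) show ?thesis by blast
  next
    case (prod a b)
    have "a ^ 2 dvd h ^ 2" "b ^ 2 dvd h ^ 2" unfolding prod(3) power_mult_distrib by simp_all
    then have ab: "proportional l a \<or> proportional l' a" "proportional l b \<or> proportional l' b"
      using L[OF prod(1)] L[OF prod(2)] h(2) dvd_trans by blast+
    \<comment> \<open>the fourth power of a linear form cannot divide \<open>f\<close> together with the square of another one\<close>
    have not4: False if "proportional (m * m) h" "m \<in> lins" "k \<in> lins" "\<not> proportional k
        m" "f = m ^ 2 * (k ^ 2 * n)" for m k
    proof -
      have "(m * m) ^ 2 dvd f" using proportional_dvd_iff'[OF proportional_power2[OF that(1)]] h(2) by blast
      then have "m ^ 2 * m ^ 2 dvd m ^ 2 * (k ^ 2 * n)" unfolding that(5) by (simp only: power_mult_distrib)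
      then have "m ^ 2 dvd k ^ 2 * n" using that(2) by (subst (asm) dvd_mult_cancel_left) auto
      then have "m ^ 2 dvd n" using lins_power2_dvd_cancel[OF that(2) sq[OF that(3)] nd[OF that(2,3,4)]
          n1] by simp
      with sq_n[OF that(2)] show False by simp
    qed
    have fe': "f = l' ^ 2 * (l ^ 2 * n)" using fe by (simp add: algebra_simps)
    have sym: "\<not> proportional l' l" using l(5) proportional_sym by blast
    consider "proportional l a" "proportional l b" | "proportional l' a" "proportional l' b"
      | "proportional l a" "proportional l' b" | "proportional l' a" "proportional l b" using ab by blast
    then show ?thesis
    proof cases
      case 1
      then have "proportional (l * l) h" using prod(3) proportional_mult by blast
      with not4[OF this l(1,3) sym fe] show ?thesis by simp
    next
      case 2
      then have "proportional (l' * l') h" using prod(3) proportional_mult by blast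
      with not4[OF this l(3,1,5) fe'] show ?thesis by simp
    next
      case 3
      then show ?thesis using prod(3) proportional_mult by blast
    next
      case 4
      then have "proportional (l' * l) h" using prod(3) proportional_mult by blast
      then show ?thesis by (simp add: mult.commute)
    qed
  qed
  moreover have "h \<in> quads \<and> h ^ 2 dvd f" if "proportional (l * l') h" for h
  proof -
    have "l * l' \<in> quads" using l(1,3) by (rule lins_mult)
    moreover have "(l * l') ^ 2 dvd f" unfolding fe by (simp add: power_mult_distrib mult.assoc[symmetric])
    ultimately show ?thesis
      using proportional_forms[OF that] proportional_dvd_iff'[OF proportional_power2[OF that]] by blast
  qed
  ultimately show "{h \<in> quads. h ^ 2 dvd f} = {h. proportional (l * l') h}" by blast
qed

lemma moebius_one_lin:
  fixes f :: "'a::finite_field bipoly"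
  assumes l: "l \<in> lins" "l ^ 2 dvd f" 
    and one: "\<And>m. m \<in> lins \<Longrightarrow> m ^ 2 dvd f \<Longrightarrow> proportional l m"
    and irr: "\<And>g. g \<in> quads \<Longrightarrow> g ^ 2 dvd f
        \<Longrightarrow> \<not> Factorial_Ring.irreducible g"
  shows "{m \<in> lins. m ^ 2 dvd f} = {m. proportional l m}"
    "\<And>h. h \<in> quads \<Longrightarrow> h ^ 2 dvd f \<Longrightarrow> eps h = 0"
proof -
  show "{m \<in> lins. m ^ 2 dvd f} = {m. proportional l m}"
    using one proportional_forms[OF _ l(1)] proportional_dvd_iff'[OF proportional_power2] l(2) by blast
next
  fix h assume h: "h \<in> quads" "h ^ 2 dvd f"
  show "eps h = 0"
    using h(1)
  proof (cases h rule: quads_cases)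
    case irr
    with h assms(4) show ?thesis by blast
  next
    case (prod a b)
    have "a ^ 2 dvd h ^ 2" "b ^ 2 dvd h ^ 2" unfolding prod(3) power_mult_distrib by simp_all
    then have "proportional l a" "proportional l b"
      using one[OF prod(1)] one[OF prod(2)] h(2) dvd_trans by blast+
    then have "proportional a b" using proportional_sym proportional_trans by blast
    then show ?thesis using eps_ramified prod by blast
  qed
qed

text \<open>The identity for the indicator function, multiplied by \<open>q - 1\<close>.\<close>

lemma moebius_identity:
  fixes f :: "'a::finite_field bipoly"
  assumes char: "CHAR('a) = 2" and f: "f \<in> forms 5"
  shows "of_nat (card {l \<in> lins. l ^ 2 dvd f}) - (\<Sum>g | g \<in> quads \<and> g ^ 2 dvd f. eps g) =
    (if squarefree f then 0 else of_nat (card (UNIV :: 'a set) - 1))"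
proof (cases "f = 0")
  case True
  have q: "card (UNIV :: 'a set) \<ge> 2" by (rule card_field_ge_2)
  then have "of_nat (card (UNIV :: 'a set) ^ 2 - 1) = (of_nat (card (UNIV :: 'a set)) ^ 2 - 1 :: complex)"
    "of_nat (card (UNIV :: 'a set) - 1) = (of_nat (card (UNIV :: 'a set)) - 1 :: complex)"
    by (simp_all add: of_nat_diff)
  moreover have ns: "\<not> squarefree (0 :: 'a bipoly)" by (auto simp: squarefree_def intro!: exI[of _ 0])
  ultimately show ?thesis using True card_lins[where 'a = 'a] sum_eps_quads[where 'a = 'a]
    by (simp only: dvd_0_right simp_thms Collect_mem_eq ns if_False) (simp add: power2_eq_square
        algebra_simps)
next
  case False
  show ?thesis
  proof (cases "squarefree f")
    case True
    then show ?thesis using moebius_squarefree[OF f False True] by (simp only: if_True) simp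
  next
    case nsq: False
    show ?thesis
    proof (cases "\<exists>g\<in>quads. Factorial_Ring.irreducible g \<and> g ^ 2 dvd f")
      case True
      then obtain g where g: "g \<in> quads" "Factorial_Ring.irreducible g" "g ^ 2 dvd f" by blast
      have "g \<noteq> 0" using g by simp
      with nsq show ?thesis unfolding moebius_irreducible[OF char f False g] sum_eps_proportional[OF
          \<open>g \<noteq> 0\<close>]
        by (simp add: eps_inert[OF g(1,2)])
    next
      case no: False
      then obtain l where l: "l \<in> lins" "l ^ 2 dvd f" using not_squarefree_formE[OF f False nsq]
          by metis
      show ?thesis
      proof (cases "\<exists>l'\<in>lins. l' ^ 2 dvd f \<and> \<not> proportional l l'")
        case True
        then obtain l' where l': "l' \<in> lins" "l' ^ 2 dvd f" "\<not> proportional l l'" by blast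
        have nz: "l \<noteq> 0" "l' \<noteq> 0" "l * l' \<noteq> 0" using l l' by auto
        have "{m. proportional l m} \<inter> {m. proportional l' m} = {}"
          using l'(3) proportional_sym proportional_trans by blast
        then have "card ({m. proportional l m} \<union> {m. proportional l' m})
            = 2 * (card (UNIV :: 'a set) - 1)"
          by (simp add: card_Un_disjoint card_proportional nz)
        moreover have *: "\<And>g. g \<in> quads \<Longrightarrow> g ^ 2 dvd f
            \<Longrightarrow> \<not> Factorial_Ring.irreducible g" using no by blast
        have "{m \<in> lins. m ^ 2 dvd f} = {m. proportional l m} \<union> {m. proportional l' m}"
          "{h \<in> quads. h ^ 2 dvd f} = {h. proportional (l * l') h}"
          using moebius_two_lins[OF f False l l' *] by blast+
        ultimately show ?thesis
          using nsq by (simp only: sum_eps_proportional[OF nz(3)] eps_split[OF l(1) l'(1,3)]) simp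
      next
        case False
        have nz: "l \<noteq> 0" using l by auto
        have *: "\<And>g. g \<in> quads \<Longrightarrow> g ^ 2 dvd f
            \<Longrightarrow> \<not> Factorial_Ring.irreducible g" using no by blast
        have **: "\<And>m. m \<in> lins \<Longrightarrow> m ^ 2 dvd f
            \<Longrightarrow> proportional l m" using False by blast
        have "(\<Sum>g | g \<in> quads \<and> g ^ 2 dvd f. eps g) = 0"
          using moebius_one_lin(2)[OF l ** *] by (intro sum.neutral) blast
        moreover have "{m \<in> lins. m ^ 2 dvd f} = {m. proportional l m}"
          using moebius_one_lin(1)[OF l ** *] by blast
        ultimately show ?thesis using nsq by (simp only: card_proportional[OF nz]) simp
      qed
    qed
  qed
qed

section \<open>Functionals, apolarity and character sums\<close>

lemma dual_add: "w \<in> dual_forms n \<Longrightarrow> f \<in> forms n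
    \<Longrightarrow> g \<in> forms n \<Longrightarrow> w (f + g) = w f + w g"
  by (simp add: dual_forms_def)

lemma dual_K: "w \<in> dual_forms n \<Longrightarrow> f \<in> forms n \<Longrightarrow> w (K c * f)
    = c * w f"
  by (simp add: dual_forms_def scale_eq_K)

lemma dual_0: "w \<in> dual_forms n \<Longrightarrow> w 0 = 0"
  using dual_K[of w n 0 0] by simp

lemma dual_sum:
  assumes "w \<in> dual_forms n" "\<And>i. i \<in> A \<Longrightarrow> f i \<in> forms n"
  shows "w (sum f A) = (\<Sum>i\<in>A. w (f i))"
  using assms(2)
proof (induction A rule: infinite_finite_induct)
  case (insert x A)
  then show ?case by (simp add: dual_add[OF assms(1)] forms_sum)
qed (simp_all add: dual_0[OF assms(1)])

lemma in_apolar_iff: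
  assumes w: "w \<in> dual_forms n" and f: "f \<in> forms m" and "m + k = n"
  shows "f \<in> apolar_ideal n w \<longleftrightarrow> (\<forall>h\<in>forms k. w (f * h) = 0)"
proof -
  have "f \<in> apolar_ideal n w \<longleftrightarrow> (\<forall>m'. polar n m' w (if m'
      = m then f else 0) = (\<lambda>_. 0))"
    unfolding apolar_ideal_def by (simp add: forms_hom_part[OF f])
  also have "\<dots> \<longleftrightarrow> polar n m w f = (\<lambda>_. 0)"
    by (auto simp: polar_def fun_eq_iff dual_0[OF w])
  also have "\<dots> \<longleftrightarrow> (\<forall>h\<in>forms k. w (f * h) = 0)"
    using assms(3) by (auto simp: polar_def fun_eq_iff)
  finally show ?thesis .
qed

lemma apolar_mult:
  assumes w: "w \<in> dual_forms n" and f: "f \<in> forms m" "f \<in> apolar_ideal n w"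
    and g: "g \<in> forms k" and le: "m + k \<le> n"
  shows "f * g \<in> apolar_ideal n w"
proof -
  obtain d where d: "m + (k + d) = n" using le by (metis add.assoc le_Suc_ex)
  have "w (f * g * h) = 0" if "h \<in> forms d" for h
    using in_apolar_iff[OF w f(1) d] f(2) forms_mult[OF g that] by (simp add: mult.assoc)
  then show ?thesis
    using in_apolar_iff[OF w forms_mult[OF f(1) g], of d] d by (simp add: add.assoc)
qed

lemma apolar_proportional:
  assumes w: "w \<in> dual_forms n" and f: "f \<in> forms m" "m \<le> n" and p: "proportional f g"
  shows "g \<in> apolar_ideal n w \<longleftrightarrow> f \<in> apolar_ideal n w"
proof -
  have *: "K c * f \<in> apolar_ideal n w" if "f \<in> apolar_ideal n w" "f \<in> forms m" for f c
    using apolar_mult[OF w that(2,1) K_in_forms[of c]] f(2) by (simp add: mult.commute)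
  obtain c where c: "g = K c * f" using p by (auto simp: proportional_K)
  obtain d where d: "f = K d * g" using proportional_sym[OF p] by (auto simp: proportional_K)
  have "g \<in> forms m" using c f(1) forms_K_mult by blast
  with * f(1) c d show ?thesis by metis
qed

lemma character_sum:
  fixes \<psi> :: "'a::finite_field \<Rightarrow> complex"
  assumes psi: "nontrivial_additive_character \<psi>" and w: "w \<in> dual_forms n"
    and h: "h \<in> forms m" and mk: "m + k = n"
  shows "(\<Sum>f\<in>forms k. \<psi> (w (h * f))) =
    (if h \<in> apolar_ideal n w then of_nat (card (UNIV :: 'a set)) ^ Suc k else 0)"
proof -
  have psi_add: "\<psi> (a + b) = \<psi> a * \<psi> b" for a b
    using psi by (simp add: nontrivial_additive_character_def)
  have "\<psi> 0 \<noteq> 0" "\<psi> 0 * \<psi> 0 = \<psi> 0" 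
    using psi psi_add[of 0 0] by (simp_all add: nontrivial_additive_character_def)
  then have psi_0: "\<psi> 0 = 1" by simp
  have hf: "h * f \<in> forms n" if "f \<in> forms k" for f using forms_mult[OF h that] mk by simp
  show ?thesis
  proof (cases "h \<in> apolar_ideal n w")
    case True
    then have "(\<Sum>f\<in>forms k. \<psi> (w (h * f))) = (\<Sum>f\<in>(forms k :: 'a bipoly set). 1)"
      using in_apolar_iff[OF w h mk] psi_0 by (intro sum.cong) auto
    then show ?thesis using True by (simp add: card_forms)
  next
    case False
    then obtain f0 where f0: "f0 \<in> forms k" "w (h * f0) \<noteq> 0"
      using in_apolar_iff[OF w h mk] by blast
    obtain a where a: "\<psi> a \<noteq> 1" using psi by (auto simp: nontrivial_additive_character_def)
    \<comment> \<open>translation by \<open>f1\<close> multiplies the sum by \<open>\<psi> a\<close>\<close>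
    define f1 where "f1 = K (a / w (h * f0)) * f0"
    have f1: "f1 \<in> forms k" unfolding f1_def using f0(1) by (rule forms_K_mult)
    have hf1: "h * f1 = K (a / w (h * f0)) * (h * f0)" by (simp add: f1_def mult.left_commute)
    have wf1: "w (h * f1) = a" unfolding hf1 dual_K[OF w hf[OF f0(1)]] using f0(2) by simp
    let ?S = "\<Sum>f\<in>forms k. \<psi> (w (h * f))"
    have "?S = (\<Sum>f\<in>forms k. \<psi> (w (h * (f + f1))))"
      by (rule sum.reindex_bij_witness[of _ "\<lambda>f. f + f1" "\<lambda>f. f - f1"])
        (auto intro: forms_add forms_diff f1)
    also have "\<dots> = (\<Sum>f\<in>forms k. \<psi> a * \<psi> (w (h * f)))"
    proof (intro sum.cong refl)
      fix f :: "'a bipoly" assume "f \<in> forms k"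
      then have "w (h * (f + f1)) = w (h * f) + a"
        using dual_add[OF w hf hf[OF f1]] wf1 by (simp add: distrib_left)
      then show "\<psi> (w (h * (f + f1))) = \<psi> a * \<psi> (w (h * f))"
          by (simp add: psi_add mult.commute)
    qed
    also have "\<dots> = \<psi> a * ?S" by (simp add: sum_distrib_left)
    finally have "?S = 0" using a by simp
    then show ?thesis using False by simp
  qed
qed

lemma character_sum_multiples:
  fixes \<psi> :: "'a::finite_field \<Rightarrow> complex"
  assumes psi: "nontrivial_additive_character \<psi>" and w: "w \<in> dual_forms n"
    and h: "h \<in> forms m" "h \<noteq> 0" and mk: "m + k = n"
  shows "(\<Sum>f | f \<in> forms n \<and> h dvd f. \<psi> (w f)) =
    (if h \<in> apolar_ideal n w then of_nat (card (UNIV :: 'a set)) ^ Suc k else 0)"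
proof -
  have "{f. f \<in> forms n \<and> h dvd f} = (\<lambda>k. h * k) ` forms k"
    using forms_multiples[OF h, of k] mk by simp
  moreover have "inj_on (\<lambda>k. h * k) (forms k)" using h(2) by (auto intro: inj_onI)
  ultimately have "(\<Sum>f | f \<in> forms n \<and> h dvd f. \<psi> (w f))
      = (\<Sum>f\<in>forms k. \<psi> (w (h * f)))"
    by (simp add: sum.reindex)
  then show ?thesis using character_sum[OF psi w h(1) mk] by simp
qed

text \<open>The nonzero linear, respectively quadratic, forms whose square lies in the apolar ideal.\<close>

definition apolar_lins :: "('a::field bipoly \<Rightarrow> 'a) \<Rightarrow> 'a bipoly set" where
  "apolar_lins w = {l \<in> lins. l ^ 2 \<in> apolar_ideal 5 w}"
definition apolar_quads :: "('a::field bipoly \<Rightarrow> 'a) \<Rightarrow> 'a bipoly set" where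
  "apolar_quads w = {g \<in> quads. g ^ 2 \<in> apolar_ideal 5 w}"

lemma Phi_hat_sum:
  fixes \<psi> :: "'a::finite_field \<Rightarrow> complex"
  assumes char: "CHAR('a) = 2" and psi: "nontrivial_additive_character \<psi>"
    and w: "w \<in> dual_forms 5" and q: "q = of_nat (card (UNIV :: 'a set))"
  shows "q ^ 6 * (q - 1) * Phi_hat \<psi> w
      = q ^ 4 * of_nat (card (apolar_lins w)) - q ^ 2 * (\<Sum>g\<in>apolar_quads w. eps g)"
proof -
  have q2: "card (UNIV :: 'a set) \<ge> 2" by (rule card_field_ge_2)
  then have q1: "of_nat (card (UNIV :: 'a set) - 1) = q - 1" unfolding q by (simp add: of_nat_diff)
  have qnz: "q \<noteq> 0" using q2 unfolding q by simp
  have fin: "finite (forms n :: 'a bipoly set)" for n by simp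
  have sq: "l ^ 2 \<in> forms 2" if "l \<in> lins" for l :: "'a bipoly"
      using forms_power[of l 1 2] that by auto
  have sq': "g ^ 2 \<in> forms 4" if "g \<in> quads" for g :: "'a bipoly"
      using forms_power[of g 2 2] that by auto
  have ind: "(\<Sum>l | l \<in> lins \<and> l ^ 2 dvd f. 1) - (\<Sum>g | g \<in> quads
      \<and> g ^ 2 dvd f. eps g) = (if squarefree f then 0 else q - 1)"
    if "f \<in> forms 5" for f :: "'a bipoly"
    using moebius_identity[OF char that] q1 by simp
  have "(q - 1) * (\<Sum>f\<in>singular_forms 5. \<psi> (w f))
      = (\<Sum>f\<in>forms 5. (if squarefree f then 0 else q - 1) * \<psi> (w f))"
    unfolding singular_forms_def sum_distrib_left sum.inter_filter[OF fin] by (intro sum.cong) auto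
  also have "\<dots> = (\<Sum>f\<in>forms 5. ((\<Sum>l | l \<in> lins
      \<and> l ^ 2 dvd f. 1) - (\<Sum>g | g \<in> quads \<and> g ^ 2 dvd f. eps g)) * \<psi> (w f))"
    by (intro sum.cong refl) (simp only: ind)
  also have "\<dots> = (\<Sum>f\<in>forms 5. \<Sum>l | l \<in> lins
      \<and> l ^ 2 dvd f. \<psi> (w f)) - (\<Sum>f\<in>forms 5. \<Sum>g | g \<in> quads
      \<and> g ^ 2 dvd f. eps g * \<psi> (w f))"
    by (simp only: left_diff_distrib sum_subtractf sum_distrib_right mult_1_left)
  also have "(\<Sum>f\<in>forms 5. \<Sum>l | l \<in> lins \<and> l ^ 2 dvd f. \<psi> (w f))
      = (\<Sum>l\<in>lins. \<Sum>f | f \<in> forms 5 \<and> l ^ 2 dvd f. \<psi> (w f))"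
    by (rule sum.swap_restrict) simp_all
  also have "\<dots> = (\<Sum>l\<in>lins. if l ^ 2 \<in> apolar_ideal 5 w then q ^ 4 else 0)"
  proof (intro sum.cong refl)
    fix l :: "'a bipoly" assume l: "l \<in> lins"
    have nz: "l ^ 2 \<noteq> 0" using l by simp
    show "(\<Sum>f | f \<in> forms 5 \<and> l ^ 2 dvd f. \<psi> (w f))
        = (if l ^ 2 \<in> apolar_ideal 5 w then q ^ 4 else 0)"
      using character_sum_multiples[OF psi w sq[OF l] nz, of 3] unfolding q by simp
  qed
  also have "\<dots> = q ^ 4 * of_nat (card (apolar_lins w))"
    unfolding apolar_lins_def by (subst sum.inter_filter[symmetric]) simp_all
  also have "(\<Sum>f\<in>forms 5. \<Sum>g | g \<in> quads \<and> g ^ 2 dvd f. eps g * \<psi> (w f))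
      = (\<Sum>g\<in>quads. \<Sum>f | f \<in> forms 5 \<and> g ^ 2 dvd f. eps g * \<psi> (w f))"
    by (rule sum.swap_restrict) simp_all
  also have "\<dots> = (\<Sum>g\<in>quads. if g ^ 2 \<in> apolar_ideal 5 w then q ^ 2 * eps g else 0)"
  proof (intro sum.cong refl)
    fix g :: "'a bipoly" assume g: "g \<in> quads"
    have nz: "g ^ 2 \<noteq> 0" using g by simp
    show "(\<Sum>f | f \<in> forms 5 \<and> g ^ 2 dvd f. eps g * \<psi> (w f))
        = (if g ^ 2 \<in> apolar_ideal 5 w then q ^ 2 * eps g else 0)"
      unfolding sum_distrib_left[symmetric]
      using character_sum_multiples[OF psi w sq'[OF g] nz, of 1] unfolding q by (simp add: power2_eq_square)
  qed
  also have "\<dots> = q ^ 2 * (\<Sum>g\<in>apolar_quads w. eps g)"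
    unfolding apolar_quads_def sum_distrib_left by (rule sum.inter_filter[symmetric]) simp
  finally have "(q - 1) * (\<Sum>f\<in>singular_forms 5. \<psi> (w f))
      = q ^ 4 * of_nat (card (apolar_lins w)) - q ^ 2 * (\<Sum>g\<in>apolar_quads w. eps g)" .
  moreover have "q ^ 6 * Phi_hat \<psi> w = (\<Sum>f\<in>singular_forms 5. \<psi> (w f))"
    using qnz unfolding Phi_hat_def card_forms q by simp
  ultimately show ?thesis by (simp add: mult.assoc mult.left_commute)
qed

text \<open>Each class in the sum defining \<open>C\<close> consists of \<open>q - 1\<close> forms with the same value of \<open>\<epsilon>\<close>.\<close>

lemma C_const_sum:
  fixes w :: "'a::finite_field bipoly \<Rightarrow> 'a"
  assumes w: "w \<in> dual_forms 5" and q: "q = of_nat (card (UNIV :: 'a set))"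
  shows "(q - 1) * C_const w = - (\<Sum>g\<in>apolar_quads w. eps g)"
proof -
  define Ps where "Ps = {P. P \<in> proj_forms 2 \<and> (\<exists>f\<in>P. f ^ 2 \<in> apolar_ideal 5 w)}"
  have cls: "\<exists>f\<in>quads. P
      = {g. proportional f g}" if "P \<in> proj_forms 2" for P :: "'a bipoly set"
    using that unfolding proj_forms_def by (auto elim!: quotientE)
  have cls': "{g. proportional f g} \<in> proj_forms 2" if "f \<in> quads" for f :: "'a bipoly"
    using quotientI[OF that, of "{(f, g). f \<in> quads \<and> proportional f g}"] that
    unfolding proj_forms_def by (simp add: Image_def)
  have ap: "g ^ 2 \<in> apolar_ideal 5 w
      \<longleftrightarrow> f ^ 2 \<in> apolar_ideal 5 w" if "f \<in> quads" "proportional f g" for f g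
    using that forms_power[of f 2 2] by (intro apolar_proportional[OF w, of _ 4] proportional_power2) auto
  have "(q - 1) * (\<Sum>P\<in>Ps. epsilon P) = (\<Sum>P\<in>Ps. \<Sum>g\<in>P. eps g)"
    unfolding sum_distrib_left
  proof (intro sum.cong refl)
    fix P assume "P \<in> Ps"
    then obtain f where f: "f \<in> quads" "P = {g. proportional f g}" using cls unfolding Ps_def by blast
    then have "f \<noteq> 0" by simp
    from sum_eps_proportional[OF this] show "(q - 1) * epsilon P = (\<Sum>g\<in>P. eps g)"
      using card_field_ge_2[where 'a = 'a] unfolding f(2) eps_def[symmetric] q by (simp add: of_nat_diff)
  qed
  also have "\<dots> = (\<Sum>g\<in>\<Union>Ps. eps g)"
  proof (subst sum.Union_disjoint)
    show "\<forall>P\<in>Ps. finite P" using cls unfolding Ps_def by fastforce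
    show "\<forall>P\<in>Ps. \<forall>Q\<in>Ps. P \<noteq> Q \<longrightarrow> P \<inter> Q = {}"
    proof (intro ballI impI)
      fix P Q assume "P \<in> Ps" "Q \<in> Ps" and ne: "P \<noteq> Q"
      then obtain f g where fg: "P = {h. proportional f h}" "Q = {h. proportional g h}"
        using cls unfolding Ps_def by blast
      have "P = Q" if "h \<in> P" "h \<in> Q" for h
        using that unfolding fg using proportional_cong proportional_sym by blast
      with ne show "P \<inter> Q = {}" by blast
    qed
  qed simp
  also have "\<Union>Ps = apolar_quads w"
  proof
    show "\<Union>Ps \<subseteq> apolar_quads w"
    proof
      fix g assume "g \<in> \<Union>Ps"
      then obtain P h where P: "P \<in> proj_forms 2" "h \<in> P" "h ^ 2 \<in> apolar_ideal 5 w" "g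
          \<in> P" unfolding Ps_def by blast
      then obtain f where f: "f \<in> quads" "P = {g. proportional f g}" using cls by blast
      then have "g \<in> quads" using P(4) proportional_forms by blast
      moreover have "g ^ 2 \<in> apolar_ideal 5 w" using P(2-4) ap[OF f(1)] f(2) by blast
      ultimately show "g \<in> apolar_quads w" by (simp add: apolar_quads_def)
    qed
    show "apolar_quads w \<subseteq> \<Union>Ps"
    proof
      fix g assume g: "g \<in> apolar_quads w"
      then have "{h. proportional g h} \<in> proj_forms 2" "g \<in> {h. proportional g h}" "g ^ 2 \<in>
          apolar_ideal 5 w"
        using cls'[of g] unfolding apolar_quads_def by simp_all
      then have "{h. proportional g h} \<in> Ps" "g \<in> {h. proportional g h}" unfolding Ps_def by blast+
      then show "g \<in> \<Union>Ps" by blast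
    qed
  qed
  finally show ?thesis unfolding C_const_def Ps_def[symmetric] by simp
qed

section \<open>The quadratic forms with apolar square\<close>

lemma XY_in_forms: "X ^ j * Y ^ i \<in> forms (j + i)"
  using forms_mult[OF forms_power[OF X_in_forms, of j] forms_power[OF Y_in_forms, of i]] by simp

lemma coord_eq: "i \<le> 5 \<Longrightarrow> X ^ (5 - i) * Y ^ i \<in> forms 5" "w (X ^ (5 - i) * Y ^
    i) = coord w i"
  using XY_in_forms[of "5 - i" i] by (simp_all add: coord_def xy_monom_eq)

lemma dual_bform:
  assumes w: "w \<in> dual_forms 5"
  shows "w (bform 5 c) = (\<Sum>i\<le>5. c i * coord w i)"
proof -
  have "w (bform 5 c) = (\<Sum>i\<le>5. w (K (c i) * (X ^ (5 - i) * Y ^ i)))"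
    unfolding bform_def mult.assoc
    by (rule dual_sum[OF w]) (auto intro!: forms_K_mult coord_eq(1))
  also have "\<dots> = (\<Sum>i\<le>5. c i * coord w i)"
    by (intro sum.cong refl) (simp add: dual_K[OF w coord_eq(1)] coord_eq(2))
  finally show ?thesis .
qed

lemma dual_eq_0I:
  assumes w: "w \<in> dual_forms 5" and z: "\<And>i. i \<le> 5 \<Longrightarrow> coord w i = 0"
  shows "w = (\<lambda>_. 0)"
proof
  fix f
  show "w f = 0"
  proof (cases "f \<in> forms 5")
    case True
    have "w f = w (bform 5 (\<lambda>i. poly.coeff (poly.coeff f i) (5 - i)))"
        using forms_eq_bform[OF True] by simp
    also have "\<dots> = 0" unfolding dual_bform[OF w] by (intro sum.neutral) (simp add: z)
    finally show ?thesis .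
  next
    case False
    with w show ?thesis by (simp add: dual_forms_def)
  qed
qed

lemma dual_comb3:
  assumes "w \<in> dual_forms n" "f \<in> forms n" "g \<in> forms n" "h \<in> forms n"
  shows "w (K a * f + K b * g + K c * h) = a * w f + b * w g + c * w h"
  using assms by (simp add: dual_add dual_K forms_add forms_K_mult)

lemma dual_comb_coord:
  assumes "w \<in> dual_forms 5" "i \<le> 5" "j \<le> 5" "k \<le> 5"
  shows "w (K a * (X ^ (5 - i) * Y ^ i) + K b * (X ^ (5 - j) * Y ^ j) + K c * (X ^ (5 - k) * Y ^ k)) =
    a * coord w i + b * coord w j + c * coord w k"
  using dual_comb3[OF assms(1) coord_eq(1)[OF assms(2)] coord_eq(1)[OF assms(3)] coord_eq(1)[OF
      assms(4)]] assms(2-4)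
  by (simp add: coord_eq(2))

lemma dual_comb2:
  assumes "w \<in> dual_forms n" "f \<in> forms n" "g \<in> forms n"
  shows "w (K a * f + K b * g) = a * w f + b * w g"
  using assms by (simp add: dual_add dual_K forms_K_mult)

lemma apolar_iff_XY:
  assumes w: "w \<in> dual_forms n" and f: "f \<in> forms m" "Suc m = n"
  shows "f \<in> apolar_ideal n w \<longleftrightarrow> w (f * X) = 0 \<and> w (f * Y) = 0"
proof -
  have *: "f * X \<in> forms n" "f * Y \<in> forms n" using forms_mult[OF f(1), of _ 1] f(2) by auto
  have "w (f * lin u v) = u * w (f * X) + v * w (f * Y)" for u v
    using dual_comb2[OF w *, of u v] by (simp add: lin_def algebra_simps)
  moreover have "f \<in> apolar_ideal n w \<longleftrightarrow> (\<forall>h\<in>forms 1. w (f * h) = 0)"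
    using f by (intro in_apolar_iff[OF w]) auto
  ultimately show ?thesis by (metis X_in_forms Y_in_forms add_0 forms_1E mult_zero_right)
qed

lemma char2_double:
  fixes x :: "'a::field bipoly" assumes "CHAR('a) = 2" shows "x + x = 0"
proof -
  have "(1::'a) + 1 = 0" using char2_uminus[OF assms, of 1] by (metis add.left_inverse)
  then have "K (1 + 1) * x = 0" by (simp only: K_0 mult_zero_left)
  then show ?thesis by (simp only: K_add K_1 distrib_right mult_1_left)
qed

lemma char2_add_square:
  fixes x y :: "'a::field bipoly" assumes "CHAR('a) = 2" shows "(x + y) ^ 2 = x ^ 2 + y ^ 2"
proof -
  have "(x + y) ^ 2 = x ^ 2 + y ^ 2 + (x * y + x * y)" by (simp add: power2_eq_square algebra_simps)
  then show ?thesis by (simp add: char2_double[OF assms])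
qed

lemma char2_add_square_field:
  fixes x y :: "'a::field" assumes "CHAR('a) = 2" shows "(x + y) ^ 2 = x ^ 2 + y ^ 2"
proof -
  have "K ((x + y) ^ 2) = K (x ^ 2 + y ^ 2)"
    using char2_add_square[OF assms, of "K x" "K y"] by (simp add: K_add K_power)
  then show ?thesis by (simp only: K_inj)
qed

lemma quad_square:
  fixes a b c :: "'a::field" assumes "CHAR('a) = 2"
  shows "quad a b c ^ 2 = K (a ^ 2) * X ^ 4 + K (b ^ 2) * (X ^ 2 * Y ^ 2) + K (c ^ 2) * Y ^ 4"
  unfolding quad_def char2_add_square[OF assms]
  by (simp add: K_power power_mult_distrib algebra_simps flip: power_mult)

lemma quad_square_apolar_iff:
  fixes a b c :: "'a::field"
  assumes char: "CHAR('a) = 2" and w: "w \<in> dual_forms 5"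
  shows "quad a b c ^ 2 \<in> apolar_ideal 5 w \<longleftrightarrow>
    coord w 0 * a ^ 2 + coord w 2 * b ^ 2 + coord w 4 * c ^ 2 = 0 \<and>
    coord w 1 * a ^ 2 + coord w 3 * b ^ 2 + coord w 5 * c ^ 2 = 0"
proof -
  have f: "quad a b c ^ 2 \<in> forms 4" using forms_power[of "quad a b c" 2 2] by simp
  have 1: "quad a b c ^ 2 * X = K (a ^ 2) * (X ^ (5 - 0) * Y ^ 0) + K (b ^ 2) * (X ^ (5 - 2) * Y ^ 2)
      + K (c ^ 2) * (X ^ (5 - 4) * Y ^ 4)"
    and 2: "quad a b c ^ 2 * Y = K (a ^ 2) * (X ^ (5 - 1) * Y ^ 1)
        + K (b ^ 2) * (X ^ (5 - 3) * Y ^ 3) + K (c ^ 2) * (X ^ (5 - 5) * Y ^ 5)"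
    unfolding quad_square[OF char] by (simp_all add: algebra_simps eval_nat_numeral)
  have "w (quad a b c ^ 2 * X) = a ^ 2 * coord w 0 + b ^ 2 * coord w 2 + c ^ 2 * coord w 4"
    unfolding 1 by (rule dual_comb_coord[OF w]) simp_all
  moreover have "w (quad a b c ^ 2 * Y) = a ^ 2 * coord w 1 + b ^ 2 * coord w 3 + c ^ 2 * coord w 5"
    unfolding 2 by (rule dual_comb_coord[OF w]) simp_all
  moreover have "quad a b c ^ 2 \<in> apolar_ideal 5 w \<longleftrightarrow> w (quad a b c ^ 2 * X)
      = 0 \<and> w (quad a b c ^ 2 * Y) = 0"
    by (rule apolar_iff_XY[OF w f]) simp
  ultimately show ?thesis by (simp add: mult.commute)
qed

text \<open>Every cubic monomial is the product of the square of a variable and a variable, so \<open>l\<^sup>2\<close> is apolar to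
  \<open>w\<close> as soon as all \<open>l\<^sup>2 m\<^sup>2\<close> are.\<close>

lemma lin_square_apolar_iff:
  fixes l :: "'a::field bipoly"
  assumes w: "w \<in> dual_forms 5" and l: "l \<in> forms 1"
  shows "l ^ 2 \<in> apolar_ideal 5 w
      \<longleftrightarrow> (\<forall>m\<in>forms 1. (l * m) ^ 2 \<in> apolar_ideal 5 w)"
proof
  have l2: "l ^ 2 \<in> forms 2" using forms_power[OF l, of 2] by simp
  show "l ^ 2 \<in> apolar_ideal 5 w
      \<Longrightarrow> \<forall>m\<in>forms 1. (l * m) ^ 2 \<in> apolar_ideal 5 w"
  proof
    fix m :: "'a bipoly" assume "l ^ 2 \<in> apolar_ideal 5 w" "m \<in> forms 1"
    then show "(l * m) ^ 2 \<in> apolar_ideal 5 w"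
      using apolar_mult[OF w l2, of "m ^ 2" 2] forms_power[of m 1 2] by (simp add: power_mult_distrib)
  qed
  assume *: "\<forall>m\<in>forms 1. (l * m) ^ 2 \<in> apolar_ideal 5 w"
  have 0: "w (l ^ 2 * m ^ 2 * k) = 0" if "m \<in> forms 1" "k \<in> forms 1" for m k
    using in_apolar_iff[OF w forms_power[OF forms_mult[OF l that(1)], of 2], of 1] * that
    by (simp add: power_mult_distrib)
  have F: "l ^ 2 * (m ^ 2 * k) \<in> forms 5" if "m \<in> forms 1" "k \<in> forms 1" for m k
    using forms_mult[OF l2 forms_mult[OF forms_power[OF that(1), of 2] that(2)]] by simp
  have "w (l ^ 2 * h) = 0" if h: "h \<in> forms 3" for h
  proof -
    define c where "c = (\<lambda>i. poly.coeff (poly.coeff h i) (3 - i))"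
    have "h = bform 3 c" unfolding c_def by (rule forms_eq_bform[OF h])
    also have "\<dots> = K (c 0) * (X ^ 2 * X) + (K (c 1) * (X ^ 2 * Y) + (K (c 2) * (Y ^ 2 * X)
        + K (c 3) * (Y ^ 2 * Y)))"
      unfolding bform_def by (simp add: numeral_3_eq_3 numeral_2_eq_2 algebra_simps)
    finally have "l ^ 2 * h = K (c 0) * (l ^ 2 * (X ^ 2 * X)) + (K (c 1) * (l ^ 2 * (X ^ 2 * Y))
        + (K (c 2) * (l ^ 2 * (Y ^ 2 * X)) + K (c 3) * (l ^ 2 * (Y ^ 2 * Y))))"
      by (simp add: algebra_simps)
    also have "w \<dots> = 0"
    proof -
      have "w (K a * f1 + (K b * f2 + (K c * f3 + K d * f4))) = 0"
        if "f1 \<in> Z" "f2 \<in> Z" "f3 \<in> Z" "f4 \<in> Z" "Z = {f \<in> forms 5. w f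
            = 0}" for a b c d f1 f2 f3 f4 Z
        using that by (simp add: dual_add[OF w] dual_K[OF w] forms_add forms_K_mult)
      from this[OF _ _ _ _ refl] show ?thesis using 0 F by (simp add: mult.assoc)
    qed
    finally show ?thesis .
  qed
  then show "l ^ 2 \<in> apolar_ideal 5 w" using in_apolar_iff[OF w l2, of 3] by simp
qed

lemma card_linear_2:
  fixes p r :: "'a::finite_field"
  assumes "p \<noteq> 0 \<or> r \<noteq> 0"
  shows "card {(s, t). p * s + r * t = 0} = card (UNIV :: 'a set)"
proof (cases "p = 0")
  case False
  have "{(s, t). p * s + r * t = 0} = range (\<lambda>t. (- (r * t) / p, t))"
    using False by (auto simp: field_simps eq_neg_iff_add_eq_0 image_iff)
  moreover have "inj (\<lambda>t. (- (r * t) / p, t))" by (auto intro: injI)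
  ultimately show ?thesis by (simp add: card_image)
next
  case True
  have "{(s, t). p * s + r * t = 0} = range (\<lambda>s. (s, 0))"
    using True assms by auto
  moreover have "inj (\<lambda>s :: 'a. (s, 0 :: 'a))" by (auto intro: injI)
  ultimately show ?thesis by (simp add: card_image)
qed

lemma card_linear_3:
  fixes p r s :: "'a::finite_field"
  assumes "p \<noteq> 0 \<or> r \<noteq> 0 \<or> s \<noteq> 0"
  shows "card {(a, b, c). p * a + r * b + s * c = 0} = card (UNIV :: 'a set) ^ 2"
proof (cases "p = 0")
  case False
  have "{(a, b, c). p * a + r * b + s * c = 0} = (\<lambda>(b, c). (- (r * b
      + s * c) / p, b, c)) ` (UNIV \<times> UNIV)"
    using False by (auto simp: field_simps eq_neg_iff_add_eq_0 image_iff)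
  moreover have "inj_on (\<lambda>(b, c). (- (r * b + s * c) / p, b, c)) (UNIV \<times> UNIV)"
      by (auto intro: inj_onI)
  ultimately show ?thesis by (simp add: card_image card_cartesian_product power2_eq_square del:
      UNIV_Times_UNIV)
next
  case True
  have "{(a, b, c). p * a + r * b + s * c = 0} = UNIV \<times> {(b, c). r * b + s * c = 0}"
    using True by auto
  then show ?thesis using card_linear_2[of r s] True assms
    by (simp add: card_cartesian_product power2_eq_square)
qed

text \<open>The linear relation with coefficients \<open>u\<close>, \<open>v\<close> between the two equations of
  \<open>quad_square_apolar_iff\<close>; in characteristic 2 equivalently,
  \<open>u x + v y\<close> times every square of a quadratic form is annihilated
  by \<open>w\<close>.\<close>

definition rows_dependent :: "('a::field bipoly \<Rightarrow> 'a) \<Rightarrow> 'a \<Rightarrow> 'a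
    \<Rightarrow> bool" where
  "rows_dependent w u v \<longleftrightarrow> u * coord w 0 + v * coord w 1 = 0 \<and> u * coord w 2
      + v * coord w 3 = 0 \<and>
     u * coord w 4 + v * coord w 5 = 0"

lemma char2_square_inj:
  fixes x y :: "'a::field" assumes "CHAR('a) = 2" "x ^ 2 = y ^ 2" shows "x = y"
  using assms(2) char2_uminus[OF assms(1), of y] by (auto simp: power2_eq_iff)

lemma cross_product_zero:
  fixes x y z :: "'b::comm_ring_1"
  assumes e: "a0 * x + a2 * y + a4 * z = 0" "a1 * x + a3 * y + a5 * z = 0"
  shows "x * (a4 * a1 - a0 * a5) = y * (a2 * a5 - a4 * a3)"
    "x * (a0 * a3 - a2 * a1) = z * (a2 * a5 - a4 * a3)"
    "y * (a0 * a3 - a2 * a1) = z * (a4 * a1 - a0 * a5)"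
proof -
  have "x * (a4 * a1 - a0 * a5) - y * (a2 * a5 - a4 * a3) =
      a4 * (a1 * x + a3 * y + a5 * z) - a5 * (a0 * x + a2 * y + a4 * z)"
    "x * (a0 * a3 - a2 * a1) - z * (a2 * a5 - a4 * a3) =
      a3 * (a0 * x + a2 * y + a4 * z) - a2 * (a1 * x + a3 * y + a5 * z)"
    "y * (a0 * a3 - a2 * a1) - z * (a4 * a1 - a0 * a5) =
      a0 * (a1 * x + a3 * y + a5 * z) - a1 * (a0 * x + a2 * y + a4 * z)"
    by (simp_all add: algebra_simps)
  then show "x * (a4 * a1 - a0 * a5) = y * (a2 * a5 - a4 * a3)"
    "x * (a0 * a3 - a2 * a1) = z * (a2 * a5 - a4 * a3)"
    "y * (a0 * a3 - a2 * a1) = z * (a4 * a1 - a0 * a5)"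
    unfolding e by simp_all
qed

lemma dual_eq_0_coordI:
  assumes w: "w \<in> dual_forms 5" and z: "coord w 0 = 0" "coord w 1 = 0" "coord w 2 = 0" "coord w 3
      = 0" "coord w 4 = 0" "coord w 5 = 0"
  shows "w = (\<lambda>_. 0)"
proof (rule dual_eq_0I[OF w])
  fix i :: nat assume "i \<le> 5"
  then consider "i = 0" | "i = 1" | "i = 2" | "i = 3" | "i = 4" | "i = 5" by linarith
  then show "coord w i = 0" using z by cases auto
qed

lemma apolar_quads_proportional:
  assumes w: "w \<in> dual_forms 5" and "g \<in> apolar_quads w" "proportional g h"
  shows "h \<in> apolar_quads w"
  using assms proportional_forms[OF assms(3), of 2]
    apolar_proportional[OF w forms_power[of g 2 2] _ proportional_power2[OF assms(3)]]
  by (auto simp: apolar_quads_def)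

text \<open>Independent equations: the squares of the coefficients of the solutions are the multiples of the
  cross product of the two rows.\<close>

lemma apolar_quads_independent:
  fixes w :: "'a::finite_field bipoly \<Rightarrow> 'a"
  assumes char: "CHAR('a) = 2" and w: "w \<in> dual_forms 5"
    and indep: "\<And>u v. u \<noteq> 0 \<or> v \<noteq> 0 \<Longrightarrow> \<not> rows_dependent w u v"
  obtains g0 where "g0 \<in> quads" "apolar_quads w = {g. proportional g0 g}"
proof -
  define a where "a = coord w"
  define n1 where "n1 = a 2 * a 5 - a 4 * a 3"
  define n2 where "n2 = a 4 * a 1 - a 0 * a 5"
  define n3 where "n3 = a 0 * a 3 - a 2 * a 1"
  have nz: "n1 \<noteq> 0 \<or> n2 \<noteq> 0 \<or> n3 \<noteq> 0"
  proof (rule ccontr)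
    assume "\<not> ?thesis"
    then have n: "a 2 * a 5 = a 4 * a 3" "a 4 * a 1 = a 0 * a 5" "a 0 * a 3 = a 2 * a 1"
      by (simp_all add: n1_def n2_def n3_def)
    have z: "x * y + - z * t = 0" if "x * y = z * t" for x y z t :: 'a using that by simp
    have n': "a 1 * a 2 = a 0 * a 3" "a 1 * a 4 = a 0 * a 5" "a 3 * a 4 = a 2 * a 5"
      "a 3 * a 0 = a 2 * a 1" "a 5 * a 0 = a 4 * a 1" "a 5 * a 2 = a 4 * a 3"
      using n by (simp_all only: mult.commute)
    have "rows_dependent w (a 1) (- a 0)" "rows_dependent w (a 3) (- a 2)" "rows_dependent w (a 5) (- a 4)"
      unfolding rows_dependent_def a_def[symmetric] by (intro conjI z n' mult.commute)+
    then have "a 0 = 0" "a 2 = 0" "a 4 = 0"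
      using indep[of "a 1" "- a 0"] indep[of "a 3" "- a 2"] indep[of "a 5" "- a 4"] by auto
    then have "rows_dependent w 1 0" by (simp add: rows_dependent_def a_def)
    then show False using indep[of 1 0] by simp
  qed
  obtain m1 where m1: "n1 = m1 ^ 2" by (rule char2_sqrt[OF char])
  obtain m2 where m2: "n2 = m2 ^ 2" by (rule char2_sqrt[OF char])
  obtain m3 where m3: "n3 = m3 ^ 2" by (rule char2_sqrt[OF char])
  note m = m1 m2 m3
  define g0 where "g0 = quad m1 m2 m3"
  have g0: "g0 \<in> quads" using nz m by (auto simp: g0_def quad_eq_0_iff)
  have "g0 ^ 2 \<in> apolar_ideal 5 w"
    unfolding g0_def quad_square_apolar_iff[OF char w] m[symmetric] n1_def n2_def n3_def a_def
    by (simp add: algebra_simps)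
  then have g0S: "g0 \<in> apolar_quads w" using g0 by (simp add: apolar_quads_def)
  have "proportional g0 g" if "g \<in> apolar_quads w" for g
  proof -
    have "g \<in> forms 2" using that by (simp add: apolar_quads_def)
    then obtain x y z where g: "g = quad x y z" by (rule forms_2E)
    have e: "a 0 * x ^ 2 + a 2 * y ^ 2 + a 4 * z ^ 2 = 0" "a 1 * x ^ 2 + a 3 * y ^ 2 + a 5 * z ^ 2 = 0"
      using that quad_square_apolar_iff[OF char w, of x y z] unfolding apolar_quads_def g a_def by blast+
    have c: "x ^ 2 * n2 = y ^ 2 * n1" "x ^ 2 * n3 = z ^ 2 * n1" "y ^ 2 * n3 = z ^ 2 * n2"
      unfolding n1_def n2_def n3_def using cross_product_zero[OF e] by blast+
    have "\<exists>t. x ^ 2 = t * n1 \<and> y ^ 2 = t * n2 \<and> z ^ 2 = t * n3"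
    proof -
      consider "n1 \<noteq> 0" | "n2 \<noteq> 0" | "n3 \<noteq> 0" using nz by blast
      then show ?thesis
      proof cases
        case 1 then show ?thesis by (intro exI[of _ "x ^ 2 / n1"]) (use c in \<open>simp add:
            field_simps\<close>)
      next
        case 2 then show ?thesis by (intro exI[of _ "y ^ 2 / n2"]) (use c in \<open>simp add:
            field_simps\<close>)
      next
        case 3 then show ?thesis by (intro exI[of _ "z ^ 2 / n3"]) (use c in \<open>simp add:
            field_simps\<close>)
      qed
    qed
    then obtain t where t: "x ^ 2 = t * n1" "y ^ 2 = t * n2" "z ^ 2 = t * n3" by blast
    obtain s where s: "t = s ^ 2" using char2_sqrt[OF char] .
    have "x ^ 2 = (s * m1) ^ 2" "y ^ 2 = (s * m2) ^ 2" "z ^ 2 = (s * m3) ^ 2"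
      unfolding power_mult_distrib t s m by (rule refl)+
    then have "x = s * m1" "y = s * m2" "z = s * m3"
      using char2_square_inj[OF char] by blast+
    then have gs: "g = K s * g0" by (simp add: g g0_def K_mult_quad)
    moreover have "s \<noteq> 0" using gs that by (auto simp: apolar_quads_def)
    ultimately show ?thesis by (auto simp: proportional_K)
  qed
  then have "apolar_quads w = {g. proportional g0 g}"
    using apolar_quads_proportional[OF w g0S] by blast
  with g0 that show ?thesis by blast
qed

lemma apolar_quads_dependent:
  fixes w :: "'a::finite_field bipoly \<Rightarrow> 'a"
  assumes char: "CHAR('a) = 2" and w: "w \<in> dual_forms 5" and wnz: "w \<noteq> (\<lambda>_. 0)"
    and dep: "u \<noteq> 0 \<or> v \<noteq> 0" "rows_dependent w u v"
  obtains al be ga where "al \<noteq> 0 \<or> be \<noteq> 0 \<or> ga \<noteq> 0"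
    "\<And>a b c. quad a b c ^ 2 \<in> apolar_ideal 5 w \<longleftrightarrow> al * a + be * b + ga * c = 0"
proof -
  have "\<exists>r1 r2 r3. (r1 \<noteq> 0 \<or> r2 \<noteq> 0 \<or> r3 \<noteq> 0) \<and>
    (\<forall>a b c. quad a b c ^ 2 \<in> apolar_ideal 5 w \<longleftrightarrow> r1 * a ^ 2
        + r2 * b ^ 2 + r3 * c ^ 2 = 0)"
  proof (cases "v = 0")
    case True
    then have z: "coord w 0 = 0" "coord w 2 = 0" "coord w 4 = 0" using dep
        by (auto simp: rows_dependent_def)
    have "coord w 1 \<noteq> 0 \<or> coord w 3 \<noteq> 0 \<or> coord w 5 \<noteq> 0"
      using dual_eq_0_coordI[OF w] z wnz by blast
    then show ?thesis
      using quad_square_apolar_iff[OF char w] z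
      by (intro exI[of _ "coord w 1"] exI[of _ "coord w 3"] exI[of _ "coord w 5"]) auto
  next
    case False
    define k where "k = - (u / v)"
    have s: "coord w 1 = k * coord w 0" "coord w 3 = k * coord w 2" "coord w 5 = k * coord w 4"
      using dep(2) False by (auto simp: rows_dependent_def k_def field_simps eq_neg_iff_add_eq_0)
    have "coord w 0 \<noteq> 0 \<or> coord w 2 \<noteq> 0 \<or> coord w 4 \<noteq> 0"
      using dual_eq_0_coordI[OF w] s wnz by auto
    moreover have "quad a b c ^ 2 \<in> apolar_ideal 5 w \<longleftrightarrow> coord w 0 * a ^ 2
        + coord w 2 * b ^ 2 + coord w 4 * c ^ 2 = 0" for a b c
    proof -
      have "coord w 1 * a ^ 2 + coord w 3 * b ^ 2 + coord w 5 * c ^ 2 = k * (coord w 0 * a ^ 2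
          + coord w 2 * b ^ 2 + coord w 4 * c ^ 2)"
        unfolding s by (simp add: algebra_simps)
      then show ?thesis unfolding quad_square_apolar_iff[OF char w] by auto
    qed
    ultimately show ?thesis by blast
  qed
  then obtain r1 r2 r3 where r: "r1 \<noteq> 0 \<or> r2 \<noteq> 0 \<or> r3 \<noteq> 0"
    "\<And>a b c. quad a b c ^ 2 \<in> apolar_ideal 5 w \<longleftrightarrow> r1 * a ^ 2 + r2 * b ^ 2
        + r3 * c ^ 2 = 0" by blast
  obtain al where al: "r1 = al ^ 2" by (rule char2_sqrt[OF char])
  obtain be where be: "r2 = be ^ 2" by (rule char2_sqrt[OF char])
  obtain ga where ga: "r3 = ga ^ 2" by (rule char2_sqrt[OF char])
  note m = al be ga
  have "r1 * a ^ 2 + r2 * b ^ 2 + r3 * c ^ 2 = (al * a + be * b + ga * c) ^ 2" for a b c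
    unfolding m char2_add_square_field[OF char] power_mult_distrib ..
  then show ?thesis using that[of al be ga] r m by auto
qed

lemma apolar_lins_unique:
  fixes w :: "'a::finite_field bipoly \<Rightarrow> 'a"
  assumes E: "\<And>u v. lin u v \<in> apolar_lins w \<longleftrightarrow> (u \<noteq> 0
      \<or> v \<noteq> 0) \<and> al * u + be * v = 0 \<and> be * u + ga * v = 0"
    and nz: "al \<noteq> 0 \<or> be \<noteq> 0
        \<or> ga \<noteq> 0" and l: "l \<in> apolar_lins w" "l' \<in> apolar_lins w"
  shows "proportional l l'"
proof -
  have lins: "l \<in> lins" "l' \<in> lins" using l by (auto simp: apolar_lins_def)
  obtain u v where uv: "l = lin u v" "u \<noteq> 0 \<or> v \<noteq> 0" using lins(1) by (rule linsE)
  obtain u' v' where uv': "l' = lin u' v'" "u' \<noteq> 0 \<or> v' \<noteq> 0" using lins(2) by (rule linsE)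
  obtain x y where xy: "x \<noteq> 0 \<or> y \<noteq> 0" "x * u + y * v = 0" "x * u' + y * v' = 0"
    using l nz unfolding uv uv' E by blast
  have "x * (u * v' - u' * v) = v' * (x * u + y * v) - v * (x * u' + y * v')"
    "y * (u * v' - u' * v) = u * (x * u' + y * v') - u' * (x * u + y * v)"
    by (simp_all add: algebra_simps)
  then have "x * (u * v' - u' * v) = 0" "y * (u * v' - u' * v) = 0" using xy(2,3) by simp_all
  then have d: "u * v' = u' * v" using xy(1) by auto
  have "l dvd l'"
    unfolding uv(1) uv'(1) lin_dvd_iff[OF lin_in_forms(1) uv(2)] ev_lin using d by (simp add: algebra_simps)
  then show ?thesis using lins_dvd_lins[OF lins] by blast
qed

text \<open>For a linear form \<open>l\<close>, the multiples of \<open>l\<close> with apolar square are again given by one linear equation in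
  the coefficients of the cofactor, which is trivial exactly when \<open>l\<^sup>2\<close> itself is apolar.\<close>

lemma sum_eps_apolar_quads_dependent:
  fixes w :: "'a::finite_field bipoly \<Rightarrow> 'a"
  assumes w: "w \<in> dual_forms 5" and q: "q = of_nat (card (UNIV :: 'a set))"
    and nz: "al \<noteq> 0 \<or> be \<noteq> 0 \<or> ga \<noteq> 0"
    and S: "\<And>a b c. quad a b c ^ 2 \<in> apolar_ideal 5 w \<longleftrightarrow> al * a + be * b
        + ga * c = 0"
  shows "(\<Sum>g\<in>apolar_quads w. eps g) = q * of_nat (card (apolar_lins w))"
    and "apolar_lins w \<noteq> {} \<Longrightarrow> card (apolar_lins w) = card (UNIV :: 'a set) - 1"
proof -
  define N where "N = card (UNIV :: 'a set)"
  have N2: "N \<ge> 2" unfolding N_def by (rule card_field_ge_2)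
  have q1: "of_nat (N - 1) = q - 1" "of_nat (N ^ 2 - 1) = q ^ 2 - 1"
    using N2 by (simp_all add: q N_def of_nat_diff)
  have q0: "q \<noteq> 0" "q - 1 \<noteq> 0" using N2 q1(1) by (auto simp: q N_def)
  have lin_lin: "(lin u v * lin s t) ^ 2 \<in> apolar_ideal 5 w \<longleftrightarrow> (al * u
      + be * v) * s + (be * u + ga * v) * t = 0" for u v s t
    unfolding lin_mult S by (simp add: algebra_simps)
  have E: "lin u v \<in> apolar_lins w \<longleftrightarrow> (u \<noteq> 0 \<or> v \<noteq> 0)
      \<and> al * u + be * v = 0 \<and> be * u + ga * v = 0" for u v
  proof -
    have "lin u v ^ 2 \<in> apolar_ideal 5 w \<longleftrightarrow> (\<forall>s t. (al * u
        + be * v) * s + (be * u + ga * v) * t = 0)"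
      unfolding lin_square_apolar_iff[OF w lin_in_forms(1)] using lin_lin
          by (metis forms_1E lin_in_forms(1))
    also have "\<dots> \<longleftrightarrow> al * u + be * v = 0 \<and> be * u + ga * v = 0"
      by (metis add.right_neutral add_0 mult_1_right mult_zero_left mult_zero_right)
    finally show ?thesis by (auto simp: apolar_lins_def lin_eq_0_iff)
  qed
  have card_S: "card (apolar_quads w) = N ^ 2 - 1"
  proof -
    have "apolar_quads w = (\<lambda>(a, b, c). quad a b c) ` {(a, b, c). al * a + be * b + ga * c
        = 0} - {0}"
    proof (intro equalityI subsetI)
      fix g assume "g \<in> apolar_quads w"
      then have g: "g \<in> forms 2" "g \<noteq> 0" "g ^ 2 \<in> apolar_ideal 5 w"
          by (auto simp: apolar_quads_def)
      obtain a b c where abc: "g = quad a b c" using g(1) by (rule forms_2E)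
      then have "(a, b, c) \<in> {(a, b, c). al * a + be * b + ga * c = 0}" using g(3) S by simp
      then show "g \<in> (\<lambda>(a, b, c). quad a b c) ` {(a, b, c). al * a + be * b + ga * c = 0} - {0}"
        using g(2) abc by (intro DiffI image_eqI[of _ _ "(a, b, c)"]) auto
    qed (use S in \<open>auto simp: apolar_quads_def\<close>)
    moreover have "inj_on (\<lambda>(a, b, c). quad a b c) {(a, b, c). al * a + be * b + ga * c = 0}"
      by (auto intro!: inj_onI simp: quad_eq_iff)
    moreover have "0 \<in> (\<lambda>(a, b, c). quad a b c) ` {(a, b, c). al * a + be * b + ga * c = 0}"
      by (rule image_eqI[of _ _ "(0, 0, 0)"]) (auto simp: quad_eq_0_iff eq_commute[of 0])
    ultimately show ?thesis using card_linear_3[OF nz] by (simp add: card_Diff_singleton card_image N_def)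
  qed
  have card_l: "card {g \<in> apolar_quads w. l dvd g}
      = (if l \<in> apolar_lins w then N ^ 2 - 1 else N - 1)" if l: "l \<in> lins" for l
  proof -
    obtain u v where uv: "l = lin u v" "u \<noteq> 0 \<or> v \<noteq> 0" using l by (rule linsE)
    let ?T = "{(s, t). (al * u + be * v) * s + (be * u + ga * v) * t = 0}"
    have "{g \<in> apolar_quads w. l dvd g} = (\<lambda>(s, t). l * lin s t) ` ?T - {0}"
    proof -
      have "{g \<in> apolar_quads w. l dvd g} = {g \<in> {f \<in> forms (1
          + 1). l dvd f}. g ^ 2 \<in> apolar_ideal 5 w} - {0}"
        unfolding apolar_quads_def one_add_one by blast
      also have "{f \<in> forms (1 + 1). l dvd f} = (\<lambda>k. l * k) ` forms 1"
        by (rule forms_multiples) (use l in auto)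
      also have "{g \<in> (\<lambda>k. l * k) ` forms 1. g ^ 2 \<in> apolar_ideal 5 w}
          = (\<lambda>(s, t). l * lin s t) ` ?T"
        unfolding uv using lin_lin[of u v] by (auto elim!: forms_1E simp del: One_nat_def)
      finally show ?thesis .
    qed
    moreover have "inj_on (\<lambda>(s, t). l * lin s t) ?T"
      using l by (auto intro!: inj_onI simp: lin_eq_iff)
    moreover have "0 \<in> (\<lambda>(s, t). l * lin s t) ` ?T"
      by (rule image_eqI[of _ _ "(0, 0)"]) (auto simp: lin_def)
    ultimately have "card {g \<in> apolar_quads w. l dvd g} = card ?T - 1"
      by (simp add: card_Diff_singleton card_image)
    moreover have "card ?T = (if l \<in> apolar_lins w then N ^ 2 else N)"
    proof (cases "l \<in> apolar_lins w")
      case True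
      then have "?T = UNIV" using uv E by auto
      then have "card ?T = card (UNIV \<times> UNIV :: ('a \<times> 'a) set)" by simp
      also have "\<dots> = N ^ 2" unfolding card_cartesian_product N_def power2_eq_square ..
      finally show ?thesis using True by simp
    next
      case False
      then have "al * u + be * v \<noteq> 0 \<or> be * u + ga * v \<noteq> 0" using uv E by auto
      then show ?thesis using False card_linear_2 unfolding N_def by auto
    qed
    ultimately show ?thesis by simp
  qed
  define e where "e = card (apolar_lins w)"
  have sub: "apolar_lins w \<subseteq> lins" and sub': "apolar_quads w \<subseteq> quads"
    by (auto simp: apolar_lins_def apolar_quads_def)
  have "(\<Sum>l\<in>lins. of_nat (card {g \<in> apolar_quads w. l dvd g}) :: complex)
      = (\<Sum>l\<in>lins. (q - 1) + (if l \<in> apolar_lins w then q ^ 2 - q else 0))"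
    using card_l q1 by (intro sum.cong refl) (auto simp del: One_nat_def)
  also have "\<dots> = (q ^ 2 - 1) * (q - 1) + of_nat e * (q ^ 2 - q)"
  proof -
    have "(\<Sum>l\<in>lins. if l \<in> apolar_lins w then q ^ 2 - q else 0)
        = (\<Sum>l\<in>{l \<in> lins. l \<in> apolar_lins w}. q ^ 2 - q)"
      by (rule sum.inter_filter[symmetric]) simp
    also have "{l \<in> lins. l \<in> apolar_lins w} = apolar_lins w" using sub by blast
    finally show ?thesis using card_lins[where 'a = 'a] q1(2)
      by (simp add: sum.distrib e_def N_def del: One_nat_def)
  qed
  finally have "(q - 1) * (\<Sum>g\<in>apolar_quads w. eps g) = (q ^ 2 - 1) * (q - 1)
      + of_nat e * (q ^ 2 - q) - (q - 1) * (q ^ 2 - 1)"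
    using sum_eps_eq[OF sub'] card_S q1 unfolding N_def by (simp del: One_nat_def)
  also have "\<dots> = (q - 1) * (q * of_nat e)" by (simp add: power2_eq_square algebra_simps)
  finally show "(\<Sum>g\<in>apolar_quads w. eps g) = q * of_nat (card (apolar_lins w))"
      using q0 unfolding e_def by simp
  show "card (apolar_lins w) = card (UNIV :: 'a set) - 1" if ne: "apolar_lins w \<noteq> {}"
  proof -
    obtain l where l: "l \<in> apolar_lins w" using ne by blast
    then have lz: "l \<in> lins" by (auto simp: apolar_lins_def)
    have "m \<in> apolar_lins w" if "proportional l m" for m
      using that l proportional_forms[OF that lz] apolar_proportional[OF w forms_power[of l 1 2] _
          proportional_power2[OF that]]
      by (auto simp: apolar_lins_def)
    then have "apolar_lins w = {m. proportional l m}"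
      using apolar_lins_unique[OF E nz l] by blast
    then show ?thesis using card_proportional[of l] lz by simp
  qed
qed

lemma apolar_dichotomy:
  fixes w :: "'a::finite_field bipoly \<Rightarrow> 'a"
  assumes char: "CHAR('a) = 2" and w: "w \<in> dual_forms 5" and wnz: "w \<noteq> (\<lambda>_. 0)"
    and q: "q = of_nat (card (UNIV :: 'a set))"
  obtains (indep) g0 where "g0 \<in> quads" "apolar_quads w = {g. proportional g0 g}" "apolar_lins w
      = {}" "C_const w = - eps g0"
  | (dep) u v where "u \<noteq> 0 \<or> v \<noteq> 0" "rows_dependent w u v" "apolar_lins w
      = {}" "C_const w = 0"
  | (square) "card (apolar_lins w)
      = card (UNIV :: 'a set) - 1" "apolar_lins w \<noteq> {}" "C_const w = - q"
proof -
  have N2: "card (UNIV :: 'a set) \<ge> 2" by (rule card_field_ge_2)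
  then have q1: "of_nat (card (UNIV :: 'a set) - 1) = q - 1" by (simp add: q of_nat_diff)
  then have q0: "q - 1 \<noteq> 0" using N2
      by (metis of_nat_eq_0_iff One_nat_def diff_is_0_eq not_less_eq_eq numeral_2_eq_2)
  note C = C_const_sum[OF w q]
  show ?thesis
  proof (cases "\<exists>u v. (u \<noteq> 0 \<or> v \<noteq> 0) \<and> rows_dependent w u v")
    case False
    then obtain g0 where g0: "g0 \<in> quads" "apolar_quads w = {g. proportional g0 g}"
      using apolar_quads_independent[OF char w] by metis
    have "apolar_lins w = {}"
    proof (rule ccontr)
      assume "apolar_lins w \<noteq> {}"
      then obtain l where l: "l \<in> lins" "l ^ 2 \<in> apolar_ideal 5 w" by (auto simp: apolar_lins_def)
      \<comment> \<open>otherwise \<open>l x\<close> and \<open>l y\<close> would both be proportional to \<open>g0\<close>\<close>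
      have XY: "X \<in> (lins :: 'a bipoly set)" "Y \<in> (lins :: 'a bipoly set)"
        using lin_eq_0_iff[of "1::'a" 0] lin_eq_0_iff[of "0::'a" 1] by (auto simp: lin_def)
      have "l * m \<in> apolar_quads w" if "m \<in> lins" for m
        using lin_square_apolar_iff[OF w, of l] l that lins_mult[OF l(1) that]
            by (auto simp: apolar_quads_def)
      with XY g0 have "proportional (l * X) (l * Y)" using proportional_sym proportional_trans by blast
      then have "l * X dvd l * Y" using proportional_K dvd_triv_right by metis
      then have "X dvd (Y :: 'a bipoly)" using l(1) by simp
      then have "lin 1 0 dvd (Y :: 'a bipoly)" by (simp add: lin_def)
      then show False using lin_dvd_iff[of "Y :: 'a bipoly" 1 1 0] by simp
    qed
    moreover have "C_const w = - eps g0"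
      using C q0 sum_eps_proportional[of g0] g0(1) unfolding g0(2) q1
          by (auto simp: mult_minus_right[symmetric] simp del: mult_minus_right)
    ultimately show ?thesis using indep g0 by blast
  next
    case True
    then obtain u v where uv: "u \<noteq> 0 \<or> v \<noteq> 0" "rows_dependent w u v" by blast
    obtain al be ga where abc: "al \<noteq> 0 \<or> be \<noteq> 0 \<or> ga \<noteq> 0"
      "\<And>a b c. quad a b c ^ 2 \<in> apolar_ideal 5 w \<longleftrightarrow> al * a + be * b
          + ga * c = 0"
      using apolar_quads_dependent[OF char w wnz uv] by metis
    note s = sum_eps_apolar_quads_dependent[OF w q abc]
    show ?thesis
    proof (cases "apolar_lins w = {}")
      case True
      then have "C_const w = 0" using C s(1) q0 by simp
      with dep uv True show ?thesis by blast
    next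
      case False
      have "(q - 1) * C_const w = (q - 1) * (- q)" using C s(1) s(2)[OF False] q1
          by (simp add: algebra_simps del: One_nat_def)
      then have "C_const w = - q" using q0 by (subst (asm) mult_left_cancel) auto
      with square False s(2) show ?thesis by blast
    qed
  qed
qed

section \<open>Splitting types in degree at most three\<close>

lemma has_splitting_type_1:
  "has_splitting_type f {#(a, b)#} \<longleftrightarrow>
    (\<exists>c g. c \<noteq> 0 \<and> g \<in> forms a \<and> Factorial_Ring.irreducible g
        \<and> b \<ge> 1 \<and> f = K c * g ^ b)" (is "?L \<longleftrightarrow> ?R")
proof
  assume ?L
  then obtain c g d e and r :: nat where *: "c \<noteq> 0" 
    "\<forall>i<r. g i \<in> forms (d i) \<and> Factorial_Ring.irreducible (g i) \<and> e i \<ge> 1"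
    "f = scale c (\<Prod>i<r. g i ^ e i)" "{#(a, b)#} = {#(d i, e i). i \<in># mset_set {..<r}#}"
    unfolding has_splitting_type_def by (elim exE conjE) blast
  have "size {#(a, b)#} = size {#(d i, e i). i \<in># mset_set {..<r}#}" by (simp only: *(4))
  then have r: "r = 1" by simp
  with * have "a = d 0" "b = e 0" "f = K c * g 0 ^ e 0" by (simp_all add: scale_eq_K lessThan_Suc)
  with * r show ?R by (intro exI[of _ c] exI[of _ "g 0"]) simp
next
  assume ?R
  then obtain c g where "c \<noteq> 0" "g \<in> forms a" "Factorial_Ring.irreducible g" "b \<ge> 1" "f
      = K c * g ^ b" by blast
  then show ?L unfolding has_splitting_type_def
    by (intro exI[of _ c] exI[of _ 1] exI[of _ "\<lambda>_. g"] exI[of _ "\<lambda>_. a"] exI[of _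
        "\<lambda>_. b"])
      (simp add: scale_eq_K lessThan_Suc)
qed

lemma has_splitting_type_2:
  "has_splitting_type f {#(a, b), (a', b')#} \<longleftrightarrow>
    (\<exists>c g g'. c \<noteq> 0 \<and> g \<in> forms a \<and> Factorial_Ring.irreducible g
        \<and> b \<ge> 1 \<and>
      g' \<in> forms a' \<and> Factorial_Ring.irreducible g' \<and> b' \<ge> 1
          \<and> \<not> proportional g g' \<and> f
          = K c * (g ^ b * g' ^ b'))" (is "?L \<longleftrightarrow> ?R")
proof
  assume ?L
  then obtain c g d e and r :: nat where *: "c \<noteq> 0" 
    "\<forall>i<r. g i \<in> forms (d i) \<and> Factorial_Ring.irreducible (g i) \<and> e i \<ge> 1"
    "\<forall>i<r. \<forall>j<r. i \<noteq> j \<longrightarrow> \<not> proportional (g i) (g j)"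
    "f = scale c (\<Prod>i<r. g i ^ e i)" "{#(a, b), (a', b')#} = {#(d i, e i). i \<in># mset_set {..<r}#}"
    unfolding has_splitting_type_def by (elim exE conjE) blast
  have "size {#(a, b), (a', b')#} = size {#(d i, e i). i \<in># mset_set {..<r}#}" by (simp only: *(5))
  then have r: "r = Suc (Suc 0)" by simp
  have f: "f = K c * (g 0 ^ e 0 * g 1 ^ e 1)" using *(4) r
      by (simp add: scale_eq_K lessThan_Suc mult.commute)
  have "{#(a, b), (a', b')#} = {#(d 0, e 0), (d 1, e 1)#}" using *(5) r
      by (simp add: lessThan_Suc add_mset_commute)
  then consider "a = d 0" "b = e 0" "a' = d 1" "b' = e 1" | "a = d 1" "b = e 1" "a' = d 0" "b' = e 0"
    by (auto simp: add_eq_conv_ex)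
  then show ?R
  proof cases
    case 1
    with * r f show ?thesis by (intro exI[of _ c] exI[of _ "g 0"] exI[of _ "g 1"]) simp
  next
    case 2
    with * r f show ?thesis by (intro exI[of _ c] exI[of _ "g 1"] exI[of _ "g 0"]) (simp add: mult.commute)
  qed
next
  assume ?R
  then obtain c g g' where *: "c \<noteq> 0" "g \<in> forms a" "Factorial_Ring.irreducible g" "b \<ge> 1"
      "g' \<in> forms a'" "Factorial_Ring.irreducible g'" "b' \<ge> 1" "\<not> proportional g g'" "f
          = K c * (g ^ b * g' ^ b')" by blast
  have "\<not> proportional g' g" using *(8) proportional_sym by blast
  with * show ?L unfolding has_splitting_type_def
    by (intro exI[of _ c] exI[of _ "Suc (Suc 0)"] exI[of _ "\<lambda>i. if i
        = 0 then g else g'"] exI[of _ "\<lambda>i. if i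
        = 0 then a else a'"] exI[of _ "\<lambda>i. if i = 0 then b else b'"])
      (auto simp: scale_eq_K lessThan_Suc less_Suc_eq mult.commute add_mset_commute)
qed

lemma has_splitting_type_111:
  assumes "l \<in> lins" "m \<in> lins" "n \<in> lins" "\<not> proportional l m" "\<not> proportional l
      n" "\<not> proportional m n"
  shows "has_splitting_type (l * m * n) {#(1, 1), (1, 1), (1, 1)#}"
proof -
  have s: "\<not> proportional m l" "\<not> proportional n l" "\<not> proportional n m"
      using assms proportional_sym by blast+
  have L: "l \<in> forms (Suc 0)" "m \<in> forms (Suc 0)" "n \<in> forms (Suc 0)" using assms by auto
  show ?thesis unfolding has_splitting_type_def
    using assms(4-6) s L lins_irreducible assms(1-3)
    by (intro exI[of _ 1] exI[of _ "Suc (Suc (Suc 0))"] exI[of _ "\<lambda>i. if i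
        = 0 then l else if i = 1 then m else n"] exI[of _ "\<lambda>i. 1"] exI[of _ "\<lambda>i. 1"])
      (auto simp: scale_eq_K lessThan_Suc less_Suc_eq algebra_simps)
qed

lemma quad_splitting_type:
  assumes "f \<in> quads"
  shows "has_splitting_type f {#(2, 1)#} \<or> has_splitting_type f {#(1, 2)#}
      \<or> has_splitting_type f {#(1, 1), (1, 1)#}"
  using assms
proof (cases f rule: quads_cases)
  case irr
  then have "has_splitting_type f {#(2, 1)#}" unfolding has_splitting_type_1
    using assms by (intro exI[of _ 1] exI[of _ f]) simp
  then show ?thesis by blast
next
  case (prod l l')
  show ?thesis
  proof (cases "proportional l l'")
    case True
    then obtain c where c: "c \<noteq> 0" "l' = K c * l" by (auto simp: proportional_K)
    then have "has_splitting_type f {#(1, 2)#}" unfolding has_splitting_type_1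
      using prod lins_irreducible[OF prod(1)]
          by (intro exI[of _ c] exI[of _ l]) (auto simp: power2_eq_square)
    then show ?thesis by blast
  next
    case False
    then have "has_splitting_type f {#(1, 1), (1, 1)#}" unfolding has_splitting_type_2
      using prod lins_irreducible[OF prod(1)] lins_irreducible[OF prod(2)] 
      by (intro exI[of _ 1] exI[of _ l] exI[of _ l']) auto
    then show ?thesis by blast
  qed
qed

lemma cubic_cases:
  assumes "f \<in> forms 3" "f \<noteq> 0"
  obtains (irr) "Factorial_Ring.irreducible f" | (prod) l g where "l \<in> lins" "g \<in> quads" "f = l * g"
proof (cases "Factorial_Ring.irreducible f")
  case False
  then obtain g h d e where gh: "f = g * h" "g \<in> forms d" "h \<in> forms e" "d + e
      = 3" "d \<noteq> 0" "e \<noteq> 0"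
    using form_irreducible_iff[OF assms] by auto
  then consider "d = 1" "e = 2" | "d = 2" "e = 1" by linarith
  then show ?thesis
  proof cases
    case 1
    with gh assms(2) show ?thesis by (intro prod[of g h]) auto
  next
    case 2
    with gh assms(2) show ?thesis by (intro prod[of h g]) (auto simp: mult.commute)
  qed
qed (rule irr)

lemma splitting_type_12_1:
  assumes "l \<in> lins" "l' \<in> lins" "\<not> proportional l l'" "c \<noteq> 0" "f = K c * (l ^ 2 * l')"
  shows "has_splitting_type f {#(1, 2), (1, 1)#}"
  unfolding has_splitting_type_2
  using assms lins_irreducible[OF assms(1)] lins_irreducible[OF assms(2)]
  by (intro exI[of _ c] exI[of _ l] exI[of _ l']) auto

lemma cubic_splitting_type:
  assumes f: "f \<in> forms 3" "f \<noteq> 0"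
  shows "has_splitting_type f {#(3, 1)#} \<or> has_splitting_type f {#(2, 1), (1, 1)#}
      \<or> has_splitting_type f {#(1, 3)#} \<or>
    has_splitting_type f {#(1, 2), (1, 1)#} \<or> has_splitting_type f {#(1, 1), (1, 1), (1, 1)#}"
  using f
proof (cases f rule: cubic_cases)
  case irr
  then have "has_splitting_type f {#(3, 1)#}" unfolding has_splitting_type_1
    using assms by (intro exI[of _ 1] exI[of _ f]) simp
  then show ?thesis by blast
next
  case (prod l g)
  note l_irr = lins_irreducible[OF prod(1)]
  show ?thesis using prod(2)
  proof (cases g rule: quads_cases)
    case irr
    have "\<not> proportional g l"
    proof
      assume "proportional g l"
      then have "l \<in> quads" using prod(2) proportional_forms by blast
      then show False using forms_degree_unique[of l 1 2] prod(1) by auto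
    qed
    then have "has_splitting_type f {#(2, 1), (1, 1)#}" unfolding has_splitting_type_2
      using prod irr l_irr by (intro exI[of _ 1] exI[of _ g] exI[of _ l]) (auto simp: mult.commute)
    then show ?thesis by blast
  next
    case mn: (prod m n)
    have fe: "f = l * m * n" using prod(3) mn(3) by (simp add: mult.assoc)
    consider (a) "proportional l m" "proportional l n" | (b) "proportional l m" "\<not> proportional l n"
      | (c) "\<not> proportional l m" "proportional l n" | (d) "\<not> proportional l m" "\<not>
          proportional l n" "proportional m n"
      | (e) "\<not> proportional l m" "\<not> proportional l n" "\<not> proportional m n" by blast
    then show ?thesis
    proof cases
      case a
      then obtain c d where cd: "c \<noteq> 0" "m = K c * l" "d \<noteq> 0" "n = K d * l"
          by (auto simp: proportional_K)
      then have "has_splitting_type f {#(1, 3)#}" unfolding has_splitting_type_1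
        using prod l_irr by (intro exI[of _ "c * d"] exI[of _ l]) (auto simp: fe K_mult power3_eq_cube
            algebra_simps)
      then show ?thesis by blast
    next
      case b
      then obtain c where c: "c \<noteq> 0" "m = K c * l" by (auto simp: proportional_K)
      have "has_splitting_type f {#(1, 2), (1, 1)#}"
        by (rule splitting_type_12_1[OF prod(1) mn(2) b(2) c(1)]) (simp add: fe c power2_eq_square
            algebra_simps)
      then show ?thesis by blast
    next
      case c
      then obtain c where c': "c \<noteq> 0" "n = K c * l" by (auto simp: proportional_K)
      have "has_splitting_type f {#(1, 2), (1, 1)#}"
        by (rule splitting_type_12_1[OF prod(1) mn(1) c(1) c'(1)]) (simp add: fe c' power2_eq_square
            algebra_simps)
      then show ?thesis by blast
    next
      case d
      then obtain c where c': "c \<noteq> 0" "n = K c * m" by (auto simp: proportional_K)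
      have d': "\<not> proportional m l" using d(1) proportional_sym by blast
      have "has_splitting_type f {#(1, 2), (1, 1)#}"
        by (rule splitting_type_12_1[OF mn(1) prod(1) d' c'(1)]) (simp add: fe c' power2_eq_square
            algebra_simps)
      then show ?thesis by blast
    next
      case e
      then show ?thesis using has_splitting_type_111[OF prod(1) mn(1,2)] fe by blast
    qed
  qed
qed

section \<open>The rank of the catalecticant\<close>

lemma (in vec_space) rank_factorization:
  assumes A: "A \<in> carrier_mat n nc"
  shows "\<exists>B c. finite B \<and> card B = rank A
      \<and> (\<forall>i<n. \<forall>j<nc. A $$ (i, j) = (\<Sum>b\<in>B. c j b * vec_index b i))"
    and "rank A \<le> n"
proof -
  let ?P = "\<lambda>T. T \<subseteq> set (cols A) \<and> lin_indpt T"
  have C: "set (cols A) \<subseteq> carrier_vec n" using cols_dim A by blast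
  obtain S where S: "maximal S ?P"
    using maximal_exists[of ?P "card (set (cols A))" "{}"]
    by (meson List.finite_set card_mono empty_iff empty_subsetI finite_lin_indpt2 rev_finite_subset)
  then have SA: "S \<subseteq> set (cols A)" and ind: "lin_indpt S" by (auto simp: maximal_def)
  have SC: "S \<subseteq> carrier_vec n" and fin: "finite S" using SA C finite_subset by auto
  have r: "rank A = card S" using rank_card_indpt[OF A S] .
  have sp: "v \<in> span S" if v: "v \<in> set (cols A)" for v
  proof (rule ccontr)
    assume ns: "v \<notin> span S"
    then have "lin_indpt (insert v S)" "v \<notin> S"
      using lin_dep_iff_in_span[OF SC ind, of v] v C span_mem[of S v] SC by auto
    then have "?P (insert v S)" using v SA by blast
    then show False using S \<open>v \<notin> S\<close> unfolding maximal_def by blast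
  qed
  have "\<exists>a. \<forall>i<n. A $$ (i, j) = (\<Sum>b\<in>S. a b * vec_index b i)" if j: "j < nc" for j
  proof -
    have "col A j \<in> set (cols A)" using j A by (metis carrier_matD(2) cols_length cols_nth nth_mem)
    then obtain a where a: "lincomb a S = col A j"
      using finite_in_span[OF fin _ sp] SC by auto
    have "A $$ (i, j) = (\<Sum>b\<in>S. a b * vec_index b i)" if "i < n" for i
      using lincomb_index[OF that SC, of a] a that j A by simp
    then show ?thesis by blast
  qed
  then obtain c where "\<forall>i<n. \<forall>j<nc. A $$ (i, j)
      = (\<Sum>b\<in>S. c j b * vec_index b i)" by metis
  then show "\<exists>B c. finite B \<and> card B = rank A
      \<and> (\<forall>i<n. \<forall>j<nc. A $$ (i, j) = (\<Sum>b\<in>B. c j b * vec_index b i))"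
    using fin r by metis
  show "rank A \<le> n" unfolding r using li_le_dim(2)[OF fin_dim _ ind] SC dim_is_n by simp
qed

lemma (in vec_space) rank_le_2_product_entries:
  assumes A: "A \<in> carrier_mat n nc"
    and e: "\<And>i j. i < n \<Longrightarrow> j < nc \<Longrightarrow> A $$ (i, j) = f i * g j
        + f' i * g' j"
  shows "rank A \<le> 2"
proof -
  let ?B = "mat n nc (\<lambda>(i, j). f i * g j)" and ?C = "mat n nc (\<lambda>(i, j). f' i * g' j)"
  have "A = ?B + ?C" using A e by (intro eq_matI) auto
  then have "rank A \<le> rank ?B + rank ?C" using rank_subadditive[of ?B nc ?C] by simp
  moreover have "rank ?B \<le> 1" by (rule rank_le_1_product_entries[of _ _ f g]) auto
  moreover have "rank ?C \<le> 1" by (rule rank_le_1_product_entries[of _ _ f' g']) auto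
  ultimately show ?thesis by linarith
qed

lemma dual_bform_monom:
  assumes w: "w \<in> dual_forms 5" and mk: "m + k = 5" and j: "j \<le> k"
  shows "w (bform m c * (X ^ (k - j) * Y ^ j)) = (\<Sum>i\<le>m. c i * coord w (i + j))"
proof -
  have e: "K (c i) * X ^ (m - i) * Y ^ i * (X ^ (k - j) * Y ^ j) = K (c i) * (X ^ (5 - (i
      + j)) * Y ^ (i + j))" if "i \<le> m" for i
  proof -
    have x: "X ^ (5 - (i + j)) = X ^ (m - i) * X ^ (k - j)" 
    proof -
      have "5 - (i + j) = (m - i) + (k - j)" using that mk j by linarith
      then show ?thesis by (simp add: power_add)
    qed
    show ?thesis unfolding x power_add by (simp add: algebra_simps)
  qed
  have "w (bform m c * (X ^ (k - j) * Y ^ j)) = w (\<Sum>i\<le>m. K (c i) * (X ^ (5 - (i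
      + j)) * Y ^ (i + j)))"
    unfolding bform_def sum_distrib_right using e by (intro arg_cong[of _ _ w] sum.cong) auto
  also have "\<dots> = (\<Sum>i\<le>m. w (K (c i) * (X ^ (5 - (i + j)) * Y ^ (i + j))))"
    using mk j by (intro dual_sum[OF w] forms_K_mult coord_eq(1)) auto
  also have "\<dots> = (\<Sum>i\<le>m. c i * coord w (i + j))"
  proof (intro sum.cong refl)
    fix i assume "i \<in> {..m}"
    then have "i + j \<le> 5" using mk j by simp
    then show "w (K (c i) * (X ^ (5 - (i + j)) * Y ^ (i + j))) = c i * coord w (i + j)"
      by (simp add: dual_K[OF w coord_eq(1)] coord_eq(2))
  qed
  finally show ?thesis .
qed

lemma bform_apolar_iff:
  assumes w: "w \<in> dual_forms 5" and mk: "m + k = 5"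
  shows "bform m c \<in> apolar_ideal 5 w
      \<longleftrightarrow> (\<forall>j\<le>k. (\<Sum>i\<le>m. c i * coord w (i + j)) = 0)"
proof -
  have "bform m c \<in> apolar_ideal 5 w
      \<longleftrightarrow> (\<forall>h\<in>forms k. w (bform m c * h) = 0)"
    by (rule in_apolar_iff[OF w bform_in_forms mk])
  also have "\<dots> \<longleftrightarrow> (\<forall>j\<le>k. w (bform m c * (X ^ (k - j) * Y ^ j)) = 0)"
  proof
    assume *: "\<forall>h\<in>forms k. w (bform m c * h) = 0"
    show "\<forall>j\<le>k. w (bform m c * (X ^ (k - j) * Y ^ j)) = 0"
    proof (intro allI impI)
      fix j assume "j \<le> k"
      then have "X ^ (k - j) * Y ^ j \<in> (forms k :: 'a bipoly set)"
          using XY_in_forms[of "k - j" j] by simp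
      with * show "w (bform m c * (X ^ (k - j) * Y ^ j)) = 0" by blast
    qed
  next
    assume *: "\<forall>j\<le>k. w (bform m c * (X ^ (k - j) * Y ^ j)) = 0"
    show "\<forall>h\<in>forms k. w (bform m c * h) = 0"
    proof
      fix h :: "'a bipoly" assume h: "h \<in> forms k"
      define d where "d = (\<lambda>i. poly.coeff (poly.coeff h i) (k - i))"
      have hd: "h = bform k d" unfolding d_def by (rule forms_eq_bform[OF h])
      have t: "bform m c * (X ^ (k - j) * Y ^ j) \<in> forms 5" if "j \<le> k" for j
        using forms_mult[OF bform_in_forms XY_in_forms[of "k - j" j], of m c] mk that by simp
      have "bform m c * h = (\<Sum>j\<le>k. K (d j) * (bform m c * (X ^ (k - j) * Y ^ j)))"
        unfolding hd unfolding bform_def[of k] sum_distrib_left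
            by (intro sum.cong refl) (simp add: ac_simps)
      also have "w \<dots> = (\<Sum>j\<le>k. w (K (d j) * (bform m c * (X ^ (k - j) * Y ^ j))))"
        by (intro dual_sum[OF w] forms_K_mult t) auto
      also have "\<dots> = 0" using * t by (intro sum.neutral) (auto simp: dual_K[OF w])
      finally show "w (bform m c * h) = 0" .
    qed
  qed
  also have "\<dots> \<longleftrightarrow> (\<forall>j\<le>k. (\<Sum>i\<le>m. c i * coord w (i + j)) = 0)"
    using dual_bform_monom[OF w mk] by auto
  finally show ?thesis .
qed

lemma lin_apolar_iff:
  assumes w: "w \<in> dual_forms 5"
  shows "lin u v \<in> apolar_ideal 5 w \<longleftrightarrow> (\<forall>j\<le>4. u * coord w j
      + v * coord w (Suc j) = 0)"
  unfolding lin_bform by (subst bform_apolar_iff[OF w, of 1 4]) auto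

lemma quad_apolar_iff:
  assumes w: "w \<in> dual_forms 5"
  shows "quad a b c \<in> apolar_ideal 5 w \<longleftrightarrow> (\<forall>j\<le>3. a * coord w j
      + b * coord w (j + 1) + c * coord w (j + 2) = 0)"
  unfolding quad_bform by (subst bform_apolar_iff[OF w, of 2 3]) (auto simp: sum_atMost_2 add.commute)

text \<open>Over a finite field, a map from the forms of degree \<open>n\<close> to a set with fewer than \<open>q\<^sup>n\<^sup>+\<^sup>1\<close> elements
  identifies two forms. Applied to linear maps, this replaces dimension counts.\<close>

lemma forms_pigeonhole:
  fixes \<phi> :: "(nat \<Rightarrow> 'a::finite_field) \<Rightarrow> 'b::finite"
  assumes "card (UNIV :: 'b set) < card (UNIV :: 'a set) ^ Suc n"
  obtains c d where "bform n c \<noteq> bform n d" "\<phi> c = \<phi> d"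
proof -
  let ?c = "\<lambda>(f :: 'a bipoly) i. poly.coeff (poly.coeff f i) (n - i)"
  have "\<not> inj_on (\<lambda>f. \<phi> (?c f)) (forms n)"
  proof
    assume "inj_on (\<lambda>f. \<phi> (?c f)) (forms n)"
    then have "card (forms n :: 'a bipoly set) \<le> card (UNIV :: 'b set)"
      by (intro card_inj_on_le[of "\<lambda>f. \<phi> (?c f)"]) auto
    with assms show False by (simp add: card_forms)
  qed
  then obtain f g where "f \<in> forms n" "g \<in> forms n" "\<phi> (?c f)
      = \<phi> (?c g)" "f \<noteq> g" by (auto simp: inj_on_def)
  then show ?thesis using that[of "?c f" "?c g"] forms_eq_bform[of f n] forms_eq_bform[of g n] by simp
qed

lemma coord_zero_imp:
  assumes w: "w \<in> dual_forms 5" and z: "\<And>i j. i < 3 \<Longrightarrow> j < 4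
      \<Longrightarrow> coord w (i + j) = 0"
  shows "w = (\<lambda>_. 0)"
proof (rule dual_eq_0I[OF w])
  fix i :: nat assume "i \<le> 5"
  then have "min i 2 < 3" "i - min i 2 < 4" "min i 2 + (i - min i 2) = i" by auto
  with z show "coord w i = 0" by metis
qed

lemma catalecticant_index [simp]: "i < 3 \<Longrightarrow> j < 4
    \<Longrightarrow> catalecticant w $$ (i, j) = coord w (i + j)"
  and catalecticant_carrier [simp]: "catalecticant w \<in> carrier_mat 3 4"
  by (simp_all add: catalecticant_def)

text \<open>If the catalecticant has rank at most one, its minors show that the pairs \<open>(a\<^sub>i, a\<^sub>i\<^sub>+\<^sub>1)\<close> for \<open>i \<le> 4\<close> are
  pairwise proportional, and a nonzero one of them gives the coefficients of an apolar linear form.\<close>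

lemma rank_one_lin:
  fixes w :: "'a::field bipoly \<Rightarrow> 'a"
  assumes w: "w \<in> dual_forms 5" and wnz: "w \<noteq> (\<lambda>_. 0)"
    and fg: "\<And>i j. i < 3 \<Longrightarrow> j < 4 \<Longrightarrow> coord w (i + j) = f i * g j"
  shows "\<exists>l\<in>lins. l \<in> apolar_ideal 5 w"
proof -
  let ?a = "coord w"
  have min: "?a (i1 + j1) * ?a (i2 + j2) = ?a (i1 + j2) * ?a (i2
      + j1)" if "i1 < 3" "i2 < 3" "j1 < 4" "j2 < 4" for i1 i2 j1 j2
    using that by (simp add: fg)
  have m: "?a (Suc i) * ?a j = ?a i * ?a (Suc j)" if "i \<le> 4" "j \<le> 4" "i < j" for i j
  proof -
    \<comment> \<open>only for the outermost pairs is a detour over \<open>a\<^sub>2 a\<^sub>3\<close> needed; all other identities are minors\<close>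
    have "i = 0 \<and> j = 4 \<or> (\<exists>i1 i2 j1 j2. i1 < 3 \<and> i2 < 3 \<and> j1 < 4
        \<and> j2 < 4 \<and>
        i1 + j1 = Suc i \<and> i2 + j2 = j \<and> i1 + j2 = Suc j \<and> i2 + j1 = i)"
    proof (cases "i = 0 \<and> j = 4")
      case False
      define e where "e = (if j = 4 then 1 else 0 :: nat)"
      show ?thesis
        by (rule disjI2, rule exI[of _ "Suc e"], rule exI[of _ e], rule exI[of _ "i - e"], rule exI[of
            _ "j - e"])
          (use False that in \<open>auto simp: e_def\<close>)
    qed simp
    then show ?thesis
    proof
      assume ij: "i = 0 \<and> j = 4"
      have "?a 1 * ?a 4 = ?a 3 * ?a 2" using min[of 0 2 1 2] by (simp add: eval_nat_numeral)
      moreover have "?a 0 * ?a 5 = ?a 3 * ?a 2" using min[of 0 2 0 3] by (simp add: eval_nat_numeral)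
      ultimately show ?thesis using ij by simp
    next
      assume "\<exists>i1 i2 j1 j2. i1 < 3 \<and> i2 < 3 \<and> j1 < 4 \<and> j2 < 4 \<and>
        i1 + j1 = Suc i \<and> i2 + j2 = j \<and> i1 + j2 = Suc j \<and> i2 + j1 = i"
      then obtain i1 i2 j1 j2 where *: "i1 < 3" "i2 < 3" "j1 < 4" "j2 < 4" 
        and e: "i1 + j1 = Suc i" "i2 + j2 = j" "i1 + j2 = Suc j" "i2 + j1 = i" by blast
      show ?thesis using min[OF *] unfolding e by (simp add: mult.commute)
    qed
  qed
  have m': "?a (Suc i) * ?a j = ?a i * ?a (Suc j)" if "i \<le> 4" "j \<le> 4" for i j
    using m[of i j] m[of j i] that by (cases i j rule: linorder_cases) (auto simp: mult.commute)
  obtain k where k: "k \<le> 5" "?a k \<noteq> 0" using dual_eq_0I[OF w] wnz by blast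
  then obtain i where i: "i \<le> 4" "?a i \<noteq> 0 \<or> ?a (Suc i) \<noteq> 0"
  proof (cases "k = 5")
    case True with k that[of 4] show ?thesis by simp
  next
    case False with k that[of k] show ?thesis by simp
  qed
  have "lin (?a (Suc i)) (- ?a i) \<in> apolar_ideal 5 w"
    unfolding lin_apolar_iff[OF w] using m'[OF i(1)] by simp
  moreover have "lin (?a (Suc i)) (- ?a i) \<in> lins" using i(2) by (auto simp: lin_eq_0_iff)
  ultimately show ?thesis by blast
qed

lemma rank_catalecticant_le:
  fixes w :: "'a::field bipoly \<Rightarrow> 'a"
  assumes w: "w \<in> dual_forms 5"
  shows "vec_space.rank 3 (catalecticant w) \<le> 3"
    and "l \<in> lins \<Longrightarrow> l \<in> apolar_ideal 5 w
        \<Longrightarrow> vec_space.rank 3 (catalecticant w) \<le> 1"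
    and "g \<in> quads \<Longrightarrow> g \<in> apolar_ideal 5 w
        \<Longrightarrow> vec_space.rank 3 (catalecticant w) \<le> 2"
proof -
  interpret vec_space "TYPE('a)" 3 .
  let ?a = "coord w"
  show "rank (catalecticant w) \<le> 3"
    by (rule rank_factorization(2)[OF catalecticant_carrier])
  show "rank (catalecticant w) \<le> 1" if l: "l \<in> lins" "l \<in> apolar_ideal 5 w"
  proof -
    obtain u v where uv: "l = lin u v" "u \<noteq> 0 \<or> v \<noteq> 0" using l(1) by (rule linsE)
    have e: "u * ?a j + v * ?a (Suc j) = 0" if "j \<le> 4" for j
      using l(2) that unfolding uv lin_apolar_iff[OF w] by blast
    show ?thesis
    proof (cases "v = 0")
      case True
      then have z: "?a j = 0" if "j \<le> 4" for j using e[OF that] uv(2) by simp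
      show ?thesis
      proof (rule rank_le_1_product_entries[OF catalecticant_carrier, of _ "\<lambda>i. if i
          = 2 then 1 else 0" "\<lambda>j. if j = 3 then ?a 5 else 0"])
        fix i j assume "i < dim_row (catalecticant w)" "j < dim_col (catalecticant w)"
        then have ij: "i < 3" "j < 4" by (simp_all add: catalecticant_def)
        then have "i + j \<le> 4 \<or> i = 2 \<and> j = 3" by linarith
        then show "catalecticant w $$ (i, j) = (if i = 2 then 1 else 0) * (if j = 3 then ?a 5 else 0)"
          using ij z[of "i + j"] by auto
      qed
    next
      case False
      define k where "k = - (u / v)"
      have s: "?a (Suc j) = k * ?a j" if "j \<le> 4" for j
        using e[OF that] False by (simp add: k_def field_simps eq_neg_iff_add_eq_0)
      have p: "?a (i + j) = k ^ i * ?a j" if "i + j \<le> 5" for i j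
        using that by (induction i) (simp_all add: s)
      show ?thesis
        by (rule rank_le_1_product_entries[OF catalecticant_carrier, of _ "\<lambda>i. k ^ i" ?a])
          (simp add: catalecticant_def p)
    qed
  qed
  show "rank (catalecticant w) \<le> 2" if g: "g \<in> quads" "g \<in> apolar_ideal 5 w"
  proof -
    obtain p r s where prs: "g = quad p r s" using g(1) by (auto elim: forms_2E)
    then have nz: "p \<noteq> 0 \<or> r \<noteq> 0 \<or> s \<noteq> 0" using g(1)
        by (auto simp: quad_eq_0_iff)
    have e: "p * ?a j + r * ?a (j + 1) + s * ?a (j + 2) = 0" if "j < 4" for j
      using g(2) that unfolding prs quad_apolar_iff[OF w] by auto
    consider "s \<noteq> 0" | "s = 0" "r \<noteq> 0" | "s = 0" "r = 0" "p \<noteq> 0" using nz by blast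
    then show ?thesis
    proof cases
      case 1
      have x: "?a (2 + j) = - (p / s) * ?a j + - (r / s) * ?a (1 + j)" if "j < 4" for j
      proof -
        have "s * ?a (j + 2) = - (p * ?a j) - r * ?a (j + 1)" using e[OF that]
            by (simp add: eq_neg_iff_add_eq_0 algebra_simps)
        then show ?thesis using 1 by (simp add: field_simps add.commute)
      qed
      show ?thesis
      proof (rule rank_le_2_product_entries[OF catalecticant_carrier, of _
            "\<lambda>i. if i = 0 then 1 else if i = 1 then 0 else - (p / s)" ?a
            "\<lambda>i. if i = 0 then 0 else if i = 1 then 1 else - (r / s)" "\<lambda>j. ?a (1 + j)"])
        fix i j :: nat assume ij: "i < 3" "j < 4"
        then have "i = 0 \<or> i = 1 \<or> i = 2" by linarith
        then show "catalecticant w $$ (i, j) = (if i = 0 then 1 else if i = 1 then 0 else - (p / s)) * ?a j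
           + (if i = 0 then 0 else if i = 1 then 1 else - (r / s)) * ?a (1 + j)"
          using ij x[OF ij(2)] by auto
      qed
    next
      case 2
      have x: "?a (1 + j) = - (p / r) * ?a j" if "j < 4" for j
        using e[OF that] 2 by (simp add: field_simps eq_neg_iff_add_eq_0)
      show ?thesis
      proof (rule rank_le_2_product_entries[OF catalecticant_carrier, of _
            "\<lambda>i. if i = 0 then 1 else if i = 1 then - (p / r) else 0" ?a
            "\<lambda>i. if i = 2 then 1 else 0" "\<lambda>j. ?a (2 + j)"])
        fix i j :: nat assume ij: "i < 3" "j < 4"
        then have "i = 0 \<or> i = 1 \<or> i = 2" by linarith
        then show "catalecticant w $$ (i, j) = (if i = 0 then 1 else if i = 1 then - (p / r) else 0) * ?a j
           + (if i = 2 then 1 else 0) * ?a (2 + j)"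
          using ij x[OF ij(2)] by auto
      qed
    next
      case 3
      have x: "?a j = 0" if "j < 4" for j using e[OF that] 3 by simp
      show ?thesis
      proof (rule rank_le_2_product_entries[OF catalecticant_carrier, of _
            "\<lambda>i. if i = 1 then 1 else 0" "\<lambda>j. ?a (1 + j)"
            "\<lambda>i. if i = 2 then 1 else 0" "\<lambda>j. ?a (2 + j)"])
        fix i j :: nat assume ij: "i < 3" "j < 4"
        then have "i = 0 \<or> i = 1 \<or> i = 2" by linarith
        then show "catalecticant w $$ (i, j) = (if i = 1 then 1 else 0) * ?a (1 + j)
           + (if i = 2 then 1 else 0) * ?a (2 + j)"
          using ij x[OF ij(2)] by auto
      qed
    qed
  qed
qed

lemma rank_catalecticant_form:
  fixes w :: "'a::finite_field bipoly \<Rightarrow> 'a"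
  assumes w: "w \<in> dual_forms 5" and wnz: "w \<noteq> (\<lambda>_. 0)"
  shows "\<exists>f\<in>forms (vec_space.rank 3 (catalecticant w)). f \<noteq> 0
      \<and> f \<in> apolar_ideal 5 w"
    and "vec_space.rank 3 (catalecticant w) \<noteq> 0"
proof -
  interpret vec_space "TYPE('a)" 3 .
  let ?a = "coord w"
  let ?r = "rank (catalecticant w)"
  obtain B c where B: "finite B" "card B = ?r"
    "\<forall>i<3. \<forall>j<4. catalecticant w $$ (i, j) = (\<Sum>b\<in>B. c j b * vec_index b i)"
    using rank_factorization(1)[OF catalecticant_carrier[of w]] by blast
  have r3: "?r \<le> 3" by (rule rank_factorization(2)[OF catalecticant_carrier])
  have a: "?a (i + j) = (\<Sum>b\<in>B. c j b * vec_index b i)" if "i < 3" "j < 4" for i j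
    using B(3) that by (metis catalecticant_index)
  show r0: "?r \<noteq> 0"
  proof
    assume "?r = 0"
    then have "B = {}" using B(1,2) by simp
    then show False using coord_zero_imp[OF w] a wnz by simp
  qed
  have q: "card (UNIV :: 'a set) \<ge> 2" by (rule card_field_ge_2)
  have pow: "card (UNIV :: 'a set) ^ m < card (UNIV :: 'a set) ^ n" if "m < n" for m n
    using that q by (intro power_strict_increasing) auto
  have cards: "card (UNIV :: ('a \<times> 'a) set) = card (UNIV :: 'a set) ^ 2"
    "card (UNIV :: ('a \<times> 'a \<times> 'a) set) = card (UNIV :: 'a set) ^ 3"
    unfolding UNIV_Times_UNIV[symmetric] card_cartesian_product
        by (simp_all add: power2_eq_square power3_eq_cube)
  have sub: "bform n c - bform n d
      = bform n (\<lambda>i. c i - d i)" for n and c d :: "nat \<Rightarrow> 'a"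
    by (simp add: bform_def sum_subtractf K_diff algebra_simps)
  have "?r = 1 \<or> ?r = 2 \<or> ?r = 3" using r0 r3 by linarith
  then show "\<exists>f\<in>forms ?r. f \<noteq> 0 \<and> f \<in> apolar_ideal 5 w"
  proof (elim disjE)
    assume r: "?r = 1"
    then obtain b where "B = {b}" using B(2) card_1_singletonE by metis
    then have "?a (i + j) = vec_index b i * c j b" if "i < 3" "j < 4" for i j
      using a[OF that] by (simp add: mult.commute)
    from rank_one_lin[OF w wnz this] show ?thesis using r by auto
  next
    assume r: "?r = 2"
    then obtain b b' where b: "B = {b, b'}" "b \<noteq> b'" using B(2) by (metis card_2_iff)
    obtain p p' where p: "bform 2 p \<noteq> bform 2 p'"
      "((\<Sum>i\<le>2. p i * vec_index b i), (\<Sum>i\<le>2. p i * vec_index b' i))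
          = ((\<Sum>i\<le>2. p' i * vec_index b i), (\<Sum>i\<le>2. p' i * vec_index b' i))"
    proof (rule forms_pigeonhole[of 2 "\<lambda>p. ((\<Sum>i\<le>2. p i * vec_index b i),
        (\<Sum>i\<le>2. p i * vec_index b' i))"])
      show "card (UNIV :: ('a \<times> 'a) set) < card (UNIV :: 'a set) ^ Suc 2"
        unfolding cards by (rule pow) simp
    qed
    define d where "d = (\<lambda>i. p i - p' i)"
    have d: "(\<Sum>i\<le>2. d i * vec_index b i) = 0" "(\<Sum>i\<le>2. d i * vec_index b' i) = 0"
      using p(2) by (simp_all add: d_def left_diff_distrib sum_subtractf)
    have "bform 2 d \<in> apolar_ideal 5 w"
    proof (subst bform_apolar_iff[OF w, of 2 3]; (intro allI impI)?)
      fix j :: nat assume j: "j \<le> 3"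
      have "(\<Sum>i\<le>2. d i * ?a (i + j)) = (\<Sum>i\<le>2. c j b * (d i * vec_index b i)
          + c j b' * (d i * vec_index b' i))"
        using j a b by (intro sum.cong refl) (auto simp: algebra_simps)
      also have "\<dots> = 0" unfolding sum.distrib sum_distrib_left[symmetric] d by simp
      finally show "(\<Sum>i\<le>2. d i * ?a (i + j)) = 0" .
    qed simp
    moreover have "bform 2 d \<noteq> 0" using p(1) unfolding d_def sub[symmetric] by simp
    ultimately show ?thesis using r by auto
  next
    assume r: "?r = 3"
    let ?\<phi> = "\<lambda>p j. \<Sum>i\<le>3. p i * ?a (i + j)"
    obtain p p' where p: "bform 3 p \<noteq> bform 3 p'" "(?\<phi> p 0, ?\<phi> p 1, ?\<phi> p 2)
        = (?\<phi> p' 0, ?\<phi> p' 1, ?\<phi> p' 2)"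
    proof (rule forms_pigeonhole[of 3 "\<lambda>p. (?\<phi> p 0, ?\<phi> p 1, ?\<phi> p 2)"])
      show "card (UNIV :: ('a \<times> 'a \<times> 'a) set) < card (UNIV :: 'a set) ^ Suc 3"
        unfolding cards by (rule pow) simp
    qed
    define d where "d = (\<lambda>i. p i - p' i)"
    have d: "?\<phi> d 0 = 0" "?\<phi> d 1 = 0" "?\<phi> d 2 = 0"
      using p(2) unfolding prod.inject d_def left_diff_distrib sum_subtractf by simp_all
    have "bform 3 d \<in> apolar_ideal 5 w"
    proof (subst bform_apolar_iff[OF w, of 3 2]; (intro allI impI)?)
      fix j :: nat assume "j \<le> 2"
      then have "j = 0 \<or> j = 1 \<or> j = 2" by linarith
      then show "(\<Sum>i\<le>3. d i * ?a (i + j)) = 0" using d by auto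
    qed simp
    moreover have "bform 3 d \<noteq> 0" using p(1) unfolding d_def sub[symmetric] by simp
    ultimately show ?thesis using r by auto
  qed
qed

lemma rank_catalecticant_minimal:
  fixes w :: "'a::finite_field bipoly \<Rightarrow> 'a"
  assumes w: "w \<in> dual_forms 5" and wnz: "w \<noteq> (\<lambda>_. 0)"
    and f: "f \<in> forms m" "f \<noteq> 0" "f \<in> apolar_ideal 5 w"
  shows "vec_space.rank 3 (catalecticant w) \<le> m"
proof -
  have "m \<noteq> 0"
  proof
    assume "m = 0"
    then obtain c where c: "f = K c" "c \<noteq> 0" using f by (auto elim: forms_0E)
    have "w h = 0" if "h \<in> forms 5" for h
    proof -
      have "w (f * h) = 0" using in_apolar_iff[OF w f(1), of 5] f(3) that \<open>m = 0\<close> by simp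
      then show ?thesis using c dual_K[OF w that] by simp
    qed
    then have "w h = 0" for h using w by (cases "h \<in> forms 5") (simp_all add: dual_forms_def)
    then have "w = (\<lambda>_. 0)" by blast
    with wnz show False ..
  qed
  then consider "m = 1" | "m = 2" | "m \<ge> 3" by linarith
  then show ?thesis
    using rank_catalecticant_le[OF w] f by cases (auto intro: order_trans)
qed

lemma waring_generator_iff:
  fixes w :: "'a::finite_field bipoly \<Rightarrow> 'a"
  assumes w: "w \<in> dual_forms 5" and wnz: "w \<noteq> (\<lambda>_. 0)"
  shows "waring_generator w \<phi>
      \<longleftrightarrow> \<phi> \<in> forms (vec_space.rank 3 (catalecticant w))
      \<and> \<phi> \<noteq> 0 \<and> \<phi> \<in> apolar_ideal 5 w"
  unfolding waring_generator_def using rank_catalecticant_minimal[OF w wnz] by blast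

lemma waring_type_square:
  fixes w :: "'a::finite_field bipoly \<Rightarrow> 'a"
  assumes w: "w \<in> dual_forms 5" and wnz: "w \<noteq> (\<lambda>_. 0)"
  shows "has_waring_type w {#(1, 1)#} \<or> has_waring_type w {#(1, 2)#}
      \<longleftrightarrow> apolar_lins w \<noteq> {}" (is "?L \<longleftrightarrow> ?R")
proof
  assume ?L
  then obtain \<phi> b where phi: "waring_generator w \<phi>" "has_splitting_type \<phi> {#(1, b)#}" "b
      = 1 \<or> b = 2"
    using wnz unfolding has_waring_type_def by auto
  then obtain c l where cl: "c \<noteq> 0" "l \<in> forms 1" "Factorial_Ring.irreducible l" "\<phi>
      = K c * l ^ b"
    unfolding has_splitting_type_1 by blast
  have ap: "\<phi> \<in> apolar_ideal 5 w" using phi(1) by (simp add: waring_generator_def)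
  have p: "proportional \<phi> (l ^ b)" using cl proportional_sym[of "l ^ b" \<phi>]
      by (auto simp: proportional_K)
  have lb: "l ^ b \<in> forms b" using forms_power[OF cl(2), of b] by simp
  then have pf: "\<phi> \<in> forms b" unfolding cl(4) by (rule forms_K_mult)
  then have "l ^ b \<in> apolar_ideal 5 w" using apolar_proportional[OF w pf _ p] ap phi(3) by auto
  then have "l ^ 2 \<in> apolar_ideal 5 w"
    using phi(3) apolar_mult[OF w cl(2) _ cl(2)] by (auto simp: power2_eq_square)
  moreover have "l \<in> lins" using cl(2,3) by auto
  ultimately show ?R by (auto simp: apolar_lins_def)
next
  assume ?R
  then obtain l where l: "l \<in> lins" "l ^ 2 \<in> apolar_ideal 5 w" by (auto simp: apolar_lins_def)
  let ?r = "vec_space.rank 3 (catalecticant w)"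
  have l2: "l ^ 2 \<in> quads" using l(1) forms_power[of l 1 2] by auto
  then have "?r \<le> 2" using rank_catalecticant_le(3)[OF w] l(2) by blast
  then have "?r = 1 \<or> ?r = 2" using rank_catalecticant_form(2)[OF w wnz] by linarith
  then show ?L
  proof
    assume r: "?r = 1"
    then obtain \<phi> where phi: "\<phi> \<in> lins" "\<phi> \<in> apolar_ideal 5 w"
      using rank_catalecticant_form(1)[OF w wnz] by auto
    then have "waring_generator w \<phi>" using r by (auto simp: waring_generator_iff[OF w wnz])
    moreover have "has_splitting_type \<phi> {#(1, 1)#}"
      unfolding has_splitting_type_1 using phi(1) lins_irreducible[OF phi(1)]
          by (intro exI[of _ 1] exI[of _ \<phi>]) auto
    ultimately show ?thesis using wnz unfolding has_waring_type_def by auto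
  next
    assume r: "?r = 2"
    then have "waring_generator w (l ^ 2)" using l2 l(2) by (auto simp: waring_generator_iff[OF w wnz])
    moreover have "has_splitting_type (l ^ 2) {#(1, 2)#}"
      unfolding has_splitting_type_1 using l(1) lins_irreducible[OF l(1)]
          by (intro exI[of _ 1] exI[of _ l]) auto
    ultimately show ?thesis using wnz unfolding has_waring_type_def by auto
  qed
qed

lemma waring_type_cases:
  fixes w :: "'a::finite_field bipoly \<Rightarrow> 'a"
  assumes w: "w \<in> dual_forms 5" and wnz: "w \<noteq> (\<lambda>_. 0)"
    and "\<not> has_waring_type w {#(1, 1)#}" "\<not> has_waring_type w {#(1, 2)#}"
  shows "has_waring_type w {#(1, 1), (1, 1)#} \<or> has_waring_type w {#(2, 1)#}
      \<or> has_waring_type w {#(1, 3)#} \<or>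
    has_waring_type w {#(1, 2), (1, 1)#} \<or> has_waring_type w {#(1, 1), (1, 1), (1, 1)#} \<or>
    has_waring_type w {#(2, 1), (1, 1)#} \<or> has_waring_type w {#(3, 1)#}"
proof -
  let ?r = "vec_space.rank 3 (catalecticant w)"
  obtain \<phi> where phi: "\<phi> \<in> forms ?r" "\<phi> \<noteq> 0" "\<phi> \<in> apolar_ideal 5 w"
    using rank_catalecticant_form(1)[OF w wnz] by blast
  then have gen: "waring_generator w \<phi>" by (simp add: waring_generator_iff[OF w wnz])
  have T: "has_waring_type w T" if "has_splitting_type \<phi> T" for T
    using gen that wnz unfolding has_waring_type_def by auto
  have "?r \<le> 3" "?r \<noteq> 0"
      using rank_catalecticant_le(1)[OF w] rank_catalecticant_form(2)[OF w wnz] by auto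
  then consider "?r = 1" | "?r = 2" | "?r = 3" by linarith
  then show ?thesis
  proof cases
    case 1
    then have l: "\<phi> \<in> lins" using phi by auto
    have "has_splitting_type \<phi> {#(1, 1)#}"
      unfolding has_splitting_type_1 using l lins_irreducible[OF l]
          by (intro exI[of _ 1] exI[of _ \<phi>]) auto
    then show ?thesis using T assms(3) by blast
  next
    case 2
    then have "\<phi> \<in> quads" using phi by auto
    from quad_splitting_type[OF this] show ?thesis using T assms(4) by blast
  next
    case 3
    then have "\<phi> \<in> forms 3" using phi by auto
    from cubic_splitting_type[OF this phi(2)] show ?thesis using T by blast
  qed
qed

section \<open>The values of C and the transform\<close>

text \<open>If the two equations were dependent, with coefficients \<open>u\<close>, \<open>v\<close>, then \<open>b j = u a\<^sub>j + v a\<^sub>j\<^sub>+\<^sub>1\<close> would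
  vanish for even \<open>j\<close>, and by the recurrence defined by \<open>g\<close> also for odd \<open>j\<close>, which makes
  \<open>u x + v y\<close> apolar. The middle coefficient of \<open>g\<close> is nonzero, as otherwise \<open>g\<close> is a square.\<close>

lemma C_const_quad:
  fixes w :: "'a::finite_field bipoly \<Rightarrow> 'a"
  assumes char: "CHAR('a) = 2" and w: "w \<in> dual_forms 5" and wnz: "w \<noteq> (\<lambda>_. 0)"
    and E: "apolar_lins w = {}" and g: "g \<in> quads" "g \<in> apolar_ideal 5 w"
  shows "C_const w = - eps g"
proof -
  have gq: "g \<in> apolar_quads w"
    using g apolar_mult[OF w _ g(2), of 2 g 2] by (auto simp: apolar_quads_def power2_eq_square)
  show ?thesis
  proof (rule apolar_dichotomy[OF char w wnz refl])
    fix g0 assume "apolar_quads w = {g. proportional g0 g}" "C_const w = - eps g0"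
    then show ?thesis using gq eps_proportional by auto
  next
    fix u v assume uv: "u \<noteq> 0 \<or> v \<noteq> 0" "rows_dependent w u v"
    let ?a = "coord w"
    obtain p r s where prs: "g = quad p r s" using g(1) by (auto elim: forms_2E)
    have r: "r \<noteq> 0"
    proof
      assume "r = 0"
      obtain p' where p': "p = p' ^ 2" by (rule char2_sqrt[OF char])
      obtain s' where s': "s = s' ^ 2" by (rule char2_sqrt[OF char])
      have "g = lin p' s' ^ 2"
        unfolding prs \<open>r = 0\<close> p' s' lin_def char2_add_square[OF char]
            by (simp add: quad_def K_power power_mult_distrib)
      then have "lin p' s' \<in> apolar_lins w" using g by (auto simp: apolar_lins_def)
      with E show False by blast
    qed
    have e: "p * ?a j + r * ?a (Suc j) + s * ?a (Suc (Suc j)) = 0" if "j \<le> 3" for j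
      using g(2) that unfolding prs quad_apolar_iff[OF w] by auto
    define b where "b j = u * ?a j + v * ?a (Suc j)" for j
    have b0: "b 0 = 0" "b 2 = 0" "b 4 = 0" using uv(2)
        by (simp_all add: b_def rows_dependent_def eval_nat_numeral)
    have rec: "p * b j + r * b (Suc j) + s * b (Suc (Suc j)) = 0" if "j \<le> 2" for j
    proof -
      have "p * b j + r * b (Suc j) + s * b (Suc (Suc j)) =
          u * (p * ?a j + r * ?a (Suc j) + s * ?a (Suc (Suc j))) + v * (p * ?a (Suc j)
              + r * ?a (Suc (Suc j)) + s * ?a (Suc (Suc (Suc j))))"
        by (simp add: b_def algebra_simps)
      also have "\<dots> = 0" using e[of j] e[of "Suc j"] that by simp
      finally show ?thesis .
    qed
    have b1: "b 1 = 0" "b 3 = 0" using rec[of 0] rec[of 2] b0 r by (simp_all add: eval_nat_numeral)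
    have "b j = 0" if "j \<le> 4" for j
    proof -
      have "j = 0 \<or> j = 1 \<or> j = 2 \<or> j = 3 \<or> j = 4" using that by linarith
      then show ?thesis using b0 b1 by blast
    qed
    then have "lin u v \<in> apolar_ideal 5 w" unfolding lin_apolar_iff[OF w] b_def by blast
    then have "lin u v ^ 2 \<in> apolar_ideal 5 w"
      using apolar_mult[OF w lin_in_forms(1) _ lin_in_forms(1)] by (simp add: power2_eq_square)
    then have "lin u v \<in> apolar_lins w" using uv(1) by (simp add: apolar_lins_def lin_eq_0_iff)
    with E show ?thesis by blast
  next
    assume "apolar_lins w \<noteq> {}"
    with E show ?thesis by blast
  qed
qed

lemma C_const_apolar_quad:
  fixes w :: "'a::finite_field bipoly \<Rightarrow> 'a"
  assumes char: "CHAR('a) = 2" and w: "w \<in> dual_forms 5" and wnz: "w \<noteq> (\<lambda>_. 0)"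
    and E: "apolar_lins w = {}" and g: "g \<in> apolar_quads w"
  shows "C_const w \<in> {0, - eps g}"
  by (rule apolar_dichotomy[OF char w wnz refl]) (use g E eps_proportional in auto)

lemma eps_values:
  assumes "g \<in> quads" shows "eps g \<in> {0, 1, - 1}"
  using assms
proof (cases g rule: quads_cases)
  case irr
  then show ?thesis using eps_inert[OF assms irr] by simp
next
  case (prod l l')
  then show ?thesis using eps_split[OF prod(1,2)] eps_ramified[OF prod(1,2)]
      by (cases "proportional l l'") auto
qed

lemma C_const_values:
  fixes w :: "'a::finite_field bipoly \<Rightarrow> 'a"
  assumes char: "CHAR('a) = 2" and w: "w \<in> dual_forms 5" and wnz: "w \<noteq> (\<lambda>_. 0)"
    and E: "apolar_lins w = {}"
  shows "C_const w \<in> {0, 1, - 1}"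
proof (rule apolar_dichotomy[OF char w wnz refl])
  fix g0 assume "g0 \<in> quads" "C_const w = - eps g0"
  then show ?thesis using eps_values[of g0] by auto
qed (use E in auto)

lemma waring_typeE:
  fixes w :: "'a::finite_field bipoly \<Rightarrow> 'a"
  assumes w: "w \<in> dual_forms 5" and wnz: "w \<noteq> (\<lambda>_. 0)" and "has_waring_type w T"
  obtains \<phi> where "\<phi> \<noteq> 0" "\<phi> \<in> apolar_ideal 5 w" "has_splitting_type \<phi> T"
  using assms unfolding has_waring_type_def waring_generator_def by auto

lemma apolar_K_cancel:
  assumes w: "w \<in> dual_forms n" and "f \<in> forms m" "m \<le> n" "c \<noteq> 0" "K c * f \<in>
      apolar_ideal n w"
  shows "f \<in> apolar_ideal n w"
proof -
  have "proportional f (K c * f)" using assms(4) by (auto simp: proportional_K)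
  from apolar_proportional[OF w assms(2,3) this] show ?thesis using assms(5) by blast
qed

lemma C_const_waring_type:
  fixes w :: "'a::finite_field bipoly \<Rightarrow> 'a"
  assumes char: "CHAR('a) = 2" and w: "w \<in> dual_forms 5" and wnz: "w \<noteq> (\<lambda>_. 0)"
    and E: "apolar_lins w = {}"
  shows "has_waring_type w {#(1, 1), (1, 1)#} \<Longrightarrow> C_const w = - 1"
    and "has_waring_type w {#(2, 1)#} \<Longrightarrow> C_const w = 1"
    and "has_waring_type w {#(1, 3)#} \<Longrightarrow> C_const w = 0"
    and "has_waring_type w {#(1, 2), (1, 1)#} \<Longrightarrow> C_const w \<in> {0, - 1}"
proof -
  assume "has_waring_type w {#(1, 1), (1, 1)#}"
  then obtain \<phi> where phi: "\<phi> \<noteq> 0" "\<phi> \<in> apolar_ideal 5 w" "has_splitting_type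
      \<phi> {#(1, 1), (1, 1)#}"
    by (rule waring_typeE[OF w wnz])
  then obtain c l l' where *: "c \<noteq> 0" "l \<in> lins" "l' \<in> lins" "\<not> proportional l l'"
      "\<phi> = K c * (l * l')"
    unfolding has_splitting_type_2 by (auto simp: irreducible_def)
  have q: "l * l' \<in> quads" using *(2,3) by (rule lins_mult)
  have "l * l' \<in> apolar_ideal 5 w"
    by (rule apolar_K_cancel[OF w, of _ 2 c]) (use q phi * in auto)
  from C_const_quad[OF char w wnz E q this] show "C_const w = - 1" by (simp add: eps_split[OF *(2-4)])
next
  assume "has_waring_type w {#(2, 1)#}"
  then obtain \<phi> where phi: "\<phi> \<noteq> 0" "\<phi> \<in> apolar_ideal 5 w" "has_splitting_type
      \<phi> {#(2, 1)#}"
    by (rule waring_typeE[OF w wnz])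
  then obtain c g where *: "c \<noteq> 0" "g \<in> quads" "Factorial_Ring.irreducible g" "\<phi> = K c * g"
    unfolding has_splitting_type_1 by (auto simp: irreducible_def)
  have "g \<in> apolar_ideal 5 w"
    by (rule apolar_K_cancel[OF w, of _ 2 c]) (use phi * in auto)
  from C_const_quad[OF char w wnz E *(2) this] show "C_const w = 1" by (simp add: eps_inert[OF *(2,3)])
next
  assume "has_waring_type w {#(1, 3)#}"
  then obtain \<phi> where phi: "\<phi> \<noteq> 0" "\<phi> \<in> apolar_ideal 5 w" "has_splitting_type
      \<phi> {#(1, 3)#}"
    by (rule waring_typeE[OF w wnz])
  then obtain c l where *: "c \<noteq> 0" "l \<in> lins" "\<phi> = K c * l ^ 3"
    unfolding has_splitting_type_1 by (auto simp: irreducible_def)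
  have l3: "l ^ 3 \<in> forms 3" and l1: "l \<in> forms 1" using *(2) forms_power[of l 1 3] by auto
  have "l ^ 3 \<in> apolar_ideal 5 w"
    by (rule apolar_K_cancel[OF w l3, of c]) (use phi * in auto)
  from apolar_mult[OF w l3 this l1] have "(l * l) ^ 2 \<in> apolar_ideal 5 w"
    by (simp add: power2_eq_square power3_eq_cube mult.assoc)
  then have "l * l \<in> apolar_quads w" using lins_mult[OF *(2,2)] by (simp add: apolar_quads_def)
  from C_const_apolar_quad[OF char w wnz E this] show "C_const w = 0"
    by (simp add: eps_ramified[OF *(2,2)])
next
  assume "has_waring_type w {#(1, 2), (1, 1)#}"
  then obtain \<phi> where phi: "\<phi> \<noteq> 0" "\<phi> \<in> apolar_ideal 5 w" "has_splitting_type
      \<phi> {#(1, 2), (1, 1)#}"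
    by (rule waring_typeE[OF w wnz])
  then obtain c l l' where *: "c \<noteq> 0" "l \<in> lins" "l' \<in> lins" "\<not> proportional l l'"
      "\<phi> = K c * (l ^ 2 * l')"
    unfolding has_splitting_type_2 by (auto simp: irreducible_def)
  have l1: "l' \<in> forms 1" "l ^ 2 \<in> forms 2" using *(2,3) forms_power[of l 1 2] by auto
  have l3: "l ^ 2 * l' \<in> forms 3" using forms_mult[OF l1(2,1)] by simp
  have "l ^ 2 * l' \<in> apolar_ideal 5 w"
    by (rule apolar_K_cancel[OF w l3, of c]) (use phi * in auto)
  from apolar_mult[OF w l3 this l1(1)] have "(l * l') ^ 2 \<in> apolar_ideal 5 w"
    by (simp add: power2_eq_square mult_ac)
  then have "l * l' \<in> apolar_quads w" using lins_mult[OF *(2,3)] by (simp add: apolar_quads_def)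
  from C_const_apolar_quad[OF char w wnz E this] show "C_const w \<in> {0, - 1}"
    by (simp add: eps_split[OF *(2-4)])
qed

lemma Phi_hat_formula:
  fixes \<psi> :: "'a::finite_field \<Rightarrow> complex"
  assumes char: "CHAR('a) = 2" and psi: "nontrivial_additive_character \<psi>"
    and w: "w \<in> dual_forms 5" and q: "q = of_nat (card (UNIV :: 'a set))"
  shows "Phi_hat \<psi> w = of_nat (card (apolar_lins w)) / (q - 1) / q ^ 2 + C_const w / q ^ 4"
proof -
  have "of_nat (card (UNIV :: 'a set)) \<noteq> (of_nat 1 :: complex)" "q \<noteq> 0"
    using card_field_ge_2[where 'a = 'a] unfolding q of_nat_eq_iff by auto
  then have q0: "q \<noteq> 0" "q - 1 \<noteq> 0" unfolding q by auto
  have "(\<Sum>g\<in>apolar_quads w. eps g) = - ((q - 1) * C_const w)"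
    using C_const_sum[OF w q] by simp
  then have "q ^ 6 * (q - 1) * Phi_hat \<psi> w = q ^ 4 * of_nat (card (apolar_lins w))
      + q ^ 2 * ((q - 1) * C_const w)"
    using Phi_hat_sum[OF char psi w q] by simp
  also have "\<dots> = q ^ 6 * (q - 1) * (of_nat (card (apolar_lins w)) / (q - 1) / q ^ 2
      + C_const w / q ^ 4)"
    using q0 by (simp add: field_simps eval_nat_numeral)
  finally show ?thesis using q0 by simp
qed

theorem theoremA1:
  fixes \<psi> :: "'a::finite_field \<Rightarrow> complex"
    and w :: "'a bipoly \<Rightarrow> 'a"
    and q :: complex
  assumes "CHAR('a) = 2"
    and "q = of_nat (card (UNIV :: 'a set))"
    and "nontrivial_additive_character \<psi>"
    and "w \<in> dual_forms 5"
  shows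
    "Phi_hat \<psi> w =
       (if w = (\<lambda>_. 0) then 1 / q + 1 / q ^ 2 - 1 / q ^ 3
        else if has_waring_type w {#(1, 1)#} \<or> has_waring_type w {#(1, 2)#}
          then 1 / q ^ 2 - 1 / q ^ 3
        else C_const w / q ^ 4)
     \<and>
     (w \<noteq> (\<lambda>_. 0) \<and> \<not> has_waring_type w {#(1, 1)#} \<and> \<not> has_waring_type w {#(1, 2)#} \<longrightarrow>
        (has_waring_type w {#(1, 1), (1, 1)#} \<longrightarrow> C_const w \<in> {- 1}) \<and>
        (has_waring_type w {#(2, 1)#} \<longrightarrow> C_const w \<in> {1}) \<and>
        (has_waring_type w {#(1, 3)#} \<longrightarrow> C_const w \<in> {0}) \<and>
        (has_waring_type w {#(1, 2), (1, 1)#} \<longrightarrow> C_const w \<in> {0, - 1}) \<and>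
        (\<not> has_waring_type w {#(1, 1), (1, 1)#} \<and> \<not> has_waring_type w {#(2, 1)#} \<and>
         \<not> has_waring_type w {#(1, 3)#} \<and> \<not> has_waring_type w {#(1, 2), (1, 1)#} \<longrightarrow>
           (has_waring_type w {#(1, 1), (1, 1), (1, 1)#} \<or>
            has_waring_type w {#(2, 1), (1, 1)#} \<or>
            has_waring_type w {#(3, 1)#}) \<and>
           C_const w \<in> {0, 1, - 1}))"
proof -
  note char = assms(1) and q = assms(2) and psi = assms(3) and w = assms(4)
  note Phi = Phi_hat_formula[OF char psi w q]
  have N: "card (UNIV :: 'a set) \<ge> 2" by (rule card_field_ge_2)
  then have q1: "of_nat (card (UNIV :: 'a set) - 1) = q - 1" "of_nat (card (UNIV :: 'a set) ^ 2 - 1)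
      = q ^ 2 - 1"
    unfolding q by (simp_all add: of_nat_diff)
  have "of_nat (card (UNIV :: 'a set)) \<noteq> (of_nat 1 :: complex)" "q \<noteq> 0"
    using N unfolding q of_nat_eq_iff by auto
  then have q0: "q \<noteq> 0" "q - 1 \<noteq> 0" unfolding q by auto
  show ?thesis
  proof (cases "w = (\<lambda>_. 0)")
    case True
    have ap: "f \<in> apolar_ideal 5 w" for f
      by (simp add: apolar_ideal_def polar_def True)
    then have "apolar_lins w = lins" "apolar_quads w = quads"
      by (auto simp: apolar_lins_def apolar_quads_def)
    then have "of_nat (card (apolar_lins w)) = q ^ 2 - 1" "(\<Sum>g\<in>apolar_quads w. eps g)
        = q * (q - 1)"
      using card_lins[where 'a = 'a] sum_eps_quads[where 'a = 'a] q1 q by simp_all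
    moreover from this have "(q - 1) * C_const w = (q - 1) * (- q)"
      using C_const_sum[OF w q] by (simp add: mult.commute)
    then have "C_const w = - q" using q0 by (subst (asm) mult_left_cancel) auto
    ultimately have "Phi_hat \<psi> w = (q ^ 2 - 1) / (q - 1) / q ^ 2 + - q / q ^ 4" using Phi by simp
    also have "(q ^ 2 - 1) / (q - 1) = q + 1"
      using q0 by (simp add: field_simps power2_eq_square)
    also have "(q + 1) / q ^ 2 + - q / q ^ 4 = 1 / q + 1 / q ^ 2 - 1 / q ^ 3"
      using q0 by (simp add: field_simps eval_nat_numeral)
    finally show ?thesis using True by simp
  next
    case wnz: False
    note sq = waring_type_square[OF w wnz]
    show ?thesis
    proof (cases "apolar_lins w = {}")
      case False
      have "card (apolar_lins w) = card (UNIV :: 'a set) - 1 \<and> C_const w = - q"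
        by (rule apolar_dichotomy[OF char w wnz q]) (use False in auto)
      then have "Phi_hat \<psi> w = 1 / q ^ 2 + - q / q ^ 4" using Phi q1 q0 by simp
      also have "\<dots> = 1 / q ^ 2 - 1 / q ^ 3" using q0 by (simp add: field_simps eval_nat_numeral)
      finally show ?thesis using wnz sq False by auto
    next
      case E: True
      have "Phi_hat \<psi> w = C_const w / q ^ 4" using Phi E by simp
      moreover have n: "\<not> has_waring_type w {#(1, 1)#}" "\<not> has_waring_type w {#(1, 2)#}"
          using sq E by auto
      ultimately show ?thesis
        using wnz C_const_waring_type[OF char w wnz E] C_const_values[OF char w wnz E]
            waring_type_cases[OF w wnz n]
        by auto
    qed
  qed
qed

end
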